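(* Let $J_0\in\mathcal{A}$. In the local chart $\Phi:\mathcal{U}(J_0)\to\mathcal{V}(J_0)$ the space $\mathcal{A}$ with its weak pseudo-Riemannian structure has the following geometric characteristics at $K\in\mathcal{V}(J_0)$, where $A,B,C\in\mathrm{End}_{J_0}(TM)$. 1) The inner product is $$(A,B)_K=4\int_M \mathrm{tr}\left((1-K^2)^{-1}A(1-K^2)^{-1}B\right)d\mu(g_0).$$ 2) The covariant derivative of the vector fields given by the constant operators $A$ and $B$ is $$\nabla_A B=AK(1-K^2)^{-1}B+BK(1-K^2)^{-1}A.$$ 3) The curvature tensor is $$R(A,B)C=-(1-K^2)\left[\left[(1-K^2)^{-1}A,(1-K^2)^{-1}B\right],(1-K^2)^{-1}C\right].$$ 4) The geodesics starting at the point $J_0$ (i.e. at $K=0$) in the direction $A\in\mathrm{End}_{J_0}(TM)$ are the curves $K(t)$ in the domain $\mathcal{V}(J_0)$ $$K(t)=\tanh\left(\tfrac t2 A\right)=\left(e^{\frac t2 A}+e^{-\frac t2 A}\right)^{-1}\left(e^{\frac t2 A}-e^{-\frac t2 A}\right),$$ for those $t$ for which this expression is defined.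
   Context: $M$ is a smooth closed oriented manifold of dimension $2n$, and $g_0$ is a fixed Riemannian metric on $M$ with Riemannian volume element $\mu(g_0)$. $\mathcal{A}$ is the space of all smooth almost complex structures on $M$, i.e. smooth endomorphism fields $J:TM\to TM$ with $J^2=-\mathrm{Id}$; it is an infinite-dimensional smooth ILH-manifold (inverse limit of Hilbert manifolds). For $J\in\mathcal{A}$, $T_J\mathcal{A}=\mathrm{End}_J(TM)$ is the space of smooth endomorphisms $K:TM\to TM$ with $JK+KJ=0$. The weak pseudo-Riemannian structure on $\mathcal{A}$ is $$(A,B)_J=\int_M\mathrm{tr}(A\circ B)\,d\mu(g_0),\qquad A,B\in T_J\mathcal{A}.$$ Local chart: for $J_0\in\mathcal{A}$ let $\mathcal{U}(J_0)=\{J\in\mathcal{A}: 1-JJ_0 \text{ is an isomorphism of } TM\}$ and $\mathcal{V}(J_0)=\{K\in\mathrm{End}_{J_0}(TM): 1-K\text{ is invertible}\}$; $\Phi:\mathcal{U}(J_0)\to\mathcal{V}(J_0)$ is $\Phi(J)=(1-JJ_0)^{-1}(1+JJ_0)$, with inverse $K\mapsto J_K=J_0(1+K)(1-K)^{-1}$. Via $\Phi$, $A\in\mathrm{End}_{J_0}(TM)$, regarded as a tangent vector at $K\in\mathcal{V}(J_0)$, corresponds to $A^*=d\Phi^{-1}_K(A)\in T_{J_K}\mathcal{A}$, and $(A,B)_K$ denotes $(A^*,B^* )_{J_K}$. A constant operator $A\in\mathrm{End}_{J_0}(TM)$ (independent of $K$) is regarded as a constant vector field on $\mathcal{V}(J_0)$.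 $\nabla$ is the Levi-Civita covariant derivative (torsion-free and compatible with the inner product). For constant fields (whose Lie brackets vanish) the curvature is $R(A,B)C=\nabla_A\nabla_BC-\nabla_B\nabla_AC$. A geodesic is a curve $K(t)$ satisfying $K''=-\Gamma_K(K',K')$, where $\Gamma_K(A,B)=\nabla_AB$ at $K$ for constant $A,B$. $[X,Y]=XY-YX$ is the commutator of endomorphisms. The curve in 4) has $K(0)=0$ and $K'(0)=\tfrac12A$; "in the direction $A$" is understood in this normalization. *)

theory Defs
  imports "HOL-Analysis.Analysis" "HOL-Library.Function_Algebras"
begin

section \<open>Smooth maps between open sets of normed spaces\<close>

text \<open>\<open>iter_D [v\<^sub>1, \<dots>, v\<^sub>k] f\<close> is the iterated directional derivative
  \<open>\<partial>\<^sub>v\<^sub>k \<dots> \<partial>\<^sub>v\<^sub>1 f\<close>.  A map on an open set is smooth iff all of these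
  exist and are again (Frechet) differentiable.\<close>

fun iter_D :: "'a::real_normed_vector list \<Rightarrow> ('a \<Rightarrow> 'b::real_normed_vector) \<Rightarrow> 'a \<Rightarrow> 'b" where
  "iter_D [] f = f"
| "iter_D (v # vs) f = iter_D vs (\<lambda>x. frechet_derivative f (at x) v)"

definition smooth_on :: "'a::real_normed_vector set \<Rightarrow> ('a \<Rightarrow> 'b::real_normed_vector) \<Rightarrow> bool" where
  "smooth_on S f \<longleftrightarrow> open S \<and> (\<forall>vs. \<forall>x\<in>S. iter_D vs f differentiable (at x))"


section \<open>Closed oriented Riemannian manifolds\<close>

text \<open>The underlying space of the manifold is the type \<open>'m\<close>; a chart is a pair of its domain
  and its coordinate map (whose values outside the domain are irrelevant).\<close>

type_synonym ('m, 'd) chart = "'m set \<times> ('m \<Rightarrow> real^'d)"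

definition coord_inv :: "('m, 'd::finite) chart \<Rightarrow> real^'d \<Rightarrow> 'm" where
  "coord_inv c = the_inv_into (fst c) (snd c)"

definition transition :: "('m, 'd::finite) chart \<Rightarrow> ('m, 'd) chart \<Rightarrow> real^'d \<Rightarrow> real^'d" where
  "transition c c' = snd c' \<circ> coord_inv c"

definition jac :: "('m, 'd::finite) chart \<Rightarrow> ('m, 'd) chart \<Rightarrow> 'm \<Rightarrow> real^'d^'d" where
  "jac c c' p = matrix (frechet_derivative (transition c c') (at (snd c p)))"

definition oriented_smooth_atlas :: "('m::topological_space, 'd::finite) chart set \<Rightarrow> bool" where
  "oriented_smooth_atlas At \<longleftrightarrow>
     (\<Union>c\<in>At. fst c) = UNIV \<and>
     (\<forall>c\<in>At. open (fst c) \<and> open (snd c ` fst c) \<and>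
        homeomorphism (fst c) (snd c ` fst c) (snd c) (coord_inv c)) \<and>
     (\<forall>c\<in>At. \<forall>c'\<in>At. smooth_on (snd c ` (fst c \<inter> fst c')) (transition c c')) \<and>
     (\<forall>c\<in>At. \<forall>c'\<in>At. \<forall>p\<in>fst c \<inter> fst c'. 0 < det (jac c c' p))"

definition closed_oriented_manifold ::
    "('m::t2_space, 'd::finite) chart set \<Rightarrow> bool" where
  "closed_oriented_manifold At \<longleftrightarrow> compact (UNIV :: 'm set) \<and> oriented_smooth_atlas At"

text \<open>Tensor fields are given by their components: \<open>g c p\<close> is the matrix of the tensor at the
  point \<open>p\<close> in the coordinate frame of the chart \<open>c\<close>.\<close>

definition riemannian_metric ::
    "('m, 'd::finite) chart set \<Rightarrow> (('m, 'd) chart \<Rightarrow> 'm \<Rightarrow> real^'d^'d) \<Rightarrow> bool" where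
  "riemannian_metric At g \<longleftrightarrow>
     (\<forall>c\<in>At. smooth_on (snd c ` fst c) (\<lambda>x. g c (coord_inv c x))) \<and>
     (\<forall>c\<in>At. \<forall>p\<in>fst c. transpose (g c p) = g c p \<and> (\<forall>v. v \<noteq> 0 \<longrightarrow> 0 < v \<bullet> (g c p *v v))) \<and>
     (\<forall>c\<in>At. \<forall>c'\<in>At. \<forall>p\<in>fst c \<inter> fst c'.
        g c p = transpose (jac c c' p) ** g c' p ** jac c c' p)"

text \<open>The Riemannian volume: the (unique) Borel measure that in each chart has the density
  \<open>sqrt (det g)\<close> with respect to Lebesgue measure.\<close>

definition riemannian_volume ::
    "('m::topological_space, 'd::finite) chart set \<Rightarrow> (('m, 'd) chart \<Rightarrow> 'm \<Rightarrow> real^'d^'d)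
      \<Rightarrow> 'm measure \<Rightarrow> bool" where
  "riemannian_volume At g \<mu> \<longleftrightarrow>
     sets \<mu> = sets borel \<and>
     (\<forall>c\<in>At. \<forall>S\<in>sets borel. S \<subseteq> fst c \<longrightarrow>
        emeasure \<mu> S =
          (\<integral>\<^sup>+x\<in>snd c ` S. ennreal (sqrt (det (g c (coord_inv c x)))) \<partial>lborel))"


section \<open>Endomorphism fields of the tangent bundle\<close>

text \<open>Components are set to \<open>0\<close> wherever \<open>c\<close> is not a chart of the atlas around \<open>p\<close>, so that
  equality of fields is equality of functions.  Sums and differences of fields are the pointwise
  ones of functions; the product of two fields is written \<open>A \<odot> B\<close> (the overloaded \<open>*\<close>
  on vectors is componentwise and is not used).\<close>

type_synonym ('m, 'd) field = "('m, 'd) chart \<Rightarrow> 'm \<Rightarrow> real^'d^'d"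

definition endo :: "('m, 'd::finite) chart set \<Rightarrow> ('m, 'd) field set" where
  "endo At = {A.
     (\<forall>c\<in>At. smooth_on (snd c ` fst c) (\<lambda>x. A c (coord_inv c x))) \<and>
     (\<forall>c\<in>At. \<forall>c'\<in>At. \<forall>p\<in>fst c \<inter> fst c'. A c' p ** jac c c' p = jac c c' p ** A c p) \<and>
     (\<forall>c p. \<not> (c \<in> At \<and> p \<in> fst c) \<longrightarrow> A c p = 0)}"

definition fcomp :: "('m, 'd::finite) field \<Rightarrow> ('m, 'd) field \<Rightarrow> ('m, 'd) field" (infixl "\<odot>" 70) where
  "A \<odot> B = (\<lambda>c p. A c p ** B c p)"

definition fscale :: "real \<Rightarrow> ('m, 'd::finite) field \<Rightarrow> ('m, 'd) field" (infixr "\<cdot>" 75) where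
  "r \<cdot> A = (\<lambda>c p. r *\<^sub>R A c p)"

definition fid :: "('m, 'd::finite) chart set \<Rightarrow> ('m, 'd) field" where
  "fid At = (\<lambda>c p. if c \<in> At \<and> p \<in> fst c then mat 1 else 0)"

definition finv :: "('m, 'd::finite) chart set \<Rightarrow> ('m, 'd) field \<Rightarrow> ('m, 'd) field" where
  "finv At A = (\<lambda>c p. if c \<in> At \<and> p \<in> fst c then matrix_inv (A c p) else 0)"

definition is_iso :: "('m, 'd::finite) chart set \<Rightarrow> ('m, 'd) field \<Rightarrow> bool" where
  "is_iso At A \<longleftrightarrow> (\<forall>c\<in>At. \<forall>p\<in>fst c. invertible (A c p))"

definition commutator :: "('m, 'd::finite) field \<Rightarrow> ('m, 'd) field \<Rightarrow> ('m, 'd) field" where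
  "commutator X Y = X \<odot> Y - Y \<odot> X"

text \<open>The trace does not depend on the chosen chart around \<open>p\<close>.\<close>

definition ftrace :: "('m, 'd::finite) chart set \<Rightarrow> ('m, 'd) field \<Rightarrow> 'm \<Rightarrow> real" where
  "ftrace At A p = trace (A (SOME c. c \<in> At \<and> p \<in> fst c) p)"

definition mexp :: "real^'d^'d \<Rightarrow> real^'d^'d::finite" where
  "mexp X = (\<Sum>k. (1 / fact k) *\<^sub>R (((**) X ^^ k) (mat 1)))"

definition fexp :: "('m, 'd::finite) chart set \<Rightarrow> ('m, 'd) field \<Rightarrow> ('m, 'd) field" where
  "fexp At A = (\<lambda>c p. if c \<in> At \<and> p \<in> fst c then mexp (A c p) else 0)"

definition ftanh :: "('m, 'd::finite) chart set \<Rightarrow> ('m, 'd) field \<Rightarrow> ('m, 'd) field" where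
  "ftanh At A = finv At (fexp At A + fexp At (- A)) \<odot> (fexp At A - fexp At (- A))"

definition ftanh_defined :: "('m, 'd::finite) chart set \<Rightarrow> ('m, 'd) field \<Rightarrow> bool" where
  "ftanh_defined At A \<longleftrightarrow> is_iso At (fexp At A + fexp At (- A))"


section \<open>Calculus in the Frechet space of smooth fields\<close>

text \<open>Convergence in the \<open>C\<^sup>\<infinity>\<close> topology: uniform convergence of all partial derivatives of the
  components on compact subsets of the charts.\<close>

definition Cinf_tendsto ::
    "('m, 'd::finite) chart set \<Rightarrow> ('t \<Rightarrow> ('m, 'd) field) \<Rightarrow> ('m, 'd) field \<Rightarrow> 't filter \<Rightarrow> bool" where
  "Cinf_tendsto At F L \<F> \<longleftrightarrow>
     (\<forall>c\<in>At. \<forall>C vs. compact C \<and> C \<subseteq> snd c ` fst c \<longrightarrow>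
        uniform_limit C (\<lambda>t. iter_D vs (\<lambda>x. F t c (coord_inv c x)))
          (iter_D vs (\<lambda>x. L c (coord_inv c x))) \<F>)"

definition has_curve_deriv ::
    "('m, 'd::finite) chart set \<Rightarrow> (real \<Rightarrow> ('m, 'd) field) \<Rightarrow> ('m, 'd) field \<Rightarrow> real \<Rightarrow> bool" where
  "has_curve_deriv At \<gamma> L t \<longleftrightarrow>
     L \<in> endo At \<and> Cinf_tendsto At (\<lambda>s. (1 / (s - t)) \<cdot> (\<gamma> s - \<gamma> t)) L (at t)"

definition curve_deriv ::
    "('m, 'd::finite) chart set \<Rightarrow> (real \<Rightarrow> ('m, 'd) field) \<Rightarrow> real \<Rightarrow> ('m, 'd) field" where
  "curve_deriv At \<gamma> t = (THE L. has_curve_deriv At \<gamma> L t)"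

text \<open>The differential \<open>dF\<^sub>K(A)\<close>.\<close>

definition dderiv ::
    "('m, 'd::finite) chart set \<Rightarrow> (('m, 'd) field \<Rightarrow> ('m, 'd) field)
      \<Rightarrow> ('m, 'd) field \<Rightarrow> ('m, 'd) field \<Rightarrow> ('m, 'd) field" where
  "dderiv At F K A = curve_deriv At (\<lambda>t. F (K + t \<cdot> A)) 0"

text \<open>Smooth maps from an open subset \<open>W\<close> of the \<open>m\<close>-fold product \<open>E\<^sup>m\<close> (lists of length \<open>m\<close>) of a
  closed subspace \<open>E\<close> of the space of fields to \<open>E\<close>, in the sense of Michal, Bastiani and
  Hamilton: all iterated directional derivatives exist and depend continuously on the point and
  the directions jointly.  Sequential continuity suffices, the spaces being metrizable.\<close>

definition displace ::
    "('m, 'd::finite) field list \<Rightarrow> real \<Rightarrow> ('m, 'd) field list \<Rightarrow> ('m, 'd) field list" where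
  "displace Ks t D = map2 (\<lambda>K A. K + t \<cdot> A) Ks D"

fun iter_dderiv ::
    "('m, 'd::finite) chart set \<Rightarrow> ('m, 'd) field list list \<Rightarrow> (('m, 'd) field list \<Rightarrow> ('m, 'd) field)
      \<Rightarrow> ('m, 'd) field list \<Rightarrow> ('m, 'd) field" where
  "iter_dderiv At [] F = F"
| "iter_dderiv At (D # Ds) F =
     iter_dderiv At Ds (\<lambda>Ks. curve_deriv At (\<lambda>t. F (displace Ks t D)) 0)"

definition tuples :: "nat \<Rightarrow> 'a set \<Rightarrow> 'a list set" where
  "tuples m E = {D. length D = m \<and> set D \<subseteq> E}"

definition smooth_map ::
    "('m, 'd::finite) chart set \<Rightarrow> ('m, 'd) field set \<Rightarrow> nat \<Rightarrow> ('m, 'd) field list set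
      \<Rightarrow> (('m, 'd) field list \<Rightarrow> ('m, 'd) field) \<Rightarrow> bool" where
  "smooth_map At E m W F \<longleftrightarrow>
     (\<forall>Ks\<in>W. F Ks \<in> E) \<and>
     (\<forall>Ds\<in>lists (tuples m E). \<forall>D\<in>tuples m E. \<forall>Ks\<in>W.
        \<exists>L\<in>E. has_curve_deriv At (\<lambda>t. iter_dderiv At Ds F (displace Ks t D)) L 0) \<and>
     (\<forall>Ksq Ks Dsq Ds.
        Ks \<in> W \<and> Ds \<in> lists (tuples m E) \<and>
        (\<forall>k. Ksq k \<in> W \<and> Dsq k \<in> lists (tuples m E) \<and> length (Dsq k) = length Ds) \<and>
        (\<forall>i<m. Cinf_tendsto At (\<lambda>k. Ksq k ! i) (Ks ! i) sequentially) \<and>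
        (\<forall>j<length Ds. \<forall>i<m. Cinf_tendsto At (\<lambda>k. Dsq k ! j ! i) (Ds ! j ! i) sequentially)
        \<longrightarrow> Cinf_tendsto At (\<lambda>k. iter_dderiv At (Dsq k) F (Ksq k)) (iter_dderiv At Ds F Ks)
              sequentially)"


section \<open>The space of almost complex structures\<close>

definition almost_complex :: "('m, 'd::finite) chart set \<Rightarrow> ('m, 'd) field set" where
  "almost_complex At = {J \<in> endo At. J \<odot> J = - fid At}"

definition tangent :: "('m, 'd::finite) chart set \<Rightarrow> ('m, 'd) field \<Rightarrow> ('m, 'd) field set" where
  "tangent At J = {K \<in> endo At. J \<odot> K + K \<odot> J = 0}"

definition inner_AC ::
    "('m, 'd::finite) chart set \<Rightarrow> 'm measure \<Rightarrow> ('m, 'd) field \<Rightarrow> ('m, 'd) field \<Rightarrow> real" where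
  "inner_AC At \<mu> A B = (\<integral>p. ftrace At (A \<odot> B) p \<partial>\<mu>)"

definition dom_U :: "('m, 'd::finite) chart set \<Rightarrow> ('m, 'd) field \<Rightarrow> ('m, 'd) field set" where
  "dom_U At J0 = {J \<in> almost_complex At. is_iso At (fid At - J \<odot> J0)}"

definition dom_V :: "('m, 'd::finite) chart set \<Rightarrow> ('m, 'd) field \<Rightarrow> ('m, 'd) field set" where
  "dom_V At J0 = {K \<in> tangent At J0. is_iso At (fid At - K)}"

definition Phi ::
    "('m, 'd::finite) chart set \<Rightarrow> ('m, 'd) field \<Rightarrow> ('m, 'd) field \<Rightarrow> ('m, 'd) field" where
  "Phi At J0 J = finv At (fid At - J \<odot> J0) \<odot> (fid At + J \<odot> J0)"

definition Phi_inv ::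
    "('m, 'd::finite) chart set \<Rightarrow> ('m, 'd) field \<Rightarrow> ('m, 'd) field \<Rightarrow> ('m, 'd) field" where
  "Phi_inv At J0 = the_inv_into (dom_U At J0) (Phi At J0)"

text \<open>The inner product of the tangent vectors at \<open>\<Phi>\<^sup>-\<^sup>1(K)\<close> that correspond to \<open>A\<close> and \<open>B\<close>.\<close>

definition inner_K ::
    "('m, 'd::finite) chart set \<Rightarrow> 'm measure \<Rightarrow> ('m, 'd) field \<Rightarrow> ('m, 'd) field
      \<Rightarrow> ('m, 'd) field \<Rightarrow> ('m, 'd) field \<Rightarrow> real" where
  "inner_K At \<mu> J0 K A B =
     inner_AC At \<mu> (dderiv At (Phi_inv At J0) K A) (dderiv At (Phi_inv At J0) K B)"


section \<open>Levi-Civita connection, curvature and geodesics in the chart\<close>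

text \<open>A vector field on \<open>\<V>(J\<^sub>0)\<close> is a map into the model space; a connection is given by
  its Christoffel map \<open>\<Gamma>\<^sub>K(A,B)\<close>, with \<open>\<nabla>\<^sub>X Y = dY(X) + \<Gamma>(X,Y)\<close>.\<close>

type_synonym ('m, 'd) vfield = "('m, 'd) field \<Rightarrow> ('m, 'd) field"
type_synonym ('m, 'd) christoffel = "('m, 'd) field \<Rightarrow> ('m, 'd) field \<Rightarrow> ('m, 'd) field \<Rightarrow> ('m, 'd) field"

definition smooth_vfield ::
    "('m, 'd::finite) chart set \<Rightarrow> ('m, 'd) field \<Rightarrow> ('m, 'd) vfield \<Rightarrow> bool" where
  "smooth_vfield At J0 X \<longleftrightarrow>
     smooth_map At (tangent At J0) 1 {[K] | K. K \<in> dom_V At J0} (\<lambda>Ks. X (Ks ! 0))"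

definition lie_bracket ::
    "('m, 'd::finite) chart set \<Rightarrow> ('m, 'd) vfield \<Rightarrow> ('m, 'd) vfield \<Rightarrow> ('m, 'd) vfield" where
  "lie_bracket At X Y = (\<lambda>K. dderiv At Y K (X K) - dderiv At X K (Y K))"

definition cov ::
    "('m, 'd::finite) chart set \<Rightarrow> ('m, 'd) christoffel \<Rightarrow> ('m, 'd) vfield \<Rightarrow> ('m, 'd) vfield
      \<Rightarrow> ('m, 'd) vfield" where
  "cov At \<Gamma> X Y = (\<lambda>K. dderiv At Y K (X K) + \<Gamma> K (X K) (Y K))"

definition connection ::
    "('m, 'd::finite) chart set \<Rightarrow> ('m, 'd) field \<Rightarrow> ('m, 'd) christoffel \<Rightarrow> bool" where
  "connection At J0 \<Gamma> \<longleftrightarrow>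
     (\<forall>K\<in>dom_V At J0. \<forall>A\<in>tangent At J0. \<forall>B\<in>tangent At J0. \<forall>C\<in>tangent At J0. \<forall>r.
        \<Gamma> K (A + B) C = \<Gamma> K A C + \<Gamma> K B C \<and> \<Gamma> K (r \<cdot> A) C = r \<cdot> \<Gamma> K A C \<and>
        \<Gamma> K A (B + C) = \<Gamma> K A B + \<Gamma> K A C \<and> \<Gamma> K A (r \<cdot> C) = r \<cdot> \<Gamma> K A C) \<and>
     smooth_map At (tangent At J0) 3
       {[K, A, B] | K A B. K \<in> dom_V At J0 \<and> A \<in> tangent At J0 \<and> B \<in> tangent At J0}
       (\<lambda>Ks. \<Gamma> (Ks ! 0) (Ks ! 1) (Ks ! 2))"

definition levi_civita ::
    "('m, 'd::finite) chart set \<Rightarrow> 'm measure \<Rightarrow> ('m, 'd) field \<Rightarrow> ('m, 'd) christoffel \<Rightarrow> bool" where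
  "levi_civita At \<mu> J0 \<Gamma> \<longleftrightarrow>
     connection At J0 \<Gamma> \<and>
     (\<forall>X Y. smooth_vfield At J0 X \<and> smooth_vfield At J0 Y \<longrightarrow>
        (\<forall>K\<in>dom_V At J0. cov At \<Gamma> X Y K - cov At \<Gamma> Y X K = lie_bracket At X Y K)) \<and>
     (\<forall>X Y Z. smooth_vfield At J0 X \<and> smooth_vfield At J0 Y \<and> smooth_vfield At J0 Z \<longrightarrow>
        (\<forall>K\<in>dom_V At J0.
           ((\<lambda>t. inner_K At \<mu> J0 (K + t \<cdot> X K) (Y (K + t \<cdot> X K)) (Z (K + t \<cdot> X K)))
             has_real_derivative
               inner_K At \<mu> J0 K (cov At \<Gamma> X Y K) (Z K) + inner_K At \<mu> J0 K (Y K) (cov At \<Gamma> X Z K))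
             (at 0)))"

text \<open>Curvature on constant vector fields, whose Lie brackets vanish.\<close>

definition curvature ::
    "('m, 'd::finite) chart set \<Rightarrow> ('m, 'd) christoffel \<Rightarrow> ('m, 'd) field
      \<Rightarrow> ('m, 'd) field \<Rightarrow> ('m, 'd) field \<Rightarrow> ('m, 'd) field \<Rightarrow> ('m, 'd) field" where
  "curvature At \<Gamma> K A B C =
     cov At \<Gamma> (\<lambda>_. A) (cov At \<Gamma> (\<lambda>_. B) (\<lambda>_. C)) K - cov At \<Gamma> (\<lambda>_. B) (cov At \<Gamma> (\<lambda>_. A) (\<lambda>_. C)) K"

definition geodesic_on ::
    "('m, 'd::finite) chart set \<Rightarrow> ('m, 'd) field \<Rightarrow> ('m, 'd) christoffel \<Rightarrow> real set
      \<Rightarrow> (real \<Rightarrow> ('m, 'd) field) \<Rightarrow> bool" where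
  "geodesic_on At J0 \<Gamma> I \<gamma> \<longleftrightarrow>
     open I \<and>
     (\<exists>v. \<forall>t\<in>I. \<gamma> t \<in> dom_V At J0 \<and> has_curve_deriv At \<gamma> (v t) t \<and>
        has_curve_deriv At v (- \<Gamma> (\<gamma> t) (v t) (v t)) t)"

end

theory Submission
  imports Defs
begin

text \<open>
  For a list \<open>vs\<close> of directions, the sum of the norms of the derivatives of a matrix valued function
  along all subsequences of \<open>vs\<close> is a submultiplicative seminorm, and the suprema of these seminorms
  over compact subsets of charts define the \<open>C\<^sup>\<infinity>\<close> topology.  So products, inverses and
  exponentials of fields are treated as in a Banach algebra: limits and derivatives of curves of
  fields follow from pointwise algebra.

  The differential of the inverse chart is \<open>A \<mapsto> 2 J\<^sub>0 (1 - K)\<^sup>-\<^sup>1 A (1 - K)\<^sup>-\<^sup>1\<close>; as \<open>J\<^sub>0\<close> anticommutes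
  with \<open>A\<close> and \<open>K\<close>, this gives the inner product.  Differentiating under the integral and using that
  the trace is cyclic shows that \<open>\<Gamma>(A, B) = A K (1 - K\<^sup>2)\<^sup>-\<^sup>1 B + B K (1 - K\<^sup>2)\<^sup>-\<^sup>1 A\<close> is compatible with
  the inner product.  The latter is nondegenerate, because a tangent vector can be paired with the
  anticommuting part of an adjoint with respect to the Riemannian metric, and Koszul's argument gives
  uniqueness.  The curvature formula is then a noncommutative polynomial identity.

  A geodesic through \<open>0\<close> solves a matrix equation at each point of the manifold, for which
  \<open>2 (1 + K)\<^sup>-\<^sup>1 K' (1 - K)\<^sup>-\<^sup>1\<close> is a first integral.  It equals \<open>A\<close>, so \<open>(1 + K) (1 - K)\<^sup>-\<^sup>1 = exp (t A)\<close>,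
  which means \<open>K = tanh (t A / 2)\<close>.
\<close>

section \<open>Square matrices\<close>

text \<open>The model space is only a Frechet space and the metric is weak, so neither existence of
  a Levi-Civita connection nor uniqueness for the geodesic equation comes for free:
  \<open>Gam\<close> has to be exhibited together with its smoothness in all variables, and
  geodesics have to be integrated explicitly. Smoothness means that all iterated directional
  derivatives exist and are jointly continuous; as these are again rational in the fields, they are
  produced by differentiating expressions symbolically. The metric is in general indefinite, so a
  tangent vector cannot be tested against itself; hence the auxiliary Riemannian adjoint. The curve
  \<open>(1 + K)(1 - K)^-1\<close> equals \<open>- J0 J_K\<close>, and the first integral is its
  logarithmic derivative; the normalization \<open>K'(0) = A/2\<close> gives it the value
  \<open>2 K'(0) = A\<close>. Compactness of the manifold acts through a finite cover by compact
  coordinate pieces, which makes invertibility an open condition and bounds integrals by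
  seminorms.\<close>

lemma norm_matrix_mul_le: "norm (A ** B) \<le> norm A * norm B" for A B :: "real^'d^'d::finite"
proof -
  have nrm: "(norm X)\<^sup>2 = (\<Sum>i\<in>UNIV. \<Sum>j\<in>UNIV. (X$i$j)\<^sup>2)" for X :: "real^'d^'d"
    unfolding power2_norm_eq_inner by (simp add: inner_vec_def power2_eq_square)
  have entry: "(A ** B)$i$j = A$i \<bullet> column j B" for i j
    by (simp add: matrix_matrix_mult_def inner_vec_def column_def)
  have "(norm (A ** B))\<^sup>2 = (\<Sum>i\<in>UNIV. \<Sum>j\<in>UNIV. (A$i \<bullet> column j B)\<^sup>2)"
    by (simp add: nrm entry)
  also have "\<dots> \<le> (\<Sum>i\<in>UNIV. \<Sum>j\<in>UNIV. (A$i \<bullet> A$i) * (column j B \<bullet> column j B))"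
    by (intro sum_mono Cauchy_Schwarz_ineq)
  also have "\<dots> = (\<Sum>i\<in>UNIV. A$i \<bullet> A$i) * (\<Sum>j\<in>UNIV. column j B \<bullet> column j B)"
    by (simp add: sum_product)
  also have "(\<Sum>i\<in>UNIV. A$i \<bullet> A$i) = (norm A)\<^sup>2"
    by (simp add: power2_norm_eq_inner inner_vec_def)
  also have "(\<Sum>j\<in>UNIV. column j B \<bullet> column j B) = (norm B)\<^sup>2"
    unfolding nrm by (subst sum.swap) (simp add: column_def inner_vec_def power2_eq_square)
  finally have "(norm (A ** B))\<^sup>2 \<le> (norm A * norm B)\<^sup>2"
    by (simp add: power_mult_distrib)
  then show ?thesis
    by (rule power2_le_imp_le) simp
qed

text \<open>One interpretation supplies the limit, derivative and series rules for the matrix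
  product.\<close>

interpretation mm: bounded_bilinear "(**) :: real^'d::finite^'d \<Rightarrow> real^'d^'d \<Rightarrow> real^'d^'d"
proof
  fix A B C :: "real^'d^'d" and r :: real
  show "(A + B) ** C = A ** C + B ** C"
    by (simp add: matrix_matrix_mult_def vec_eq_iff distrib_right sum.distrib)
  show "A ** (B + C) = A ** B + A ** C"
    by (rule matrix_add_ldistrib)
  show "(r *\<^sub>R A) ** B = r *\<^sub>R (A ** B)"
    by (simp add: matrix_matrix_mult_def vec_eq_iff sum_distrib_left mult.assoc)
  show "A ** (r *\<^sub>R B) = r *\<^sub>R (A ** B)"
    by (simp add: matrix_matrix_mult_def vec_eq_iff sum_distrib_left mult.left_commute)
  show "\<exists>K. \<forall>(A :: real^'d^'d) (B :: real^'d^'d). norm (A ** B) \<le> norm A * norm B * K"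
    by (rule exI[of _ 1]) (simp add: norm_matrix_mul_le)
qed

lemmas mm_assoc = matrix_mul_assoc[symmetric]
lemmas mm_simps = mm.add_left mm.add_right mm.diff_left mm.diff_right mm.minus_left mm.minus_right
  mm.scaleR_left mm.scaleR_right mm.zero_left mm.zero_right mm_assoc

section \<open>Inverse matrices: continuity and derivative of inversion\<close>

lemma matrix_inv_mul:
  fixes A :: "real^'d^'d::finite"
  assumes "invertible A"
  shows "A ** matrix_inv A = mat 1" "matrix_inv A ** A = mat 1"
proof -
  have "A ** matrix_inv A = mat 1 \<and> matrix_inv A ** A = mat 1"
    using assms unfolding invertible_def matrix_inv_def by (rule someI_ex)
  then show "A ** matrix_inv A = mat 1" "matrix_inv A ** A = mat 1" by auto
qed

lemma matrix_inv_mul_assoc: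
  fixes A :: "real^'d^'d::finite"
  assumes "invertible A"
  shows "A ** (matrix_inv A ** B) = B" "matrix_inv A ** (A ** B) = B"
  by (simp_all add: matrix_mul_assoc matrix_inv_mul[OF assms])

lemma invertibleI:
  fixes A :: "real^'d^'d::finite"
  assumes "A ** B = mat 1"
  shows "invertible A" "matrix_inv A = B" "B ** A = mat 1"
proof -
  show BA: "B ** A = mat 1" using assms matrix_left_right_inverse by blast
  show inv: "invertible A" using assms BA unfolding invertible_def by blast
  have "matrix_inv A = matrix_inv A ** (A ** B)" using assms by simp
  then show "matrix_inv A = B" by (simp add: matrix_inv_mul_assoc[OF inv])
qed

lemma invertible_matrix_inv: "invertible A \<Longrightarrow> invertible (matrix_inv A)" for A :: "real^'d^'d::finite"
  using invertibleI(1) matrix_inv_mul(2) by blast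

lemma norm_matrix_vector_mul_le: "norm (A *v x) \<le> norm A * norm x" for A :: "real^'d^'d::finite"
proof -
  have "(norm (A *v x))\<^sup>2 = (\<Sum>i\<in>UNIV. (A$i \<bullet> x)\<^sup>2)"
    unfolding power2_norm_eq_inner by (simp add: inner_vec_def matrix_vector_mult_def power2_eq_square)
  also have "\<dots> \<le> (\<Sum>i\<in>UNIV. (A$i \<bullet> A$i) * (x \<bullet> x))"
    by (intro sum_mono Cauchy_Schwarz_ineq)
  also have "\<dots> = (norm A * norm x)\<^sup>2"
    by (simp add: power_mult_distrib power2_norm_eq_inner inner_vec_def sum_distrib_right)
  finally show ?thesis
    by (rule power2_le_imp_le) simp
qed

lemma invertible_iff_inj: "invertible A \<longleftrightarrow> (\<forall>x. A *v x = 0 \<longrightarrow> x = 0)" for A :: "real^'d^'d::finite"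
  by (simp add: invertible_left_inverse matrix_left_invertible_ker)

text \<open>A kernel vector satisfies \<open>x = - (Z *v x)\<close>, so its norm is at most
  \<open>norm Z\<close> times itself and it vanishes. This replaces the Neumann series.\<close>

lemma invertible_one_plus:
  fixes Z :: "real^'d^'d::finite"
  assumes "norm Z < 1"
  shows "invertible (mat 1 + Z)"
  unfolding invertible_iff_inj
proof (intro allI impI)
  fix x assume "(mat 1 + Z) *v x = 0"
  then have "x = - (Z *v x)"
    by (simp add: matrix_vector_mult_add_rdistrib eq_neg_iff_add_eq_0)
  then have "norm x \<le> norm Z * norm x"
    by (metis norm_matrix_vector_mul_le norm_minus_cancel)
  then show "x = 0"
    using assms mult_strict_right_mono[of "norm Z" 1 "norm x"] by (cases "x = 0") auto
qed

lemma invertible_near: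
  fixes A B :: "real^'d^'d::finite"
  assumes "invertible A" "norm (matrix_inv A) * norm (B - A) < 1"
  shows "invertible B"
proof -
  have "norm (matrix_inv A ** (B - A)) < 1"
    using norm_matrix_mul_le assms(2) by (rule le_less_trans)
  then have "invertible (A ** (mat 1 + matrix_inv A ** (B - A)))"
    by (intro invertible_mult assms(1) invertible_one_plus)
  then show ?thesis
    by (simp add: mm_simps matrix_inv_mul_assoc[OF assms(1)])
qed

text \<open>The resolvent identity. Continuity and differentiability of inversion come from it, here
  for matrices and later, as \<open>finv_diff\<close>, for fields.\<close>

lemma matrix_inv_diff:
  fixes A B :: "real^'d^'d::finite"
  assumes "invertible A" "invertible B"
  shows "matrix_inv B - matrix_inv A = - (matrix_inv B ** (B - A) ** matrix_inv A)"
  using assms by (simp add: mm_simps matrix_inv_mul_assoc matrix_inv_mul)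

lemma tendsto_matrix_inv:
  fixes f :: "'a \<Rightarrow> real^'d^'d::finite"
  assumes f: "(f \<longlongrightarrow> A) F" and A: "invertible A"
  shows "((\<lambda>x. matrix_inv (f x)) \<longlongrightarrow> matrix_inv A) F"
proof -
  define a where "a = norm (matrix_inv A)"
  have "((\<lambda>x. a * norm (f x - A)) \<longlongrightarrow> a * norm (A - A)) F"
    by (intro tendsto_intros f)
  \<comment> \<open>The threshold 1/2 serves twice: it is below 1, so \<open>f x\<close> is
    invertible, and it lets the unknown norm \<open>b\<close> of the inverse be absorbed, since then
    \<open>b \<le> a + b / 2\<close>.\<close>
  then have ev: "\<forall>\<^sub>F x in F. a * norm (f x - A) < 1/2"
    by (rule order_tendstoD) simp
  have "((\<lambda>x. matrix_inv (f x) - matrix_inv A) \<longlongrightarrow> 0) F"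
  proof (rule Lim_null_comparison)
    show "\<forall>\<^sub>F x in F. norm (matrix_inv (f x) - matrix_inv A) \<le> (2 * a) * norm (f x - A) * a"
      using ev
    proof eventually_elim
      case (elim x)
      have inv: "invertible (f x)"
        using elim by (intro invertible_near[OF A]) (simp add: a_def)
      define b where "b = norm (matrix_inv (f x))"
      have le: "norm (matrix_inv (f x) - matrix_inv A) \<le> b * norm (f x - A) * a"
        unfolding matrix_inv_diff[OF A inv] norm_minus_cancel a_def b_def
        by (intro order_trans[OF norm_matrix_mul_le] mult_right_mono norm_matrix_mul_le) auto
      have "b \<le> a + norm (matrix_inv (f x) - matrix_inv A)"
        unfolding a_def b_def by (metis add.commute diff_add_cancel norm_triangle_ineq)
      also have "\<dots> \<le> a + b * (1/2)"
        using le mult_left_mono[OF less_imp_le[OF elim], of b] by (simp add: b_def mult_ac)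
      finally have "b \<le> 2 * a" by simp
      then have "b * norm (f x - A) * a \<le> (2 * a) * norm (f x - A) * a"
        by (intro mult_right_mono) (auto simp: a_def)
      with le show ?case by simp
    qed
    have "((\<lambda>x. (2 * a) * norm (f x - A) * a) \<longlongrightarrow> (2 * a) * norm (A - A) * a) F"
      by (intro tendsto_intros f)
    then show "((\<lambda>x. (2 * a) * norm (f x - A) * a) \<longlongrightarrow> 0) F" by simp
  qed
  then show ?thesis by (rule LIM_zero_cancel)
qed

lemma has_derivative_matrix_inv:
  fixes f :: "'a::real_normed_vector \<Rightarrow> real^'d^'d::finite"
  assumes f: "(f has_derivative f') (at x)" and inv: "\<forall>\<^sub>F y in nhds x. invertible (f y)"
  shows "((\<lambda>y. matrix_inv (f y)) has_derivative (\<lambda>h. - (matrix_inv (f x) ** f' h ** matrix_inv (f x)))) (at x)"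
proof -
  let ?i = "\<lambda>y. matrix_inv (f y)"
  have invx: "invertible (f x)" using inv by (rule eventually_nhds_x_imp_x)
  have lin: "bounded_linear f'" using f by (rule has_derivative_bounded_linear)
  have cont: "(f \<longlongrightarrow> f x) (at x)" using has_derivative_continuous[OF f] by (simp add: continuous_within)
  \<comment> \<open>The first-order remainder of \<open>f\<close> in units of the distance; it tends
    to 0 by differentiability.\<close>
  define e where "e y = (f y - f x - f' (y - x)) /\<^sub>R norm (y - x)" for y
  have e0: "(e \<longlongrightarrow> 0) (at x)" using f unfolding has_derivative_at_within e_def by blast
  obtain B where B: "\<And>h. norm (f' h) \<le> norm h * B" using lin bounded_linear.bounded by blast
  show ?thesis
    unfolding has_derivative_at_within
  proof (intro conjI)
    show "bounded_linear (\<lambda>h. - (?i x ** f' h ** ?i x))"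
      by (intro bounded_linear_minus mm.bounded_linear_left[THEN bounded_linear_compose]
          mm.bounded_linear_right[THEN bounded_linear_compose] lin)
    \<comment> \<open>After the resolvent identity two errors remain: the remainder
      \<open>e\<close>, and the replacement of the inverse at \<open>y\<close> by the inverse at
      \<open>x\<close> next to the linear term, which continuity of inversion controls.\<close>
    let ?R = "\<lambda>y. norm (?i y) * norm (e y) * norm (?i x) + norm (?i y - ?i x) * B * norm (?i x)"
    show "((\<lambda>y. (?i y - ?i x - - (?i x ** f' (y - x) ** ?i x)) /\<^sub>R norm (y - x)) \<longlongrightarrow> 0) (at x)"
    proof (rule Lim_null_comparison)
      have "\<forall>\<^sub>F y in at x. invertible (f y)"
        using inv by (simp add: eventually_at_filter eventually_mono)
      moreover have "\<forall>\<^sub>F y in at x. y \<noteq> x" by (simp add: eventually_at_filter)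
      ultimately show "\<forall>\<^sub>F y in at x. norm ((?i y - ?i x - - (?i x ** f' (y - x) ** ?i x)) /\<^sub>R norm (y - x)) \<le> ?R y"
      proof eventually_elim
        case (elim y)
        have nz: "norm (y - x) > 0" using elim by simp
        have fe: "f y - f x = norm (y - x) *\<^sub>R e y + f' (y - x)"
          using nz by (simp add: e_def)
        have "?i y - ?i x = - (?i y ** (norm (y - x) *\<^sub>R e y + f' (y - x)) ** ?i x)"
          using matrix_inv_diff[OF invx elim(1)] fe by simp
        then have "?i y - ?i x - - (?i x ** f' (y - x) ** ?i x) =
            - (?i y ** (norm (y - x) *\<^sub>R e y + f' (y - x)) ** ?i x) + ?i x ** f' (y - x) ** ?i x"
          by (simp only: diff_minus_eq_add)
        also have "\<dots> = - (norm (y - x) *\<^sub>R (?i y ** e y ** ?i x)) - (?i y - ?i x) ** f' (y - x) ** ?i x"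
          by (simp add: mm_simps)
        finally have "norm ((?i y - ?i x - - (?i x ** f' (y - x) ** ?i x)) /\<^sub>R norm (y - x))
           = norm ((- (norm (y - x) *\<^sub>R (?i y ** e y ** ?i x)) - (?i y - ?i x) ** f' (y - x) ** ?i x) /\<^sub>R norm (y - x))"
          by simp
        also have "\<dots> = norm (- (?i y ** e y ** ?i x) - ((?i y - ?i x) ** f' (y - x) ** ?i x) /\<^sub>R norm (y - x))"
          using nz by (simp add: scaleR_diff_right scaleR_minus_right)
        also have "\<dots> \<le> norm (?i y ** e y ** ?i x) + norm ((?i y - ?i x) ** f' (y - x) ** ?i x) / norm (y - x)"
          by (rule order_trans[OF norm_triangle_ineq4]) (simp add: divide_inverse_commute)
        also have "norm (?i y ** e y ** ?i x) \<le> norm (?i y) * norm (e y) * norm (?i x)"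
          by (intro order_trans[OF norm_matrix_mul_le] mult_right_mono norm_matrix_mul_le) auto
        also have "norm ((?i y - ?i x) ** f' (y - x) ** ?i x) \<le> norm (?i y - ?i x) * (norm (y - x) * B) * norm (?i x)"
          by (intro order_trans[OF norm_matrix_mul_le] mult_right_mono)
            (auto intro!: order_trans[OF norm_matrix_mul_le] mult_left_mono B)
        finally show ?case using nz by (simp add: divide_right_mono)
      qed
      have "(?R \<longlongrightarrow> norm (?i x) * norm (0::real^'d^'d) * norm (?i x) + norm (?i x - ?i x) * B * norm (?i x)) (at x)"
        by (intro tendsto_intros tendsto_matrix_inv cont invx e0)
      then show "(?R \<longlongrightarrow> 0) (at x)" by simp
    qed
  qed
qed

section \<open>Jets of smooth maps\<close>

abbreviation dird :: "'a::real_normed_vector \<Rightarrow> ('a \<Rightarrow> 'b::real_normed_vector) \<Rightarrow> 'a \<Rightarrow> 'b" where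
  "dird v f \<equiv> (\<lambda>x. frechet_derivative f (at x) v)"

text \<open>Both functions have the same set of derivatives at \<open>x\<close>, so the choice
  operator behind \<open>frechet_derivative\<close> returns the same map, even where that set is
  empty.\<close>

lemma frechet_derivative_cong_open:
  assumes "open S" "x \<in> S" "\<And>y. y \<in> S \<Longrightarrow> f y = g y"
  shows "frechet_derivative f (at x) = frechet_derivative g (at x)"
proof -
  have "(f has_derivative h) (at x) = (g has_derivative h) (at x)" for h
    using has_derivative_transform_within_open[OF _ assms(1,2), of f h UNIV g]
      has_derivative_transform_within_open[OF _ assms(1,2), of g h UNIV f] assms(3) by auto
  then show ?thesis by (simp add: frechet_derivative_def)
qed

lemma differentiable_cong_open:
  assumes "open S" "x \<in> S" "\<And>y. y \<in> S \<Longrightarrow> f y = g y" "f differentiable (at x)"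
  shows "g differentiable (at x)"
  using assms(4) has_derivative_transform_within_open[OF _ assms(1,2), of f _ UNIV g] assms(3)
  unfolding differentiable_def by auto

lemma iter_D_cong:
  assumes "open S" "x \<in> S" "\<And>y. y \<in> S \<Longrightarrow> f y = g y"
  shows "iter_D vs f x = iter_D vs g x"
  using assms(3)
proof (induction vs arbitrary: f g)
  case Nil
  then show ?case using assms by simp
next
  case (Cons v vs)
  have "dird v f y = dird v g y" if "y \<in> S" for y
    using frechet_derivative_cong_open[OF assms(1) that Cons.prems] by simp
  from Cons.IH[OF this] show ?case by simp
qed

text \<open>Smoothness speaks of all lists of directions at once; the number of admissible
  differentiations provides a measure for induction. Closure under an operation is proved for each
  \<open>k\<close>, because differentiating the result brings back the same operation applied to
  functions of order \<open>k\<close>.\<close>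

fun times_diff :: "nat \<Rightarrow> 'a::real_normed_vector set \<Rightarrow> ('a \<Rightarrow> 'b::real_normed_vector) \<Rightarrow> bool" where
  "times_diff 0 S f \<longleftrightarrow> True"
| "times_diff (Suc k) S f \<longleftrightarrow> (\<forall>x\<in>S. f differentiable (at x)) \<and> (\<forall>v. times_diff k S (dird v f))"

lemma times_diff_iff:
  fixes f :: "'a::real_normed_vector \<Rightarrow> 'b::real_normed_vector"
  shows "times_diff k S f \<longleftrightarrow> (\<forall>vs. length vs < k \<longrightarrow> (\<forall>x\<in>S. iter_D vs f differentiable (at x)))"
proof (induction k arbitrary: f)
  case (Suc k)
  have split: "(\<forall>vs. length vs < Suc k \<longrightarrow> P vs) \<longleftrightarrow> P [] \<and> (\<forall>v vs. length vs < k \<longrightarrow> P (v # vs))"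
    for P :: "'a list \<Rightarrow> bool"
  proof safe
    fix vs :: "'a list" assume "P []" "\<forall>v vs. length vs < k \<longrightarrow> P (v # vs)" "length vs < Suc k"
    then show "P vs" by (cases vs) auto
  qed auto
  show ?case unfolding split times_diff.simps Suc by simp
qed simp

lemma smooth_on_iff_times_diff: "smooth_on S f \<longleftrightarrow> open S \<and> (\<forall>k. times_diff k S f)"
  unfolding smooth_on_def times_diff_iff by blast

lemma times_diff_mono: "times_diff (Suc k) S f \<Longrightarrow> times_diff k S f"
  by (simp add: times_diff_iff)

lemma times_diff_cong:
  fixes f g :: "'a::real_normed_vector \<Rightarrow> 'b::real_normed_vector"
  assumes "open S" "\<And>y. y \<in> S \<Longrightarrow> f y = g y" "times_diff k S f"
  shows "times_diff k S g"
  unfolding times_diff_iff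
proof (intro allI impI ballI)
  fix vs :: "'a list" and x assume "length vs < k" "x \<in> S"
  then have "iter_D vs f differentiable (at x)" using assms(3) by (simp add: times_diff_iff)
  then show "iter_D vs g differentiable (at x)"
    by (rule differentiable_cong_open[OF assms(1) \<open>x \<in> S\<close>, rotated]) (rule iter_D_cong[OF assms(1) _ assms(2)])
qed

section \<open>Closure properties of smooth maps and of iterated derivatives\<close>

lemma smooth_on_open: "smooth_on S f \<Longrightarrow> open S"
  by (simp add: smooth_on_def)

lemma smooth_on_cong:
  assumes "smooth_on S f" "\<And>y. y \<in> S \<Longrightarrow> f y = g y"
  shows "smooth_on S g"
  using assms(1) times_diff_cong[of S f g] assms(2) unfolding smooth_on_iff_times_diff by blast

lemma smooth_on_dird: "smooth_on S f \<Longrightarrow> smooth_on S (dird v f)"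
  unfolding smooth_on_iff_times_diff using times_diff.simps(2) by blast

lemma smooth_on_differentiable: "smooth_on S f \<Longrightarrow> x \<in> S \<Longrightarrow> f differentiable (at x)"
  by (auto simp: smooth_on_iff_times_diff dest: spec[of _ "Suc 0"])

lemma smooth_on_has_derivative:
  "smooth_on S f \<Longrightarrow> x \<in> S \<Longrightarrow> (f has_derivative frechet_derivative f (at x)) (at x)"
  using smooth_on_differentiable frechet_derivative_works by blast

lemma continuous_on_iter_D: "smooth_on S f \<Longrightarrow> continuous_on S (iter_D vs f)"
  unfolding smooth_on_def
  by (meson continuous_at_imp_continuous_on differentiable_imp_continuous_within)

lemma times_diff_const: "times_diff k S (\<lambda>_. c)"
  by (induction k arbitrary: c) auto

lemma smooth_on_const: "open S \<Longrightarrow> smooth_on S (\<lambda>_. c)"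
  by (simp add: smooth_on_iff_times_diff times_diff_const)

lemma dird_linear:
  assumes "bounded_linear L" "f differentiable (at x)"
  shows "dird v (\<lambda>x. L (f x)) x = L (dird v f x)"
proof -
  have "((\<lambda>x. L (f x)) has_derivative (\<lambda>h. L (frechet_derivative f (at x) h))) (at x)"
    by (rule bounded_linear.has_derivative[OF assms(1)]) (use assms(2) in \<open>simp add: frechet_derivative_works\<close>)
  from fun_cong[OF frechet_derivative_at[OF this], of v] show ?thesis by simp
qed

lemma dird_bilinear:
  assumes "bounded_bilinear pr" "f differentiable (at x)" "g differentiable (at x)"
  shows "dird v (\<lambda>x. pr (f x) (g x)) x = pr (f x) (dird v g x) + pr (dird v f x) (g x)"
proof -
  have "((\<lambda>x. pr (f x) (g x)) has_derivative
      (\<lambda>h. pr (f x) (frechet_derivative g (at x) h) + pr (frechet_derivative f (at x) h) (g x))) (at x)"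
    by (rule bounded_bilinear.FDERIV[OF assms(1)]) (use assms(2,3) in \<open>simp_all add: frechet_derivative_works\<close>)
  from fun_cong[OF frechet_derivative_at[OF this], of v] show ?thesis by simp
qed

lemma dird_add:
  assumes "f differentiable (at x)" "g differentiable (at x)"
  shows "dird v (\<lambda>x. f x + g x) x = dird v f x + dird v g x"
proof -
  have "((\<lambda>x. f x + g x) has_derivative
      (\<lambda>h. frechet_derivative f (at x) h + frechet_derivative g (at x) h)) (at x)"
    by (rule has_derivative_add) (use assms in \<open>simp_all add: frechet_derivative_works\<close>)
  from fun_cong[OF frechet_derivative_at[OF this], of v] show ?thesis by simp
qed

lemma times_diff_add:
  assumes S: "open S"
  shows "times_diff k S f \<Longrightarrow> times_diff k S g \<Longrightarrow> times_diff k S (\<lambda>x. f x + g x)"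
proof (induction k arbitrary: f g)
  case (Suc k)
  then have "times_diff k S (\<lambda>x. dird v f x + dird v g x)" for v by simp
  then have "times_diff k S (dird v (\<lambda>x. f x + g x))" for v
    by (rule times_diff_cong[OF S, rotated]) (use Suc.prems in \<open>simp add: dird_add\<close>)
  then show ?case using Suc.prems by auto
qed simp

lemma times_diff_linear:
  assumes S: "open S" and L: "bounded_linear L"
  shows "times_diff k S f \<Longrightarrow> times_diff k S (\<lambda>x. L (f x))"
proof (induction k arbitrary: f)
  case (Suc k)
  then have "times_diff k S (\<lambda>x. L (dird v f x))" for v by simp
  then have "times_diff k S (dird v (\<lambda>x. L (f x)))" for v
    by (rule times_diff_cong[OF S, rotated]) (use Suc.prems in \<open>simp add: dird_linear[OF L]\<close>)
  moreover have "(\<lambda>x. L (f x)) differentiable (at x)" if "x \<in> S" for x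
  proof -
    from Suc.prems that obtain f' where "(f has_derivative f') (at x)" by (auto simp: differentiable_def)
    from bounded_linear.has_derivative[OF L this] show ?thesis by (rule differentiableI)
  qed
  ultimately show ?case by auto
qed simp

lemma times_diff_bilinear:
  assumes S: "open S" and B: "bounded_bilinear pr"
  shows "times_diff k S f \<Longrightarrow> times_diff k S g \<Longrightarrow> times_diff k S (\<lambda>x. pr (f x) (g x))"
proof (induction k arbitrary: f g)
  case (Suc k)
  have "times_diff k S (\<lambda>x. pr (f x) (dird v g x) + pr (dird v f x) (g x))" for v
  proof (rule times_diff_add[OF S])
    show "times_diff k S (\<lambda>x. pr (f x) (dird v g x))"
      by (rule Suc.IH[OF times_diff_mono[OF Suc.prems(1)]]) (use Suc.prems(2) in simp)
    show "times_diff k S (\<lambda>x. pr (dird v f x) (g x))"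
      by (rule Suc.IH[OF _ times_diff_mono[OF Suc.prems(2)]]) (use Suc.prems(1) in simp)
  qed
  then have "times_diff k S (dird v (\<lambda>x. pr (f x) (g x)))" for v
    by (rule times_diff_cong[OF S, rotated]) (use Suc.prems in \<open>simp add: dird_bilinear[OF B]\<close>)
  moreover have "(\<lambda>x. pr (f x) (g x)) differentiable (at x)" if "x \<in> S" for x
  proof -
    have "f differentiable (at x)" "g differentiable (at x)" using Suc.prems that by auto
    then obtain f' g' where "(f has_derivative f') (at x)" "(g has_derivative g') (at x)"
      unfolding differentiable_def by blast
    from bounded_bilinear.FDERIV[OF B this] show ?thesis by (rule differentiableI)
  qed
  ultimately show ?case by auto
qed simp

lemma smooth_on_add: "smooth_on S f \<Longrightarrow> smooth_on S g \<Longrightarrow> smooth_on S (\<lambda>x. f x + g x)"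
  by (auto simp: smooth_on_iff_times_diff times_diff_add)

lemma smooth_on_linear: "bounded_linear L \<Longrightarrow> smooth_on S f \<Longrightarrow> smooth_on S (\<lambda>x. L (f x))"
  by (auto simp: smooth_on_iff_times_diff times_diff_linear)

lemma smooth_on_bilinear:
  "bounded_bilinear pr \<Longrightarrow> smooth_on S f \<Longrightarrow> smooth_on S g \<Longrightarrow> smooth_on S (\<lambda>x. pr (f x) (g x))"
  by (auto simp: smooth_on_iff_times_diff times_diff_bilinear)

lemmas smooth_on_scaleR = smooth_on_linear[OF bounded_linear_scaleR_right]
lemmas smooth_on_mm = smooth_on_bilinear[OF mm.bounded_bilinear_axioms]

lemma smooth_on_minus: "smooth_on S f \<Longrightarrow> smooth_on S (\<lambda>x. - f x)"
  using smooth_on_linear[OF bounded_linear_minus[OF bounded_linear_ident]] .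

lemma iter_D_add:
  "smooth_on S f \<Longrightarrow> smooth_on S g \<Longrightarrow> x \<in> S \<Longrightarrow>
    iter_D vs (\<lambda>x. f x + g x) x = iter_D vs f x + iter_D vs g x"
proof (induction vs arbitrary: f g)
  case (Cons v vs)
  have "iter_D vs (dird v (\<lambda>x. f x + g x)) x = iter_D vs (\<lambda>x. dird v f x + dird v g x) x"
    by (rule iter_D_cong[OF smooth_on_open[OF Cons.prems(1)] Cons.prems(3)])
      (simp add: dird_add smooth_on_differentiable[OF Cons.prems(1)] smooth_on_differentiable[OF Cons.prems(2)])
  then show ?case using Cons by (simp add: smooth_on_dird)
qed simp

lemma iter_D_linear:
  "bounded_linear L \<Longrightarrow> smooth_on S f \<Longrightarrow> x \<in> S \<Longrightarrow> iter_D vs (\<lambda>x. L (f x)) x = L (iter_D vs f x)"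
proof (induction vs arbitrary: f)
  case (Cons v vs)
  have "iter_D vs (dird v (\<lambda>x. L (f x))) x = iter_D vs (\<lambda>x. L (dird v f x)) x"
    by (rule iter_D_cong[OF smooth_on_open[OF Cons.prems(2)] Cons.prems(3)])
      (simp add: dird_linear[OF Cons.prems(1)] smooth_on_differentiable[OF Cons.prems(2)])
  then show ?case using Cons by (simp add: smooth_on_dird)
qed simp

lemma iter_D_diff:
  assumes "smooth_on S f" "smooth_on S g" "x \<in> S"
  shows "iter_D vs (\<lambda>x. f x - g x) x = iter_D vs f x - iter_D vs g x"
  using iter_D_add[OF assms(1) smooth_on_minus[OF assms(2)] assms(3)]
    iter_D_linear[OF bounded_linear_minus[OF bounded_linear_ident] assms(2,3)] by simp

text \<open>The derivative of the inverse is a product that contains the inverse itself, so each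
  order of differentiability yields the next one.\<close>

lemma times_diff_matrix_inv:
  fixes f :: "'a::real_normed_vector \<Rightarrow> real^'d^'d::finite"
  assumes f: "smooth_on S f" and inv: "\<And>x. x \<in> S \<Longrightarrow> invertible (f x)"
  shows "times_diff k S (\<lambda>x. matrix_inv (f x))"
proof (induction k)
  case (Suc k)
  have S: "open S" using f by (rule smooth_on_open)
  have der: "((\<lambda>y. matrix_inv (f y)) has_derivative
      (\<lambda>h. - (matrix_inv (f x) ** frechet_derivative f (at x) h ** matrix_inv (f x)))) (at x)" if "x \<in> S" for x
    by (rule has_derivative_matrix_inv[OF smooth_on_has_derivative[OF f that]])
      (use S inv that in \<open>auto simp: eventually_nhds\<close>)
  have "times_diff k S (\<lambda>x. - (matrix_inv (f x) ** dird v f x ** matrix_inv (f x)))" for v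
    by (intro times_diff_linear[OF S bounded_linear_minus[OF bounded_linear_ident]]
        times_diff_bilinear[OF S mm.bounded_bilinear_axioms] Suc)
      (use smooth_on_dird[OF f] in \<open>simp add: smooth_on_iff_times_diff\<close>)
  then have "times_diff k S (dird v (\<lambda>x. matrix_inv (f x)))" for v
    by (rule times_diff_cong[OF S, rotated]) (use fun_cong[OF frechet_derivative_at[OF der]] in \<open>simp\<close>)
  moreover have "(\<lambda>x. matrix_inv (f x)) differentiable (at x)" if "x \<in> S" for x
    using der[OF that] by (auto simp: differentiable_def)
  ultimately show ?case by auto
qed simp

lemma smooth_on_matrix_inv:
  fixes f :: "'a::real_normed_vector \<Rightarrow> real^'d^'d::finite"
  assumes "smooth_on S f" "\<And>x. x \<in> S \<Longrightarrow> invertible (f x)"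
  shows "smooth_on S (\<lambda>x. matrix_inv (f x))"
  using times_diff_matrix_inv[OF assms] smooth_on_open[OF assms(1)] by (simp add: smooth_on_iff_times_diff)

text \<open>Summing over all subsequences of \<open>vs\<close> makes this seminorm submultiplicative: by the Leibniz
  rule every derivative of a product splits into derivatives along complementary subsequences.\<close>

definition jnorm :: "'a::real_normed_vector list \<Rightarrow> ('a \<Rightarrow> 'b::real_normed_vector) \<Rightarrow> 'a \<Rightarrow> real" where
  "jnorm vs f x = (\<Sum>us\<leftarrow>subseqs vs. norm (iter_D us f x))"

lemma jnorm_Nil [simp]: "jnorm [] f x = norm (f x)"
  by (simp add: jnorm_def)

lemma jnorm_Cons [simp]: "jnorm (v # vs) f x = jnorm vs (dird v f) x + jnorm vs f x"
  by (simp add: jnorm_def Let_def o_def)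

lemma jnorm_nonneg: "0 \<le> jnorm vs f x"
  unfolding jnorm_def by (rule sum_list_nonneg) auto

lemma norm_iter_D_le_jnorm: "norm (iter_D vs f x) \<le> jnorm vs f x"
proof (induction vs arbitrary: f)
  case (Cons v vs)
  show ?case using Cons[of "dird v f"] jnorm_nonneg[of vs f x] by simp
qed simp

lemma continuous_on_jnorm: "smooth_on S f \<Longrightarrow> continuous_on S (jnorm vs f)"
proof (induction vs arbitrary: f)
  case Nil
  then show ?case using continuous_on_iter_D[OF Nil, of "[]"] by (auto intro: continuous_on_norm)
next
  case (Cons v vs)
  have "jnorm (v # vs) f = (\<lambda>x. jnorm vs (dird v f) x + jnorm vs f x)" by (rule ext) simp
  then show ?case using Cons by (auto intro!: continuous_on_add smooth_on_dird)
qed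

lemma jnorm_cong:
  assumes "open S" "x \<in> S" "\<And>y. y \<in> S \<Longrightarrow> f y = g y"
  shows "jnorm vs f x = jnorm vs g x"
  unfolding jnorm_def using iter_D_cong[OF assms] by simp

lemma jnorm_add_le:
  "smooth_on S f \<Longrightarrow> smooth_on S g \<Longrightarrow> x \<in> S \<Longrightarrow>
    jnorm vs (\<lambda>x. f x + g x) x \<le> jnorm vs f x + jnorm vs g x"
  unfolding jnorm_def by (simp add: iter_D_add sum_list_addf[symmetric] norm_triangle_ineq sum_list_mono)

lemma jnorm_scaleR: "smooth_on S f \<Longrightarrow> x \<in> S \<Longrightarrow> jnorm vs (\<lambda>x. r *\<^sub>R f x) x = \<bar>r\<bar> * jnorm vs f x"
  unfolding jnorm_def by (simp add: iter_D_linear[OF bounded_linear_scaleR_right] sum_list_const_mult)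

lemma jnorm_mm_le:
  fixes f g :: "'a::real_normed_vector \<Rightarrow> real^'d^'d::finite"
  shows "smooth_on S f \<Longrightarrow> smooth_on S g \<Longrightarrow> x \<in> S \<Longrightarrow>
    jnorm vs (\<lambda>x. f x ** g x) x \<le> jnorm vs f x * jnorm vs g x"
proof (induction vs arbitrary: f g)
  case Nil
  then show ?case by (simp add: norm_matrix_mul_le)
next
  case (Cons v vs)
  note sm = Cons.prems(1,2) smooth_on_dird[OF Cons.prems(1)] smooth_on_dird[OF Cons.prems(2)]
  have "jnorm vs (dird v (\<lambda>x. f x ** g x)) x = jnorm vs (\<lambda>x. f x ** dird v g x + dird v f x ** g x) x"
    by (rule jnorm_cong[OF smooth_on_open[OF Cons.prems(1)] Cons.prems(3)])
      (simp add: dird_bilinear[OF mm.bounded_bilinear_axioms] smooth_on_differentiable[OF Cons.prems(1)]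
        smooth_on_differentiable[OF Cons.prems(2)])
  also have "\<dots> \<le> jnorm vs (\<lambda>x. f x ** dird v g x) x + jnorm vs (\<lambda>x. dird v f x ** g x) x"
    by (rule jnorm_add_le[OF _ _ Cons.prems(3)]; intro smooth_on_mm sm)
  also have "\<dots> \<le> jnorm vs f x * jnorm vs (dird v g) x + jnorm vs (dird v f) x * jnorm vs g x"
    by (intro add_mono Cons.IH sm Cons.prems(3))
  finally have "jnorm (v # vs) (\<lambda>x. f x ** g x) x
      \<le> jnorm vs f x * jnorm vs (dird v g) x + jnorm vs (dird v f) x * jnorm vs g x + jnorm vs f x * jnorm vs g x"
    using Cons.IH[OF sm(1,2) Cons.prems(3)] by simp
  \<comment> \<open>The product on the right has one more nonnegative term, in which both factors
    are differentiated along \<open>v\<close>; it is dropped.\<close>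
  also have "\<dots> \<le> jnorm (v # vs) f x * jnorm (v # vs) g x"
    by (simp add: algebra_simps jnorm_nonneg)
  finally show ?case .
qed

section \<open>Smooth series and the matrix exponential\<close>

text \<open>The Weierstrass condition is imposed on every iterated derivative, so that the class is
  closed under termwise directional derivatives; this drives all inductions on series.\<close>

definition smooth_series :: "'a::real_normed_vector set \<Rightarrow> (nat \<Rightarrow> 'a \<Rightarrow> 'b::real_normed_vector) \<Rightarrow> bool" where
  "smooth_series S u \<longleftrightarrow> open S \<and> (\<forall>k. smooth_on S (u k)) \<and>
     (\<forall>vs C. compact C \<and> C \<subseteq> S \<longrightarrow>
        (\<exists>M. summable M \<and> (\<forall>k. \<forall>x\<in>C. norm (iter_D vs (u k) x) \<le> M k)))"

lemma smooth_series_dird: "smooth_series S u \<Longrightarrow> smooth_series S (\<lambda>k. dird v (u k))"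
  unfolding smooth_series_def by (auto intro: smooth_on_dird simp del: iter_D.simps simp: iter_D.simps(2)[symmetric])

lemma has_derivative_smooth_series:
  fixes u :: "nat \<Rightarrow> 'a::euclidean_space \<Rightarrow> 'b::banach"
  assumes u: "smooth_series S u" and x: "x \<in> S"
  shows "((\<lambda>x. \<Sum>k. u k x) has_derivative (\<lambda>h. \<Sum>k. frechet_derivative (u k) (at x) h)) (at x)"
proof -
  have S: "open S" and sm: "\<And>k. smooth_on S (u k)"
    and bd: "\<And>vs C. compact C \<Longrightarrow> C \<subseteq> S \<Longrightarrow> \<exists>M. summable M \<and> (\<forall>k. \<forall>x\<in>C. norm (iter_D vs (u k) x) \<le> M k)"
    using u by (auto simp: smooth_series_def)
  obtain r where r: "r > 0" "cball x r \<subseteq> S" using S x open_contains_cball by blast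
  let ?K = "cball x r"
  obtain M0 where M0: "summable M0" "\<And>k y. y \<in> ?K \<Longrightarrow> norm (u k y) \<le> M0 k"
    using bd[of ?K "[]"] r by auto
  have "\<forall>b. \<exists>M. summable M \<and> (\<forall>k. \<forall>y\<in>?K. norm (dird b (u k) y) \<le> M k)"
    using bd[of ?K "[_]"] r by auto
  from choice[OF this] obtain Mb where "\<forall>b. summable (Mb b) \<and> (\<forall>k. \<forall>y\<in>?K. norm (dird b (u k) y) \<le> Mb b k)"
    by blast
  then have Mb: "\<And>b. summable (Mb b)" "\<And>b k y. y \<in> ?K \<Longrightarrow> norm (dird b (u k) y) \<le> Mb b k"
    by blast+
  \<comment> \<open>The hypothesis gives a majorant for one direction at a time. Expanding a
    direction in the finite basis and adding the majorants bounds the operator norms of the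
    derivatives uniformly on the ball.\<close>
  define M where "M k = (\<Sum>b\<in>Basis. Mb b k)" for k
  have M: "summable M" unfolding M_def by (intro summable_sum Mb)
  have le: "norm (frechet_derivative (u k) (at y) h) \<le> M k * norm h" if y: "y \<in> ?K" for k y h
  proof -
    have "linear (frechet_derivative (u k) (at y))"
      using smooth_on_differentiable[OF sm] y r by (intro linear_frechet_derivative) auto
    then have "frechet_derivative (u k) (at y) (\<Sum>b\<in>Basis. (h \<bullet> b) *\<^sub>R b) = (\<Sum>b\<in>Basis. (h \<bullet> b) *\<^sub>R dird b (u k) y)"
      by (simp only: linear_sum linear_scale)
    then have "norm (frechet_derivative (u k) (at y) h) \<le> (\<Sum>b\<in>Basis. norm ((h \<bullet> b) *\<^sub>R dird b (u k) y))"
      by (simp only: euclidean_representation norm_sum)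
    also have "\<dots> \<le> (\<Sum>b\<in>Basis. norm h * Mb b k)"
      by (intro sum_mono) (auto intro!: mult_mono Basis_le_norm Mb y)
    finally show ?thesis by (simp add: M_def sum_distrib_left mult.commute)
  qed
  have summ: "summable (\<lambda>k. frechet_derivative (u k) (at y) h)" if "y \<in> ?K" for y h
    by (rule summable_comparison_test'[OF summable_mult2[OF M, of "norm h"]]) (rule le[OF that])
  have "\<exists>g. \<forall>y\<in>?K. (\<lambda>n. u n y) sums (g y) \<and>
      (g has_derivative (\<lambda>h. \<Sum>k. frechet_derivative (u k) (at y) h)) (at y within ?K)"
  proof (rule has_derivative_series)
    show "convex ?K" by simp
    show "(u n has_derivative frechet_derivative (u n) (at y)) (at y within ?K)" if "y \<in> ?K" for n y
      by (rule has_derivative_at_withinI, rule smooth_on_has_derivative[OF sm]) (use that r in blast)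
    show "x \<in> ?K" using r by simp
    show "(\<lambda>n. u n x) sums (\<Sum>n. u n x)"
      by (rule summable_sums, rule summable_comparison_test'[OF M0(1)]) (use r in \<open>auto intro: M0(2)\<close>)
    fix e :: real assume e: "e > 0"
    obtain N where N: "\<And>n. n \<ge> N \<Longrightarrow> norm (\<Sum>i. M (i + n)) < e"
      using suminf_exist_split[OF e M] by blast
    show "\<forall>\<^sub>F n in sequentially. \<forall>y\<in>?K. \<forall>h. norm ((\<Sum>i<n. frechet_derivative (u i) (at y) h) -
        (\<Sum>k. frechet_derivative (u k) (at y) h)) \<le> e * norm h"
      unfolding eventually_sequentially
    proof (intro exI[of _ N] allI impI ballI)
      fix n y h assume n: "n \<ge> N" and y: "y \<in> ?K"
      let ?f = "\<lambda>k. frechet_derivative (u k) (at y) h"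
      have sM: "summable (\<lambda>i. M (i + n))" using M by (rule summable_ignore_initial_segment)
      have "norm ((\<Sum>i<n. ?f i) - (\<Sum>k. ?f k)) = norm (\<Sum>k. ?f (k + n))"
        using suminf_split_initial_segment[OF summ[OF y], of h n] by (simp add: norm_minus_commute)
      also have "\<dots> \<le> (\<Sum>k. M (k + n) * norm h)"
        by (rule norm_suminf_le[OF _ summable_mult2[OF sM]]) (rule le[OF y])
      also have "\<dots> = (\<Sum>k. M (k + n)) * norm h" by (rule suminf_mult2[OF sM, symmetric])
      also have "\<dots> \<le> e * norm h" using N[OF n] by (intro mult_right_mono) auto
      finally show "norm ((\<Sum>i<n. ?f i) - (\<Sum>k. ?f k)) \<le> e * norm h" .
    qed
  qed
  then obtain g where g: "\<And>y. y \<in> ?K \<Longrightarrow> (\<lambda>n. u n y) sums (g y)"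
    "\<And>y. y \<in> ?K \<Longrightarrow> (g has_derivative (\<lambda>h. \<Sum>k. frechet_derivative (u k) (at y) h)) (at y within ?K)"
    by blast
  have "(g has_derivative (\<lambda>h. \<Sum>k. frechet_derivative (u k) (at x) h)) (at x within ball x r)"
    using g(2)[of x] r by (auto intro: has_derivative_subset)
  then have "(g has_derivative (\<lambda>h. \<Sum>k. frechet_derivative (u k) (at x) h)) (at x)"
    using r at_within_open[of x "ball x r"] by simp
  then show ?thesis
    by (rule has_derivative_transform_within_open[of _ _ _ _ "ball x r"]) (use r sums_unique[OF g(1)] in simp_all)
qed

lemma dird_smooth_series:
  fixes u :: "nat \<Rightarrow> 'a::euclidean_space \<Rightarrow> 'b::banach"
  assumes "smooth_series S u" "x \<in> S"
  shows "dird v (\<lambda>x. \<Sum>k. u k x) x = (\<Sum>k. dird v (u k) x)"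
  using fun_cong[OF frechet_derivative_at[OF has_derivative_smooth_series[OF assms]], of v] by simp

lemma smooth_on_suminf:
  fixes u :: "nat \<Rightarrow> 'a::euclidean_space \<Rightarrow> 'b::banach"
  assumes u: "smooth_series S u"
  shows "smooth_on S (\<lambda>x. \<Sum>k. u k x)"
proof -
  have S: "open S" using u by (simp add: smooth_series_def)
  have "times_diff n S (\<lambda>x. \<Sum>k. u k x)" for n
    using u
  proof (induction n arbitrary: u)
    case (Suc n)
    have "times_diff n S (dird v (\<lambda>x. \<Sum>k. u k x))" for v
      by (rule times_diff_cong[OF S _ Suc.IH[OF smooth_series_dird[OF Suc.prems]]])
        (simp add: dird_smooth_series[OF Suc.prems])
    moreover have "(\<lambda>x. \<Sum>k. u k x) differentiable (at x)" if "x \<in> S" for x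
      using has_derivative_smooth_series[OF Suc.prems that] by (rule differentiableI)
    ultimately show ?case by simp
  qed simp
  then show ?thesis using S by (simp add: smooth_on_iff_times_diff)
qed

lemma summable_jnorm:
  "smooth_series S u \<Longrightarrow> x \<in> S \<Longrightarrow> summable (\<lambda>k. jnorm vs (u k) x)"
proof (induction vs arbitrary: u)
  case Nil
  then obtain M where "summable M" "\<And>k. norm (u k x) \<le> M k"
    unfolding smooth_series_def by (metis compact_sing empty_subsetI insert_subset iter_D.simps(1) singletonI)
  then show ?case by (auto intro: summable_comparison_test')
next
  case (Cons v vs)
  then show ?case by (auto intro!: summable_add smooth_series_dird)
qed

lemma jnorm_suminf_le:
  fixes u :: "nat \<Rightarrow> 'a::euclidean_space \<Rightarrow> 'b::banach"
  shows "smooth_series S u \<Longrightarrow> x \<in> S \<Longrightarrow> jnorm vs (\<lambda>x. \<Sum>k. u k x) x \<le> (\<Sum>k. jnorm vs (u k) x)"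
proof (induction vs arbitrary: u)
  case Nil
  then show ?case using summable_jnorm[OF Nil, of "[]"] by (simp add: summable_norm)
next
  case (Cons v vs)
  have S: "open S" using Cons.prems by (simp add: smooth_series_def)
  have "jnorm vs (dird v (\<lambda>x. \<Sum>k. u k x)) x = jnorm vs (\<lambda>x. \<Sum>k. dird v (u k) x) x"
    by (rule jnorm_cong[OF S Cons.prems(2)]) (rule dird_smooth_series[OF Cons.prems(1)])
  also have "\<dots> \<le> (\<Sum>k. jnorm vs (dird v (u k)) x)"
    by (rule Cons.IH[OF smooth_series_dird[OF Cons.prems(1)] Cons.prems(2)])
  finally show ?case
    using Cons.IH[OF Cons.prems]
    by (simp add: suminf_add[symmetric] summable_jnorm[OF Cons.prems] summable_jnorm[OF smooth_series_dird[OF Cons.prems(1)] Cons.prems(2)])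
qed

section \<open>Powers and the exponential of a matrix valued map\<close>

definition mpow :: "real^'d^'d::finite \<Rightarrow> nat \<Rightarrow> real^'d^'d" where
  "mpow X k = ((**) X ^^ k) (mat 1)"

lemma mpow_simps [simp]: "mpow X 0 = mat 1" "mpow X (Suc k) = X ** mpow X k"
  by (simp_all add: mpow_def)

lemma mpow_scaleR: "mpow (r *\<^sub>R X) k = r ^ k *\<^sub>R mpow X k"
  by (induction k) (simp_all add: mm.scaleR_left mm.scaleR_right)

lemma mpow_intertwine: "Y ** B = B ** X \<Longrightarrow> mpow Y k ** B = B ** mpow X k" for X Y B :: "real^'d^'d::finite"
  by (induction k) (simp_all, metis matrix_mul_assoc)

lemma mexp_eq: "mexp X = (\<Sum>k. (1 / fact k) *\<^sub>R mpow X k)"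
  by (simp add: mexp_def mpow_def)

lemma smooth_on_mpow: "smooth_on S f \<Longrightarrow> smooth_on S (\<lambda>x. mpow (f x) k)"
  by (induction k) (simp_all add: smooth_on_const smooth_on_open smooth_on_mm)

text \<open>Submultiplicativity, \<open>k\<close> times. The last factor stems from the power of
  exponent 0: in the Frobenius norm the unit matrix does not have norm 1.\<close>

lemma jnorm_mpow_le:
  fixes f :: "'a::real_normed_vector \<Rightarrow> real^'d^'d::finite"
  assumes "smooth_on S f" "x \<in> S"
  shows "jnorm vs (\<lambda>x. mpow (f x) k) x \<le> jnorm vs f x ^ k * jnorm vs (\<lambda>_. mat 1 :: real^'d^'d::finite) x"
proof (induction k)
  case (Suc k)
  have "jnorm vs (\<lambda>x. f x ** mpow (f x) k) x \<le> jnorm vs f x * jnorm vs (\<lambda>x. mpow (f x) k) x"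
    by (rule jnorm_mm_le[OF assms(1) smooth_on_mpow[OF assms(1)] assms(2)])
  also have "\<dots> \<le> jnorm vs f x * (jnorm vs f x ^ k * jnorm vs (\<lambda>_. mat 1 :: real^'d^'d) x)"
    by (intro mult_left_mono Suc jnorm_nonneg)
  finally show ?case by (simp add: mult.assoc)
qed simp

lemma summable_exp_scaled: "summable (\<lambda>k. B / fact k * (a ^ k * N))" for a B N :: real
  using summable_mult[OF summable_exp[of a], of "B * N"] by (simp add: field_simps)

lemma jnorm_power_term_le:
  fixes f :: "'a::euclidean_space \<Rightarrow> real^'d^'d::finite"
  assumes f: "smooth_on S f" and c: "\<And>k. \<bar>c k\<bar> \<le> B / fact k" and "x \<in> S"
  shows "jnorm vs (\<lambda>x. c k *\<^sub>R mpow (f x) k) x \<le> B / fact k * (jnorm vs f x ^ k * jnorm vs (\<lambda>_. mat 1 :: real^'d^'d) x)"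
proof -
  have "jnorm vs (\<lambda>x. c k *\<^sub>R mpow (f x) k) x = \<bar>c k\<bar> * jnorm vs (\<lambda>x. mpow (f x) k) x"
    by (rule jnorm_scaleR[OF smooth_on_mpow[OF f] assms(3)])
  also have "\<dots> \<le> B / fact k * (jnorm vs f x ^ k * jnorm vs (\<lambda>_. mat 1 :: real^'d^'d) x)"
    by (intro mult_mono c jnorm_mpow_le[OF f assms(3)] jnorm_nonneg) (use c[of k] in auto)
  finally show ?thesis .
qed

text \<open>The coefficients are kept general for two uses: \<open>1 / fact k\<close> gives the
  exponential, and coefficients bounded by \<open>\<bar>h\<bar> / fact k\<close> give the error of
  its difference quotient.\<close>

lemma smooth_series_power:
  fixes f :: "'a::euclidean_space \<Rightarrow> real^'d^'d::finite"
  assumes f: "smooth_on S f" and c: "\<And>k. \<bar>c k\<bar> \<le> B / fact k"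
  shows "smooth_series S (\<lambda>k x. c k *\<^sub>R mpow (f x) k)"
  unfolding smooth_series_def
proof (intro conjI allI impI)
  show S: "open S" using f by (rule smooth_on_open)
  show "smooth_on S (\<lambda>x. c k *\<^sub>R mpow (f x) k)" for k
    by (intro smooth_on_scaleR smooth_on_mpow f)
  fix vs :: "'a list" and C assume C: "compact C \<and> C \<subseteq> S"
  have bd: "\<exists>a. \<forall>x\<in>C. jnorm vs g x \<le> a" if "smooth_on S g" for g :: "'a \<Rightarrow> real^'d^'d"
  proof -
    have "compact (jnorm vs g ` C)"
      using C continuous_on_jnorm[OF that] by (intro compact_continuous_image) (auto intro: continuous_on_subset)
    then have "bdd_above (jnorm vs g ` C)" by (intro bounded_imp_bdd_above compact_imp_bounded)
    then show ?thesis by (auto simp: bdd_above_def)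
  qed
  obtain a where a: "\<And>x. x \<in> C \<Longrightarrow> jnorm vs f x \<le> a" using bd[OF f] by blast
  obtain N where N: "\<And>x. x \<in> C \<Longrightarrow> jnorm vs (\<lambda>_. mat 1 :: real^'d^'d) x \<le> N" using bd[OF smooth_on_const[OF S]] by blast
  have B: "B \<ge> 0" using c[of 0] by simp
  show "\<exists>M. summable M \<and> (\<forall>k. \<forall>x\<in>C. norm (iter_D vs (\<lambda>x. c k *\<^sub>R mpow (f x) k) x) \<le> M k)"
  proof (intro exI conjI allI ballI)
    show "summable (\<lambda>k. B / fact k * (a ^ k * N))" by (rule summable_exp_scaled)
    fix k x assume x: "x \<in> C"
    then have xS: "x \<in> S" using C by blast
    have "norm (iter_D vs (\<lambda>x. c k *\<^sub>R mpow (f x) k) x) \<le> jnorm vs (\<lambda>x. c k *\<^sub>R mpow (f x) k) x"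
      by (rule norm_iter_D_le_jnorm)
    also have "\<dots> \<le> B / fact k * (jnorm vs f x ^ k * jnorm vs (\<lambda>_. mat 1 :: real^'d^'d) x)"
      by (rule jnorm_power_term_le[OF f c xS])
    also have "\<dots> \<le> B / fact k * (a ^ k * N)"
      using B by (intro mult_left_mono mult_mono power_mono a N x jnorm_nonneg)
        (auto intro!: zero_le_power order_trans[OF jnorm_nonneg a[OF x]])
    finally show "norm (iter_D vs (\<lambda>x. c k *\<^sub>R mpow (f x) k) x) \<le> B / fact k * (a ^ k * N)" .
  qed
qed

lemma jnorm_power_series_le:
  fixes f :: "'a::euclidean_space \<Rightarrow> real^'d^'d::finite"
  assumes f: "smooth_on S f" and c: "\<And>k. \<bar>c k\<bar> \<le> B / fact k" and x: "x \<in> S"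
  shows "jnorm vs (\<lambda>x. \<Sum>k. c k *\<^sub>R mpow (f x) k) x
    \<le> B * (exp (jnorm vs f x) * jnorm vs (\<lambda>_. mat 1 :: real^'d^'d) x)"
proof -
  let ?a = "jnorm vs f x" and ?N = "jnorm vs (\<lambda>_. mat 1 :: real^'d^'d) x"
  have "jnorm vs (\<lambda>x. \<Sum>k. c k *\<^sub>R mpow (f x) k) x \<le> (\<Sum>k. jnorm vs (\<lambda>x. c k *\<^sub>R mpow (f x) k) x)"
    by (rule jnorm_suminf_le[OF smooth_series_power[OF f c] x])
  also have "\<dots> \<le> (\<Sum>k. B / fact k * (?a ^ k * ?N))"
    by (rule suminf_le[OF jnorm_power_term_le[OF f c x] summable_jnorm[OF smooth_series_power[OF f c] x] summable_exp_scaled])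
  also have "\<dots> = (\<Sum>k. (B * ?N) * (?a ^ k /\<^sub>R fact k))"
    by (simp add: field_simps)
  also have "\<dots> = (B * ?N) * exp ?a"
    unfolding exp_def by (rule suminf_mult[OF summable_exp_generic])
  finally show ?thesis by (simp add: mult_ac)
qed

lemma smooth_on_mexp:
  fixes f :: "'a::euclidean_space \<Rightarrow> real^'d^'d::finite"
  assumes "smooth_on S f"
  shows "smooth_on S (\<lambda>x. mexp (f x))"
  unfolding mexp_eq by (rule smooth_on_suminf[OF smooth_series_power[OF assms, of _ 1]]) simp

lemma summable_mexp: "summable (\<lambda>k. (1 / fact k) *\<^sub>R mpow X k)" for X :: "real^'d^'d::finite"
proof -
  \<comment> \<open>A single matrix is regarded as a constant map on the real line; the seminorm of
    the empty list then gives absolute convergence.\<close>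
  have "smooth_series UNIV (\<lambda>k (x::real). (1 / fact k) *\<^sub>R mpow X k)"
    using smooth_series_power[of UNIV "\<lambda>_::real. X" "\<lambda>k. 1 / fact k" 1] by (simp add: smooth_on_const)
  from summable_jnorm[OF this, of 0 "[]"] show ?thesis by (auto intro: summable_norm_cancel)
qed

text \<open>Used with \<open>B\<close> a Jacobian, to see that the exponential of a field transforms
  as a field; with \<open>X = Y\<close>, for commutation; and with \<open>B\<close> the value of
  \<open>J0\<close> and \<open>Y = - X\<close>, where it says that \<open>J0\<close> exchanges the
  exponentials of \<open>a\<close> and \<open>- a\<close>.\<close>

lemma mexp_intertwine:
  fixes X Y B :: "real^'d^'d::finite"
  assumes "Y ** B = B ** X"
  shows "mexp Y ** B = B ** mexp X"
proof -
  have "mexp Y ** B = (\<Sum>k. ((1 / fact k) *\<^sub>R mpow Y k) ** B)"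
    unfolding mexp_eq by (rule bounded_linear.suminf[OF mm.bounded_linear_left summable_mexp])
  also have "\<dots> = (\<Sum>k. B ** ((1 / fact k) *\<^sub>R mpow X k))"
    by (simp add: mm.scaleR_left mm.scaleR_right mpow_intertwine[OF assms])
  also have "\<dots> = B ** mexp X"
    unfolding mexp_eq by (rule bounded_linear.suminf[OF mm.bounded_linear_right summable_mexp, symmetric])
  finally show ?thesis .
qed

lemma mexp_0 [simp]: "mexp (0 :: real^'d^'d::finite) = mat 1"
proof -
  have "(\<Sum>k. (1 / fact k) *\<^sub>R mpow (0 :: real^'d^'d) k) = (\<Sum>k\<in>{0}. (1 / fact k) *\<^sub>R mpow (0 :: real^'d^'d) k)"
  proof (rule suminf_finite)
    fix k :: nat assume "k \<notin> {0}"
    then show "(1 / fact k) *\<^sub>R mpow (0 :: real^'d^'d) k = 0" by (cases k) (auto simp: mm.zero_left)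
  qed simp
  then show ?thesis by (simp add: mexp_eq)
qed

lemma has_vector_derivative_mexp:
  fixes A :: "real^'d^'d::finite"
  shows "((\<lambda>t. mexp (t *\<^sub>R A)) has_vector_derivative (A ** mexp (t *\<^sub>R A))) (at t)"
proof -
  let ?u = "\<lambda>k t. (1 / fact k) *\<^sub>R mpow (t *\<^sub>R A) k"
  have lin: "smooth_on UNIV (\<lambda>t::real. t *\<^sub>R A)"
  proof -
    have "(\<lambda>t::real. t *\<^sub>R A) differentiable (at t)" for t
      by (rule differentiableI[OF bounded_linear.has_derivative[OF bounded_linear_scaleR_left has_derivative_ident]])
    moreover have "dird v (\<lambda>t::real. t *\<^sub>R A) = (\<lambda>_. v *\<^sub>R A)" for v
      by (rule ext, rule fun_cong[OF frechet_derivative_at[symmetric, OF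
            bounded_linear.has_derivative[OF bounded_linear_scaleR_left has_derivative_ident]]])
    ultimately have "times_diff n UNIV (\<lambda>t::real. t *\<^sub>R A)" for n by (cases n) (simp_all add: times_diff_const)
    then show ?thesis by (simp add: smooth_on_iff_times_diff)
  qed
  have ser: "smooth_series UNIV ?u" by (rule smooth_series_power[OF lin, of _ 1]) simp
  have "frechet_derivative (?u k) (at t) h = (h * (of_nat k * t ^ (k - 1) / fact k)) *\<^sub>R mpow A k" for k h
  proof -
    have "?u k = (\<lambda>t. (t ^ k / fact k) *\<^sub>R mpow A k)" by (simp add: mpow_scaleR fun_eq_iff)
    moreover have "((\<lambda>t. (t ^ k / fact k) *\<^sub>R mpow A k) has_derivative
        (\<lambda>h. (h * (of_nat k * t ^ (k - 1) / fact k)) *\<^sub>R mpow A k)) (at t)"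
      by (auto intro!: derivative_eq_intros simp: fun_eq_iff)
    ultimately show ?thesis using frechet_derivative_at by metis
  qed
  with has_derivative_smooth_series[OF ser UNIV_I, of t]
  have der: "((\<lambda>t. mexp (t *\<^sub>R A)) has_derivative
      (\<lambda>h. \<Sum>k. (h * (of_nat k * t ^ (k - 1) / fact k)) *\<^sub>R mpow A k)) (at t)"
    by (simp add: mexp_eq)
  have "(\<Sum>k. (h * (of_nat k * t ^ (k - 1) / fact k)) *\<^sub>R mpow A k) = h *\<^sub>R (A ** mexp (t *\<^sub>R A))" for h
  proof -
    let ?w = "\<lambda>k. (h * (of_nat k * t ^ (k - 1) / fact k)) *\<^sub>R mpow A k"
    have "h * (of_nat (Suc k) * t ^ k / fact (Suc k)) = h * (1 / fact k * t ^ k)" for k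
      by (simp add: fact_Suc del: of_nat_Suc)
    then have "?w (Suc k) = h *\<^sub>R (A ** ?u k t)" for k
      by (simp only: diff_Suc_1 mpow_simps mpow_scaleR mm.scaleR_right scaleR_scaleR mult.assoc)
    moreover have "(\<lambda>k. h *\<^sub>R (A ** ?u k t)) sums (h *\<^sub>R (A ** mexp (t *\<^sub>R A)))"
      unfolding mexp_eq
      by (intro bounded_linear.sums[OF bounded_linear_scaleR_right] bounded_linear.sums[OF mm.bounded_linear_right]
          summable_sums summable_mexp)
    ultimately have "(\<lambda>k. ?w (Suc k)) sums (h *\<^sub>R (A ** mexp (t *\<^sub>R A)))" by simp
    \<comment> \<open>Shifting the index back adds only the term of index 0, which vanishes because
      of its factor \<open>of_nat k\<close>.\<close>
    then have "?w sums (h *\<^sub>R (A ** mexp (t *\<^sub>R A)) + ?w 0)" by (rule sums_Suc)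
    then show ?thesis by (simp add: sums_iff)
  qed
  with der show ?thesis by (simp add: has_vector_derivative_def)
qed

text \<open>As a function of \<open>t\<close> the left side has derivative zero, because
  \<open>A\<close> commutes with its exponentials; its value at \<open>t = 0\<close> is the right
  side. The group law \<open>mexp_add\<close> follows.\<close>

lemma mexp_add_minus:
  fixes A :: "real^'d^'d::finite"
  shows "mexp ((s + t) *\<^sub>R A) ** mexp ((- t) *\<^sub>R A) = mexp (s *\<^sub>R A)"
proof -
  let ?G = "\<lambda>r. mexp ((s + r) *\<^sub>R A) ** mexp ((- r) *\<^sub>R A)"
  have comm: "mexp (r *\<^sub>R A) ** A = A ** mexp (r *\<^sub>R A)" for r
    by (rule mexp_intertwine) (simp add: mm_simps)
  have comm': "mexp (r *\<^sub>R A) ** (A ** B) = A ** (mexp (r *\<^sub>R A) ** B)" for r B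
    by (simp add: matrix_mul_assoc comm)
  have der: "(?G has_vector_derivative 0) (at r within UNIV)" for r
  proof -
    have 1: "((\<lambda>r. mexp ((s + r) *\<^sub>R A)) has_vector_derivative (A ** mexp ((s + r) *\<^sub>R A))) (at r)"
    proof -
      have "((\<lambda>r. s + r) has_vector_derivative 1) (at r)"
        by (auto intro!: derivative_eq_intros simp flip: has_real_derivative_iff_has_vector_derivative)
      from vector_diff_chain_at[OF this has_vector_derivative_mexp[of A]] show ?thesis by (simp add: o_def)
    qed
    have 2: "((\<lambda>r. mexp ((- r) *\<^sub>R A)) has_vector_derivative - (A ** mexp ((- r) *\<^sub>R A))) (at r)"
    proof -
      have "((\<lambda>r. - r) has_vector_derivative - 1) (at r)"
        by (auto intro!: derivative_eq_intros simp flip: has_real_derivative_iff_has_vector_derivative)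
      from vector_diff_chain_at[OF this has_vector_derivative_mexp[of A]] show ?thesis by (simp add: o_def)
    qed
    show ?thesis
      using mm.has_vector_derivative[OF 1 2] by (simp add: mm_simps comm')
  qed
  have "?G t = ?G 0"
  proof (rule has_vector_derivative_zero_constant[of UNIV ?G, OF convex_UNIV der])
    fix c assume c: "\<And>r. r \<in> UNIV \<Longrightarrow> ?G r = c"
    from trans[OF c[OF UNIV_I] sym[OF c[OF UNIV_I]]] show ?thesis .
  qed
  then show ?thesis by simp
qed

lemma mexp_inverse: "mexp A ** mexp (- A) = mat 1" for A :: "real^'d^'d::finite"
  using mexp_add_minus[of 0 1 A] by simp

lemma mexp_add: "mexp ((s + t) *\<^sub>R A) = mexp (s *\<^sub>R A) ** mexp (t *\<^sub>R A)" for A :: "real^'d^'d::finite"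
proof -
  have "mexp ((s + t) *\<^sub>R A) = mexp ((s + t) *\<^sub>R A) ** (mexp ((- t) *\<^sub>R A) ** mexp (t *\<^sub>R A))"
    using mexp_inverse[of "(- t) *\<^sub>R A"] by simp
  also have "\<dots> = mexp (s *\<^sub>R A) ** mexp (t *\<^sub>R A)"
    by (simp only: matrix_mul_assoc mexp_add_minus)
  finally show ?thesis .
qed

text \<open>Removing the terms of order 0 and 1 leaves the coefficients
  \<open>h ^ (k - 1) / fact k\<close> with \<open>k \<ge> 2\<close>. For
  \<open>\<bar>h\<bar> \<le> 1\<close> one factor \<open>\<bar>h\<bar>\<close> can be extracted from
  each, and an exponential series remains.\<close>

lemma jnorm_mexp_quotient_le:
  fixes f :: "'a::euclidean_space \<Rightarrow> real^'d^'d::finite"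
  assumes f: "smooth_on S f" and x: "x \<in> S" and h: "h \<noteq> 0" "\<bar>h\<bar> \<le> 1"
  shows "jnorm vs (\<lambda>x. (1 / h) *\<^sub>R (mexp (h *\<^sub>R f x) - mat 1) - f x) x
    \<le> \<bar>h\<bar> * (exp (jnorm vs f x) * jnorm vs (\<lambda>_. mat 1 :: real^'d^'d) x)"
proof -
  define c where "c k = (if k < 2 then 0 else h ^ (k - 1) / fact k)" for k :: nat
  have c: "\<bar>c k\<bar> \<le> \<bar>h\<bar> / fact k" for k
  proof (cases "k < 2")
    case False
    then obtain j where k: "k = Suc (Suc j)" by (metis add_2_eq_Suc le_Suc_ex not_less)
    have "\<bar>h\<bar> * \<bar>h\<bar> ^ j \<le> \<bar>h\<bar> * 1" using h by (intro mult_left_mono power_le_one) auto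
    then show ?thesis by (simp add: c_def k power_abs abs_mult divide_right_mono)
  qed (simp add: c_def)
  have "(1 / h) *\<^sub>R (mexp (h *\<^sub>R X) - mat 1) - X = (\<Sum>k. c k *\<^sub>R mpow X k)" for X :: "real^'d^'d"
  proof -
    have eq: "c (k + 2) *\<^sub>R mpow X (k + 2) = (1 / h) *\<^sub>R ((1 / fact (k + 2)) *\<^sub>R mpow (h *\<^sub>R X) (k + 2))" for k
      using h by (simp add: c_def mpow_scaleR mm_simps del: fact_Suc)
    have "(\<lambda>k. (1 / fact k) *\<^sub>R mpow (h *\<^sub>R X) k) sums mexp (h *\<^sub>R X)"
      unfolding mexp_eq by (rule summable_sums[OF summable_mexp])
    then have "(\<lambda>k. (1 / fact (k + 2)) *\<^sub>R mpow (h *\<^sub>R X) (k + 2)) sums (mexp (h *\<^sub>R X) - (mat 1 + h *\<^sub>R X))"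
      by (subst sums_iff_shift) (simp add: numeral_2_eq_2)
    from bounded_linear.sums[OF bounded_linear_scaleR_right this, of "1 / h"]
    have "(\<lambda>k. c (k + 2) *\<^sub>R mpow X (k + 2)) sums ((1 / h) *\<^sub>R (mexp (h *\<^sub>R X) - (mat 1 + h *\<^sub>R X)))"
      by (simp only: eq)
    then have "(\<lambda>k. c k *\<^sub>R mpow X k) sums ((1 / h) *\<^sub>R (mexp (h *\<^sub>R X) - (mat 1 + h *\<^sub>R X)))"
      by (subst (asm) sums_iff_shift) (simp add: numeral_2_eq_2 c_def)
    then show ?thesis using h by (simp add: sums_iff algebra_simps)
  qed
  then show ?thesis using jnorm_power_series_le[OF f c x] by simp
qed

section \<open>Smooth endomorphism fields\<close>

abbreviation cdom :: "('m, 'd) chart \<Rightarrow> (real^'d) set" where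
  "cdom c \<equiv> snd c ` fst c"

definition loc :: "('m, 'd::finite) field \<Rightarrow> ('m, 'd) chart \<Rightarrow> real^'d \<Rightarrow> real^'d^'d" where
  "loc X c = (\<lambda>x. X c (coord_inv c x))"

lemma fcomp_apply [simp]: "(A \<odot> B) c p = A c p ** B c p"
  by (simp add: fcomp_def)

lemma fscale_apply [simp]: "(r \<cdot> A) c p = r *\<^sub>R A c p"
  by (simp add: fscale_def)

lemma fid_apply [simp]: "c \<in> At \<Longrightarrow> p \<in> fst c \<Longrightarrow> fid At c p = mat 1"
  by (simp add: fid_def)

lemma finv_apply [simp]: "c \<in> At \<Longrightarrow> p \<in> fst c \<Longrightarrow> finv At A c p = matrix_inv (A c p)"
  by (simp add: finv_def)

lemma fexp_apply [simp]: "c \<in> At \<Longrightarrow> p \<in> fst c \<Longrightarrow> fexp At A c p = mexp (A c p)"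
  by (simp add: fexp_def)

lemma fscale_simps [simp]: "0 \<cdot> A = 0" "1 \<cdot> A = A" "r \<cdot> (s \<cdot> A) = (r * s) \<cdot> A" "r \<cdot> 0 = 0"
  by (simp_all add: fscale_def fun_eq_iff)

section \<open>The algebra of smooth endomorphism fields on a closed manifold\<close>

locale closed_manifold =
  fixes At :: "('m::t2_space, 'd::finite) chart set"
  assumes closed_oriented: "closed_oriented_manifold At"
begin

lemma compact_UNIV: "compact (UNIV :: 'm set)"
  and charts_cover: "(\<Union>c\<in>At. fst c) = UNIV"
  and open_fst: "c \<in> At \<Longrightarrow> open (fst c)"
  and open_dom: "c \<in> At \<Longrightarrow> open (cdom c)"
  and chart_homeomorphism: "c \<in> At \<Longrightarrow> homeomorphism (fst c) (cdom c) (snd c) (coord_inv c)"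
  and det_jac_pos: "c \<in> At \<Longrightarrow> c' \<in> At \<Longrightarrow> p \<in> fst c \<Longrightarrow> p \<in> fst c' \<Longrightarrow> 0 < det (jac c c' p)"
  using closed_oriented by (auto simp: closed_oriented_manifold_def oriented_smooth_atlas_def)

lemma coord_inv_snd: "c \<in> At \<Longrightarrow> p \<in> fst c \<Longrightarrow> coord_inv c (snd c p) = p"
  using chart_homeomorphism[of c] by (simp add: homeomorphism_def)

lemma coord_inv_dom:
  assumes "c \<in> At" "x \<in> cdom c"
  shows "coord_inv c x \<in> fst c" "snd c (coord_inv c x) = x"
proof -
  obtain p where "p \<in> fst c" "x = snd c p" using assms(2) by blast
  then show "coord_inv c x \<in> fst c" "snd c (coord_inv c x) = x"
    by (simp_all add: coord_inv_snd[OF assms(1)])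
qed

lemma chart_around: obtains c where "c \<in> At" "p \<in> fst c"
  using charts_cover by blast

lemma endoD:
  assumes "X \<in> endo At"
  shows "c \<in> At \<Longrightarrow> smooth_on (cdom c) (loc X c)"
    and "c \<in> At \<Longrightarrow> c' \<in> At \<Longrightarrow> p \<in> fst c \<Longrightarrow> p \<in> fst c' \<Longrightarrow> X c' p ** jac c c' p = jac c c' p ** X c p"
    and "\<not> (c \<in> At \<and> p \<in> fst c) \<Longrightarrow> X c p = 0"
  using assms unfolding endo_def loc_def mem_Collect_eq by blast+

lemma endoI:
  assumes "\<And>c. c \<in> At \<Longrightarrow> smooth_on (cdom c) (loc X c)"
    and "\<And>c c' p. c \<in> At \<Longrightarrow> c' \<in> At \<Longrightarrow> p \<in> fst c \<Longrightarrow> p \<in> fst c' \<Longrightarrow> X c' p ** jac c c' p = jac c c' p ** X c p"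
    and "\<And>c p. \<not> (c \<in> At \<and> p \<in> fst c) \<Longrightarrow> X c p = 0"
  shows "X \<in> endo At"
  using assms unfolding endo_def loc_def by blast

lemma field_eqI:
  assumes "X \<in> endo At" "Y \<in> endo At" "\<And>c p. c \<in> At \<Longrightarrow> p \<in> fst c \<Longrightarrow> X c p = Y c p"
  shows "X = Y"
proof (intro ext)
  fix c p show "X c p = Y c p"
    using assms(3) endoD(3)[OF assms(1)] endoD(3)[OF assms(2)] by (cases "c \<in> At \<and> p \<in> fst c") auto
qed

lemma endo_0: "0 \<in> endo At"
  by (rule endoI) (auto simp: loc_def smooth_on_const open_dom mm.zero_left mm.zero_right)

lemma endo_add: assumes "X \<in> endo At" "Y \<in> endo At" shows "X + Y \<in> endo At"
proof (rule endoI)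
  show "smooth_on (cdom c) (loc (X + Y) c)" if "c \<in> At" for c
    using smooth_on_add[OF endoD(1)[OF assms(1) that] endoD(1)[OF assms(2) that]] by (simp add: loc_def)
qed (simp_all add: mm.add_left mm.add_right endoD(2,3)[OF assms(1)] endoD(2,3)[OF assms(2)])

lemma endo_minus: assumes "X \<in> endo At" shows "- X \<in> endo At"
proof (rule endoI)
  show "smooth_on (cdom c) (loc (- X) c)" if "c \<in> At" for c
    using smooth_on_minus[OF endoD(1)[OF assms that]] by (simp add: loc_def)
qed (simp_all add: mm.minus_left mm.minus_right endoD(2,3)[OF assms])

lemma endo_diff: "X \<in> endo At \<Longrightarrow> Y \<in> endo At \<Longrightarrow> X - Y \<in> endo At"
  using endo_add[OF _ endo_minus, of X Y] by simp

lemma endo_fscale: assumes "X \<in> endo At" shows "r \<cdot> X \<in> endo At"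
proof (rule endoI)
  show "smooth_on (cdom c) (loc (r \<cdot> X) c)" if "c \<in> At" for c
    using smooth_on_scaleR[OF endoD(1)[OF assms that]] by (simp add: loc_def)
qed (simp_all add: mm.scaleR_left mm.scaleR_right endoD(2,3)[OF assms])

lemma endo_fcomp: assumes "X \<in> endo At" "Y \<in> endo At" shows "X \<odot> Y \<in> endo At"
proof (rule endoI)
  show "smooth_on (cdom c) (loc (X \<odot> Y) c)" if "c \<in> At" for c
    using smooth_on_mm[OF endoD(1)[OF assms(1) that] endoD(1)[OF assms(2) that]] by (simp add: loc_def)
  show "(X \<odot> Y) c' p ** jac c c' p = jac c c' p ** (X \<odot> Y) c p"
    if "c \<in> At" "c' \<in> At" "p \<in> fst c" "p \<in> fst c'" for c c' p
    using endoD(2)[OF assms(1) that] endoD(2)[OF assms(2) that]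
    by (metis fcomp_apply matrix_mul_assoc)
qed (auto simp: mm.zero_left endoD(3)[OF assms(1)])

lemma endo_fid: "fid At \<in> endo At"
proof (rule endoI)
  show "smooth_on (cdom c) (loc (fid At) c)" if "c \<in> At" for c
    by (rule smooth_on_cong[OF smooth_on_const[OF open_dom[OF that]]])
      (use that coord_inv_dom(1) in \<open>auto simp: loc_def\<close>)
qed (auto simp: fid_def)

lemma endo_finv: assumes "X \<in> endo At" "is_iso At X" shows "finv At X \<in> endo At"
proof (rule endoI)
  have inv: "invertible (X c p)" if "c \<in> At" "p \<in> fst c" for c p
    using assms(2) that by (simp add: is_iso_def)
  show "smooth_on (cdom c) (loc (finv At X) c)" if "c \<in> At" for c
  proof (rule smooth_on_cong[OF smooth_on_matrix_inv[OF endoD(1)[OF assms(1) that]]])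
    show "invertible (loc X c x)" if "x \<in> cdom c" for x
      using inv coord_inv_dom(1) \<open>c \<in> At\<close> that by (simp add: loc_def)
    show "matrix_inv (loc X c x) = loc (finv At X) c x" if "x \<in> cdom c" for x
      using coord_inv_dom(1) \<open>c \<in> At\<close> that by (simp add: loc_def)
  qed
  show "finv At X c' p ** jac c c' p = jac c c' p ** finv At X c p"
    if c: "c \<in> At" "c' \<in> At" "p \<in> fst c" "p \<in> fst c'" for c c' p
  proof -
    have "matrix_inv (X c' p) ** (X c' p ** jac c c' p) ** matrix_inv (X c p)
        = matrix_inv (X c' p) ** (jac c c' p ** X c p) ** matrix_inv (X c p)"
      by (simp add: endoD(2)[OF assms(1) c])
    then show ?thesis using c inv by (simp add: mm_assoc matrix_inv_mul_assoc matrix_inv_mul)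
  qed
qed (auto simp: finv_def)

lemma endo_fexp: assumes "X \<in> endo At" shows "fexp At X \<in> endo At"
proof (rule endoI)
  show "smooth_on (cdom c) (loc (fexp At X) c)" if "c \<in> At" for c
    by (rule smooth_on_cong[OF smooth_on_mexp[OF endoD(1)[OF assms that]]])
      (use coord_inv_dom(1) that in \<open>simp add: loc_def\<close>)
  show "fexp At X c' p ** jac c c' p = jac c c' p ** fexp At X c p"
    if "c \<in> At" "c' \<in> At" "p \<in> fst c" "p \<in> fst c'" for c c' p
    using mexp_intertwine[OF endoD(2)[OF assms that]] that by simp
qed (auto simp: fexp_def)

lemmas endo_intros = endo_0 endo_add endo_minus endo_diff endo_fscale endo_fcomp endo_fid endo_finv endo_fexp

lemma invertible_jac:
  "c \<in> At \<Longrightarrow> c' \<in> At \<Longrightarrow> p \<in> fst c \<Longrightarrow> p \<in> fst c' \<Longrightarrow> invertible (jac c c' p)"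
  using det_jac_pos[of c c' p] by (simp add: invertible_det_nz)

lemma endo_conj:
  assumes "X \<in> endo At" "c \<in> At" "c' \<in> At" "p \<in> fst c" "p \<in> fst c'"
  shows "X c' p = jac c c' p ** X c p ** matrix_inv (jac c c' p)"
proof -
  have "X c' p = X c' p ** jac c c' p ** matrix_inv (jac c c' p)"
    by (simp add: mm_assoc matrix_inv_mul[OF invertible_jac[OF assms(2-5)]])
  then show ?thesis by (simp add: endoD(2)[OF assms])
qed

lemma invertible_chart_indep:
  assumes "X \<in> endo At" "c \<in> At" "c' \<in> At" "p \<in> fst c" "p \<in> fst c'" "invertible (X c p)"
  shows "invertible (X c' p)"
  unfolding endo_conj[OF assms(1-5)]
  by (intro invertible_mult assms(6) invertible_matrix_inv invertible_jac[OF assms(2-5)])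

section \<open>Seminorms and convergence of fields\<close>

definition chart_compact :: "('m, 'd) chart \<Rightarrow> (real^'d) set \<Rightarrow> bool" where
  "chart_compact c C \<longleftrightarrow> c \<in> At \<and> compact C \<and> C \<subseteq> cdom c"

text \<open>The value \<open>0\<close> is inserted because the supremum of the empty set of reals is unspecified.\<close>

definition pn :: "('m, 'd) chart \<Rightarrow> (real^'d) set \<Rightarrow> (real^'d) list \<Rightarrow> ('m, 'd) field \<Rightarrow> real" where
  "pn c C vs X = Sup (insert 0 (jnorm vs (loc X c) ` C))"

lemma pn_bounds:
  assumes "chart_compact c C" "X \<in> endo At"
  shows pn_nonneg: "0 \<le> pn c C vs X" and pn_upper: "x \<in> C \<Longrightarrow> jnorm vs (loc X c) x \<le> pn c C vs X"
proof -
  have "continuous_on (cdom c) (jnorm vs (loc X c))"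
    using assms by (intro continuous_on_jnorm endoD(1)) (simp_all add: chart_compact_def)
  then have "compact (jnorm vs (loc X c) ` C)"
    using assms unfolding chart_compact_def by (intro compact_continuous_image) (auto elim: continuous_on_subset)
  then have bdd: "bdd_above (insert 0 (jnorm vs (loc X c) ` C))"
    by (simp add: bounded_imp_bdd_above compact_imp_bounded)
  show "0 \<le> pn c C vs X" "x \<in> C \<Longrightarrow> jnorm vs (loc X c) x \<le> pn c C vs X"
    unfolding pn_def by (auto intro: cSup_upper[OF _ bdd])
qed

lemma pn_least: "(\<And>x. x \<in> C \<Longrightarrow> jnorm vs (loc X c) x \<le> b) \<Longrightarrow> 0 \<le> b \<Longrightarrow> pn c C vs X \<le> b"
  unfolding pn_def by (rule cSup_least) auto

context
  fixes c C assumes cC: "chart_compact c C"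
begin

lemma smooth_on_loc: "X \<in> endo At \<Longrightarrow> smooth_on (cdom c) (loc X c)"
  using cC endoD(1) by (simp add: chart_compact_def)

lemma in_dom: "x \<in> C \<Longrightarrow> x \<in> cdom c"
  using cC unfolding chart_compact_def by blast

lemma pn_add_le:
  assumes X: "X \<in> endo At" and Y: "Y \<in> endo At"
  shows "pn c C vs (X + Y) \<le> pn c C vs X + pn c C vs Y"
proof (rule pn_least)
  fix x assume x: "x \<in> C"
  have "jnorm vs (loc (X + Y) c) x \<le> jnorm vs (loc X c) x + jnorm vs (loc Y c) x"
    using jnorm_add_le[OF smooth_on_loc[OF X] smooth_on_loc[OF Y] in_dom[OF x]] by (simp add: loc_def)
  also have "\<dots> \<le> pn c C vs X + pn c C vs Y"
    by (intro add_mono pn_upper cC X Y x)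
  finally show "jnorm vs (loc (X + Y) c) x \<le> pn c C vs X + pn c C vs Y" .
qed (intro add_nonneg_nonneg pn_nonneg cC X Y)

lemma pn_fcomp_le:
  assumes X: "X \<in> endo At" and Y: "Y \<in> endo At"
  shows "pn c C vs (X \<odot> Y) \<le> pn c C vs X * pn c C vs Y"
proof (rule pn_least)
  fix x assume x: "x \<in> C"
  have "jnorm vs (loc (X \<odot> Y) c) x \<le> jnorm vs (loc X c) x * jnorm vs (loc Y c) x"
    using jnorm_mm_le[OF smooth_on_loc[OF X] smooth_on_loc[OF Y] in_dom[OF x]] by (simp add: loc_def)
  also have "\<dots> \<le> pn c C vs X * pn c C vs Y"
    by (intro mult_mono pn_upper cC X Y x jnorm_nonneg pn_nonneg)
  finally show "jnorm vs (loc (X \<odot> Y) c) x \<le> pn c C vs X * pn c C vs Y" .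
qed (intro mult_nonneg_nonneg pn_nonneg cC X Y)

lemma pn_fscale_le:
  assumes X: "X \<in> endo At"
  shows "pn c C vs (r \<cdot> X) \<le> \<bar>r\<bar> * pn c C vs X"
proof (rule pn_least)
  fix x assume x: "x \<in> C"
  have "jnorm vs (loc (r \<cdot> X) c) x = \<bar>r\<bar> * jnorm vs (loc X c) x"
    using jnorm_scaleR[OF smooth_on_loc[OF X] in_dom[OF x]] by (simp add: loc_def)
  also have "\<dots> \<le> \<bar>r\<bar> * pn c C vs X"
    by (intro mult_left_mono pn_upper cC X x) auto
  finally show "jnorm vs (loc (r \<cdot> X) c) x \<le> \<bar>r\<bar> * pn c C vs X" .
qed (intro mult_nonneg_nonneg pn_nonneg cC X, simp)

lemma pn_minus_le:
  assumes X: "X \<in> endo At"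
  shows "pn c C vs (- X) \<le> pn c C vs X"
proof -
  have "- X = (- 1) \<cdot> X" by (simp add: fun_eq_iff)
  then show ?thesis using pn_fscale_le[OF X, of vs "- 1"] by simp
qed

lemma pn_triangle:
  assumes X: "X \<in> endo At" and Y: "Y \<in> endo At"
  shows "pn c C vs X \<le> pn c C vs (X - Y) + pn c C vs Y"
  using pn_add_le[OF endo_diff[OF X Y] Y, of vs] by simp

end

text \<open>\<open>Cinf_tendsto\<close> does not force the approximating objects to be smooth
  fields, whereas the seminorm estimates hold only for such; hence membership in
  \<open>endo At\<close> is carried along.\<close>

definition conv :: "('t \<Rightarrow> ('m, 'd) field) \<Rightarrow> ('m, 'd) field \<Rightarrow> 't filter \<Rightarrow> bool" where
  "conv F L \<F> \<longleftrightarrow> (\<forall>\<^sub>F t in \<F>. F t \<in> endo At) \<and> L \<in> endo At \<and> Cinf_tendsto At F L \<F>"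

text \<open>The seminorm of \<open>vs\<close> dominates the derivative along \<open>vs\<close>;
  conversely it is a sum of finitely many derivatives, each of which converges uniformly on
  \<open>C\<close>.\<close>

lemma conv_iff_pn:
  "conv F L \<F> \<longleftrightarrow> (\<forall>\<^sub>F t in \<F>. F t \<in> endo At) \<and> L \<in> endo At \<and>
     (\<forall>c C vs. chart_compact c C \<longrightarrow> ((\<lambda>t. pn c C vs (F t - L)) \<longlongrightarrow> 0) \<F>)"
proof -
  have "Cinf_tendsto At F L \<F> \<longleftrightarrow> (\<forall>c C vs. chart_compact c C \<longrightarrow> ((\<lambda>t. pn c C vs (F t - L)) \<longlongrightarrow> 0) \<F>)"
    if ev: "\<forall>\<^sub>F t in \<F>. F t \<in> endo At" and L: "L \<in> endo At"
  proof
    assume lim: "\<forall>c C vs. chart_compact c C \<longrightarrow> ((\<lambda>t. pn c C vs (F t - L)) \<longlongrightarrow> 0) \<F>"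
    show "Cinf_tendsto At F L \<F>"
      unfolding Cinf_tendsto_def loc_def[symmetric]
    proof (intro ballI allI impI)
      fix c C and vs :: "(real^'d) list" assume c: "c \<in> At" and C: "compact C \<and> C \<subseteq> cdom c"
      then have cC: "chart_compact c C" by (simp add: chart_compact_def)
      show "uniform_limit C (\<lambda>t. iter_D vs (loc (F t) c)) (iter_D vs (loc L c)) \<F>"
      proof (rule uniform_limitI)
        fix e :: real assume "e > 0"
        with lim cC have "\<forall>\<^sub>F t in \<F>. pn c C vs (F t - L) < e" using order_tendstoD(2) by blast
        with ev show "\<forall>\<^sub>F t in \<F>. \<forall>x\<in>C. dist (iter_D vs (loc (F t) c) x) (iter_D vs (loc L c) x) < e"
        proof eventually_elim
          case (elim t)
          show ?case
          proof
            fix x assume x: "x \<in> C"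
            have "iter_D vs (loc (F t) c) x - iter_D vs (loc L c) x = iter_D vs (loc (F t - L) c) x"
              using iter_D_diff[OF smooth_on_loc[OF cC elim(1)] smooth_on_loc[OF cC L] in_dom[OF cC x]]
              by (simp add: loc_def)
            then have "dist (iter_D vs (loc (F t) c) x) (iter_D vs (loc L c) x) \<le> jnorm vs (loc (F t - L) c) x"
              by (simp add: dist_norm norm_iter_D_le_jnorm)
            also have "\<dots> \<le> pn c C vs (F t - L)"
              by (rule pn_upper[OF cC endo_diff[OF elim(1) L] x])
            finally show "dist (iter_D vs (loc (F t) c) x) (iter_D vs (loc L c) x) < e" using elim by simp
          qed
        qed
      qed
    qed
  next
    assume lim: "Cinf_tendsto At F L \<F>"
    show "\<forall>c C vs. chart_compact c C \<longrightarrow> ((\<lambda>t. pn c C vs (F t - L)) \<longlongrightarrow> 0) \<F>"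
    proof (intro allI impI)
      fix c C vs assume cC: "chart_compact c C"
      then have ul: "uniform_limit C (\<lambda>t. iter_D us (loc (F t) c)) (iter_D us (loc L c)) \<F>" for us
        using lim unfolding Cinf_tendsto_def chart_compact_def loc_def by blast
      show "((\<lambda>t. pn c C vs (F t - L)) \<longlongrightarrow> 0) \<F>"
      proof (rule tendstoI)
        fix e :: real assume e: "e > 0"
        define N where "N = length (subseqs vs)"
        \<comment> \<open>The error \<open>e\<close> is shared among the subsequences. The added 1
          keeps the denominator positive, and the factor 2 keeps the inequality strict after passing
          to the supremum.\<close>
        define d where "d = e / (2 * (real N + 1))"
        have d: "d > 0" using e by (simp add: d_def)
        have "real N * d \<le> (real N + 1) * d" using d by simp
        also have "\<dots> = e / 2" by (simp add: d_def field_simps)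
        finally have Nd: "real N * d \<le> e / 2" .
        have "\<forall>\<^sub>F t in \<F>. \<forall>us\<in>set (subseqs vs). \<forall>x\<in>C. dist (iter_D us (loc (F t) c) x) (iter_D us (loc L c) x) < d"
          by (rule eventually_ball_finite) (use uniform_limitD[OF ul d] in auto)
        with ev show "\<forall>\<^sub>F t in \<F>. dist (pn c C vs (F t - L)) 0 < e"
        proof eventually_elim
          case (elim t)
          have "pn c C vs (F t - L) \<le> e / 2"
          proof (rule pn_least)
            fix x assume x: "x \<in> C"
            have "jnorm vs (loc (F t - L) c) x = (\<Sum>us\<leftarrow>subseqs vs. norm (iter_D us (loc (F t) c) x - iter_D us (loc L c) x))"
              unfolding jnorm_def
              using iter_D_diff[OF smooth_on_loc[OF cC elim(1)] smooth_on_loc[OF cC L] in_dom[OF cC x]]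
              by (simp add: loc_def)
            also have "\<dots> \<le> (\<Sum>us\<leftarrow>subseqs vs. d)"
              using elim(2) x by (intro sum_list_mono) (force simp: dist_norm)
            also have "\<dots> = real N * d" by (simp add: N_def sum_list_triv)
            finally show "jnorm vs (loc (F t - L) c) x \<le> e / 2" using Nd by simp
          qed (use e in simp)
          then show ?case using e pn_nonneg[OF cC endo_diff[OF elim(1) L], of vs] by simp
        qed
      qed
    qed
  qed
  then show ?thesis unfolding conv_def by blast
qed

lemma conv_endo: "conv F L \<F> \<Longrightarrow> L \<in> endo At"
  and conv_eventually_endo: "conv F L \<F> \<Longrightarrow> \<forall>\<^sub>F t in \<F>. F t \<in> endo At"
  and conv_pn: "conv F L \<F> \<Longrightarrow> chart_compact c C \<Longrightarrow> ((\<lambda>t. pn c C vs (F t - L)) \<longlongrightarrow> 0) \<F>"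
  unfolding conv_iff_pn by blast+

lemma conv_null_comparison:
  assumes "\<forall>\<^sub>F t in \<F>. F t \<in> endo At" "L \<in> endo At"
    and "\<And>c C vs. chart_compact c C \<Longrightarrow> \<exists>b. (\<forall>\<^sub>F t in \<F>. pn c C vs (F t - L) \<le> b t) \<and> (b \<longlongrightarrow> 0) \<F>"
  shows "conv F L \<F>"
  unfolding conv_iff_pn
proof (intro conjI assms(1,2) allI impI)
  fix c C vs assume cC: "chart_compact c C"
  obtain b where b: "\<forall>\<^sub>F t in \<F>. pn c C vs (F t - L) \<le> b t" "(b \<longlongrightarrow> 0) \<F>" using assms(3)[OF cC] by blast
  show "((\<lambda>t. pn c C vs (F t - L)) \<longlongrightarrow> 0) \<F>"
  proof (rule Lim_null_comparison[OF _ b(2)])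
    show "\<forall>\<^sub>F t in \<F>. norm (pn c C vs (F t - L)) \<le> b t"
      using b(1) assms(1)
      by eventually_elim (simp add: pn_nonneg[OF cC endo_diff[OF _ assms(2)]])
  qed
qed

lemma conv_cong:
  assumes "\<forall>\<^sub>F t in \<F>. F t = G t" "conv F L \<F>"
  shows "conv G L \<F>"
proof (rule conv_null_comparison)
  show "\<forall>\<^sub>F t in \<F>. G t \<in> endo At" using assms(1) conv_eventually_endo[OF assms(2)] by eventually_elim simp
  show "\<exists>b. (\<forall>\<^sub>F t in \<F>. pn c C vs (G t - L) \<le> b t) \<and> (b \<longlongrightarrow> 0) \<F>" if "chart_compact c C" for c C vs
    by (rule exI[of _ "\<lambda>t. pn c C vs (F t - L)"])
      (use assms(1) conv_pn[OF assms(2) that] in \<open>auto elim: eventually_mono\<close>)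
qed (rule conv_endo[OF assms(2)])

lemma conv_const: "L \<in> endo At \<Longrightarrow> conv (\<lambda>_. L) L \<F>"
proof (rule conv_null_comparison)
  have "jnorm vs (\<lambda>_. 0 :: real^'d^'d) x = 0" for vs and x :: "real^'d"
    by (induction vs) simp_all
  then have "pn c C vs (L - L) \<le> 0" for c C vs
    by (intro pn_least) (simp_all add: loc_def)
  then show "\<exists>b. (\<forall>\<^sub>F t in \<F>. pn c C vs (L - L) \<le> b t) \<and> (b \<longlongrightarrow> 0) \<F>" for c C vs
    by (intro exI[of _ "\<lambda>_. 0"]) simp
qed auto

lemma conv_add:
  assumes F: "conv F L \<F>" and G: "conv G M \<F>"
  shows "conv (\<lambda>t. F t + G t) (L + M) \<F>"
proof (rule conv_null_comparison)
  note ev = conv_eventually_endo[OF F] conv_eventually_endo[OF G] and en = conv_endo[OF F] conv_endo[OF G]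
  show "L + M \<in> endo At" by (intro endo_add en)
  show "\<forall>\<^sub>F t in \<F>. F t + G t \<in> endo At" using ev by eventually_elim (rule endo_add)
  fix c C vs assume cC: "chart_compact c C"
  have "\<forall>\<^sub>F t in \<F>. pn c C vs (F t + G t - (L + M)) \<le> pn c C vs (F t - L) + pn c C vs (G t - M)"
    using ev
  proof eventually_elim
    case (elim t)
    have "F t + G t - (L + M) = (F t - L) + (G t - M)" by (simp add: algebra_simps)
    then show ?case using pn_add_le[OF cC endo_diff[OF elim(1) en(1)] endo_diff[OF elim(2) en(2)]] by (simp only:)
  qed
  moreover have "((\<lambda>t. pn c C vs (F t - L) + pn c C vs (G t - M)) \<longlongrightarrow> 0) \<F>"
    using tendsto_add[OF conv_pn[OF F cC] conv_pn[OF G cC]] by simp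
  ultimately show "\<exists>b. (\<forall>\<^sub>F t in \<F>. pn c C vs (F t + G t - (L + M)) \<le> b t) \<and> (b \<longlongrightarrow> 0) \<F>"
    by (intro exI[of _ "\<lambda>t. pn c C vs (F t - L) + pn c C vs (G t - M)"] conjI)
qed

lemma conv_fcomp:
  assumes F: "conv F L \<F>" and G: "conv G M \<F>"
  shows "conv (\<lambda>t. F t \<odot> G t) (L \<odot> M) \<F>"
proof (rule conv_null_comparison)
  note ev = conv_eventually_endo[OF F] conv_eventually_endo[OF G] and en = conv_endo[OF F] conv_endo[OF G]
  show "L \<odot> M \<in> endo At" by (intro endo_fcomp en)
  show "\<forall>\<^sub>F t in \<F>. F t \<odot> G t \<in> endo At" using ev by eventually_elim (rule endo_fcomp)
  fix c C vs assume cC: "chart_compact c C"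
  let ?b = "\<lambda>t. pn c C vs (F t - L) * (pn c C vs (G t - M) + pn c C vs M) + pn c C vs L * pn c C vs (G t - M)"
  have "\<forall>\<^sub>F t in \<F>. pn c C vs (F t \<odot> G t - L \<odot> M) \<le> ?b t"
    using ev
  proof eventually_elim
    case (elim t)
    note d = endo_diff[OF elim(1) en(1)] endo_diff[OF elim(2) en(2)]
    have "F t \<odot> G t - L \<odot> M = (F t - L) \<odot> G t + L \<odot> (G t - M)" by (simp add: fun_eq_iff mm_simps)
    then have "pn c C vs (F t \<odot> G t - L \<odot> M) \<le> pn c C vs ((F t - L) \<odot> G t) + pn c C vs (L \<odot> (G t - M))"
      using pn_add_le[OF cC endo_fcomp[OF d(1) elim(2)] endo_fcomp[OF en(1) d(2)]] by simp
    also have "\<dots> \<le> pn c C vs (F t - L) * pn c C vs (G t) + pn c C vs L * pn c C vs (G t - M)"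
      by (intro add_mono pn_fcomp_le cC d elim en)
    also have "\<dots> \<le> ?b t"
      by (intro add_mono mult_left_mono pn_triangle cC pn_nonneg d elim en order_refl)
    finally show ?case .
  qed
  moreover have "(?b \<longlongrightarrow> 0 * (0 + pn c C vs M) + pn c C vs L * 0) \<F>"
    by (intro tendsto_intros conv_pn[OF F cC] conv_pn[OF G cC])
  ultimately show "\<exists>b. (\<forall>\<^sub>F t in \<F>. pn c C vs (F t \<odot> G t - L \<odot> M) \<le> b t) \<and> (b \<longlongrightarrow> 0) \<F>"
    by (intro exI[of _ ?b]) simp
qed

lemma conv_fscale:
  assumes F: "conv F L \<F>" and r: "(r \<longlongrightarrow> s) \<F>"
  shows "conv (\<lambda>t. r t \<cdot> F t) (s \<cdot> L) \<F>"
proof (rule conv_null_comparison)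
  note ev = conv_eventually_endo[OF F] and en = conv_endo[OF F]
  show "s \<cdot> L \<in> endo At" by (intro endo_fscale en)
  show "\<forall>\<^sub>F t in \<F>. r t \<cdot> F t \<in> endo At" using ev by eventually_elim (rule endo_fscale)
  fix c C vs assume cC: "chart_compact c C"
  let ?b = "\<lambda>t. \<bar>r t\<bar> * pn c C vs (F t - L) + \<bar>r t - s\<bar> * pn c C vs L"
  have "\<forall>\<^sub>F t in \<F>. pn c C vs (r t \<cdot> F t - s \<cdot> L) \<le> ?b t"
    using ev
  proof eventually_elim
    case (elim t)
    have "r t \<cdot> F t - s \<cdot> L = r t \<cdot> (F t - L) + (r t - s) \<cdot> L" by (simp add: fun_eq_iff algebra_simps)
    then have "pn c C vs (r t \<cdot> F t - s \<cdot> L) \<le> pn c C vs (r t \<cdot> (F t - L)) + pn c C vs ((r t - s) \<cdot> L)"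
      using pn_add_le[OF cC endo_fscale[OF endo_diff[OF elim en]] endo_fscale[OF en]] by simp
    also have "\<dots> \<le> ?b t" by (intro add_mono pn_fscale_le cC endo_diff elim en)
    finally show ?case .
  qed
  moreover have "(?b \<longlongrightarrow> \<bar>s\<bar> * 0 + \<bar>s - s\<bar> * pn c C vs L) \<F>"
    by (intro tendsto_intros conv_pn[OF F cC] r)
  ultimately show "\<exists>b. (\<forall>\<^sub>F t in \<F>. pn c C vs (r t \<cdot> F t - s \<cdot> L) \<le> b t) \<and> (b \<longlongrightarrow> 0) \<F>"
    by (intro exI[of _ ?b]) simp
qed

lemma conv_minus: "conv F L \<F> \<Longrightarrow> conv (\<lambda>t. - F t) (- L) \<F>"
  using conv_fscale[OF _ tendsto_const[of "- 1"], of F L \<F>] by (simp add: fscale_def fun_Compl_def)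

lemma conv_diff: "conv F L \<F> \<Longrightarrow> conv G M \<F> \<Longrightarrow> conv (\<lambda>t. F t - G t) (L - M) \<F>"
  using conv_add[OF _ conv_minus, of F L \<F> G M] by simp

text \<open>Here compactness of the manifold enters: finitely many seminorms of order zero control a
  field at every point. Openness of invertibility, finiteness of the volume and continuity of
  integrated traces all rest on this.\<close>

lemma finite_compact_cover:
  obtains I where "finite I" "\<And>c C. (c, C) \<in> I \<Longrightarrow> chart_compact c C"
    "\<And>p. \<exists>(c, C)\<in>I. p \<in> fst c \<and> snd c p \<in> C"
proof -
  have "\<exists>c r. c \<in> At \<and> p \<in> fst c \<and> r > 0 \<and> cball (snd c p) r \<subseteq> cdom c" for p
  proof -
    obtain c where c: "c \<in> At" "p \<in> fst c" by (rule chart_around)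
    with open_dom[of c] open_contains_cball[of "cdom c"] show ?thesis by blast
  qed
  then obtain ch r where ch: "\<And>p. ch p \<in> At" "\<And>p. p \<in> fst (ch p)" "\<And>p. r p > (0::real)"
    "\<And>p. cball (snd (ch p) p) (r p) \<subseteq> cdom (ch p)" by metis
  \<comment> \<open>Open balls give the open cover from which finitely many sets are chosen; the
    closed balls of the same radius are the compact pieces.\<close>
  define O' where "O' p = fst (ch p) \<inter> snd (ch p) -` ball (snd (ch p) p) (r p)" for p
  have "open (O' p)" for p
    unfolding O'_def using chart_homeomorphism[OF ch(1)] open_fst[OF ch(1)]
    by (intro continuous_open_preimage) (auto simp: homeomorphism_def)
  moreover have "UNIV \<subseteq> (\<Union>p\<in>UNIV. O' p)" using ch by (auto simp: O'_def)
  ultimately obtain P where P: "finite P" "UNIV \<subseteq> (\<Union>p\<in>P. O' p)"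
    using compactE_image[OF compact_UNIV, of UNIV O'] by auto
  let ?I = "(\<lambda>p. (ch p, cball (snd (ch p) p) (r p))) ` P"
  show ?thesis
  proof
    show "finite ?I" using P by simp
    show "chart_compact c C" if "(c, C) \<in> ?I" for c C
    proof -
      from that obtain p where p: "c = ch p" "C = cball (snd (ch p) p) (r p)" by blast
      show ?thesis unfolding p chart_compact_def using ch(1,4) by simp
    qed
    show "\<exists>(c, C)\<in>?I. p \<in> fst c \<and> snd c p \<in> C" for p
      using P(2) by (force simp: O'_def)
  qed
qed

text \<open>On each compact piece the inverse of the limit is bounded, so an error that is small in
  order zero keeps all values invertible at once. The finite cover makes this uniform over the
  manifold, and invertibility at a point passes from one chart to the others.\<close>

lemma eventually_is_iso:
  assumes F: "conv F L \<F>" and L: "is_iso At L"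
  shows "\<forall>\<^sub>F t in \<F>. is_iso At (F t)"
proof -
  obtain I where I: "finite I" "\<And>c C. (c, C) \<in> I \<Longrightarrow> chart_compact c C"
    "\<And>p. \<exists>(c, C)\<in>I. p \<in> fst c \<and> snd c p \<in> C" by (rule finite_compact_cover) blast
  note en = conv_endo[OF F]
  have "\<forall>\<^sub>F t in \<F>. pn c C [] (finv At L) * pn c C [] (F t - L) < 1" if "(c, C) \<in> I" for c C
  proof -
    have "((\<lambda>t. pn c C [] (finv At L) * pn c C [] (F t - L)) \<longlongrightarrow> pn c C [] (finv At L) * 0) \<F>"
      by (intro tendsto_intros conv_pn[OF F I(2)[OF that]])
    then show ?thesis by (rule order_tendstoD) simp
  qed
  then have "\<forall>\<^sub>F t in \<F>. \<forall>(c, C)\<in>I. pn c C [] (finv At L) * pn c C [] (F t - L) < 1"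
    using I(1) by (intro eventually_ball_finite) auto
  with conv_eventually_endo[OF F] show ?thesis
  proof eventually_elim
    case (elim t)
    show ?case
      unfolding is_iso_def
    proof (intro ballI)
      fix c' p assume c': "c' \<in> At" "p \<in> fst c'"
      obtain c C where cC: "(c, C) \<in> I" "p \<in> fst c" "snd c p \<in> C" using I(3)[of p] by blast
      have c: "c \<in> At" "chart_compact c C" using I(2)[OF cC(1)] by (auto simp: chart_compact_def)
      have le: "norm (X c p) \<le> pn c C [] X" if "X \<in> endo At" for X
        using pn_upper[OF c(2) that cC(3), of "[]"] coord_inv_snd[OF c(1) cC(2)] by (simp add: loc_def)
      have "norm (matrix_inv (L c p)) * norm (F t c p - L c p) \<le> pn c C [] (finv At L) * pn c C [] (F t - L)"
      proof (rule mult_mono)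
        show "norm (matrix_inv (L c p)) \<le> pn c C [] (finv At L)"
          using le[OF endo_finv[OF en L]] c(1) cC(2) by simp
        show "norm (F t c p - L c p) \<le> pn c C [] (F t - L)"
          using le[OF endo_diff[OF elim(1) en]] by simp
      qed (simp_all add: pn_nonneg[OF c(2) endo_finv[OF en L]])
      also have "\<dots> < 1" using elim(2) cC(1) by auto
      finally have "invertible (F t c p)"
        by (rule invertible_near[rotated]) (use L c(1) cC(2) in \<open>simp add: is_iso_def\<close>)
      then show "invertible (F t c' p)"
        by (rule invertible_chart_indep[OF elim(1) c(1) c'(1) cC(2) c'(2)])
    qed
  qed
qed

lemma finv_diff:
  assumes "X \<in> endo At" "Y \<in> endo At" "is_iso At X" "is_iso At Y"
  shows "finv At Y - finv At X = - (finv At Y \<odot> (Y - X) \<odot> finv At X)"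
proof (rule field_eqI)
  show "finv At Y - finv At X \<in> endo At" "- (finv At Y \<odot> (Y - X) \<odot> finv At X) \<in> endo At"
    by (intro endo_minus endo_diff endo_fcomp endo_finv assms)+
qed (use assms(3,4) in \<open>simp add: matrix_inv_diff is_iso_def\<close>)

text \<open>The absorption argument of \<open>tendsto_matrix_inv\<close>, with a submultiplicative
  seminorm in place of the matrix norm.\<close>

lemma conv_finv:
  assumes F: "conv F L \<F>" and L: "is_iso At L"
  shows "conv (\<lambda>t. finv At (F t)) (finv At L) \<F>"
proof (rule conv_null_comparison)
  note ev = conv_eventually_endo[OF F] eventually_is_iso[OF F L] and en = conv_endo[OF F]
  show en': "finv At L \<in> endo At" by (intro endo_finv en L)
  show "\<forall>\<^sub>F t in \<F>. finv At (F t) \<in> endo At" using ev by eventually_elim (rule endo_finv)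
  fix c C vs assume cC: "chart_compact c C"
  let ?p = "pn c C vs"
  define a where "a = ?p (finv At L)"
  have a0: "a \<ge> 0" unfolding a_def by (rule pn_nonneg[OF cC en'])
  have "((\<lambda>t. a * ?p (F t - L)) \<longlongrightarrow> a * 0) \<F>" by (intro tendsto_intros conv_pn[OF F cC])
  then have "\<forall>\<^sub>F t in \<F>. a * ?p (F t - L) < 1/2" by (rule order_tendstoD) simp
  with ev have "\<forall>\<^sub>F t in \<F>. ?p (finv At (F t) - finv At L) \<le> (2 * a) * ?p (F t - L) * a"
  proof eventually_elim
    case (elim t)
    note d = endo_diff[OF elim(1) en] and i = endo_finv[OF elim(1,2)]
    define b where "b = ?p (finv At (F t))"
    have b0: "b \<ge> 0" unfolding b_def by (rule pn_nonneg[OF cC i])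
    have "?p (finv At (F t) - finv At L) \<le> ?p (finv At (F t) \<odot> (F t - L) \<odot> finv At L)"
      unfolding finv_diff[OF en elim(1) L elim(2)] by (intro pn_minus_le cC endo_fcomp i d en')
    also have "\<dots> \<le> ?p (finv At (F t) \<odot> (F t - L)) * a"
      unfolding a_def by (intro pn_fcomp_le cC endo_fcomp i d en')
    also have "\<dots> \<le> b * ?p (F t - L) * a"
      unfolding b_def by (intro mult_right_mono pn_fcomp_le cC i d a0)
    finally have le: "?p (finv At (F t) - finv At L) \<le> b * ?p (F t - L) * a" .
    have "b \<le> ?p (finv At (F t) - finv At L) + a"
      unfolding a_def b_def by (rule pn_triangle[OF cC i en'])
    also have "\<dots> \<le> b * (1/2) + a"
      using le mult_left_mono[OF less_imp_le[OF elim(3)] b0] by (simp add: mult_ac)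
    finally have "b \<le> 2 * a" by simp
    then have "b * ?p (F t - L) * a \<le> (2 * a) * ?p (F t - L) * a"
      by (intro mult_right_mono a0 pn_nonneg[OF cC d])
    with le show ?case by simp
  qed
  moreover have "((\<lambda>t. (2 * a) * ?p (F t - L) * a) \<longlongrightarrow> (2 * a) * 0 * a) \<F>"
    by (intro tendsto_intros conv_pn[OF F cC])
  ultimately show "\<exists>b. (\<forall>\<^sub>F t in \<F>. ?p (finv At (F t) - finv At L) \<le> b t) \<and> (b \<longlongrightarrow> 0) \<F>"
    by (intro exI[of _ "\<lambda>t. (2 * a) * ?p (F t - L) * a"]) simp
qed

lemma Cinf_tendsto_pointwise:
  assumes "Cinf_tendsto At F L \<F>" "c \<in> At" "p \<in> fst c"
  shows "((\<lambda>t. F t c p) \<longlongrightarrow> L c p) \<F>"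
proof -
  have "compact {snd c p} \<and> {snd c p} \<subseteq> cdom c" using assms by auto
  then have "uniform_limit {snd c p} (\<lambda>t. iter_D [] (\<lambda>x. F t c (coord_inv c x)))
      (iter_D [] (\<lambda>x. L c (coord_inv c x))) \<F>"
    using assms(1,2) unfolding Cinf_tendsto_def by blast
  then show ?thesis by (simp add: coord_inv_snd[OF assms(2,3)])
qed

section \<open>Derivatives of curves of fields\<close>

lemma has_curve_deriv_endo: "has_curve_deriv At \<gamma> L t \<Longrightarrow> L \<in> endo At"
  by (simp add: has_curve_deriv_def)

text \<open>Evaluation at a point of a chart turns statements on curves of fields into statements on
  curves of matrices. Uniqueness of derivatives, closedness of the tangent space and the uniqueness
  of geodesics are obtained in this way.\<close>

lemma has_curve_deriv_pointwise:
  assumes "has_curve_deriv At \<gamma> L t" "c \<in> At" "p \<in> fst c"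
  shows "((\<lambda>s. \<gamma> s c p) has_vector_derivative L c p) (at t)"
proof -
  have "Cinf_tendsto At (\<lambda>s. (1 / (s - t)) \<cdot> (\<gamma> s - \<gamma> t)) L (at t)"
    using assms(1) by (simp add: has_curve_deriv_def)
  from Cinf_tendsto_pointwise[OF this assms(2,3)]
  have "((\<lambda>s. ((1 / (s - t)) \<cdot> (\<gamma> s - \<gamma> t)) c p) \<longlongrightarrow> L c p) (at t)" .
  then have lim: "((\<lambda>s. (\<gamma> s c p - \<gamma> t c p) /\<^sub>R (s - t)) \<longlongrightarrow> L c p) (at t)"
    by (simp add: inverse_eq_divide)
  then have "((\<lambda>s. norm ((\<gamma> s c p - \<gamma> t c p) /\<^sub>R (s - t) - L c p)) \<longlongrightarrow> 0) (at t)"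
    by (simp add: LIM_zero tendsto_norm_zero)
  moreover have "\<forall>\<^sub>F s in at t. norm ((\<gamma> s c p - \<gamma> t c p) /\<^sub>R (s - t) - L c p)
      = norm (\<gamma> s c p - \<gamma> t c p - (s - t) *\<^sub>R L c p) / norm (s - t)"
    unfolding eventually_at_filter
  proof (intro always_eventually allI impI)
    fix s assume "s \<noteq> t"
    then have "(\<gamma> s c p - \<gamma> t c p) /\<^sub>R (s - t) - L c p = (\<gamma> s c p - \<gamma> t c p - (s - t) *\<^sub>R L c p) /\<^sub>R (s - t)"
      by (simp add: scaleR_diff_right)
    then show "norm ((\<gamma> s c p - \<gamma> t c p) /\<^sub>R (s - t) - L c p)
      = norm (\<gamma> s c p - \<gamma> t c p - (s - t) *\<^sub>R L c p) / norm (s - t)"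
      by (simp add: divide_inverse_commute)
  qed
  ultimately have "((\<lambda>s. norm (\<gamma> s c p - \<gamma> t c p - (s - t) *\<^sub>R L c p) / norm (s - t)) \<longlongrightarrow> 0) (at t)"
    by (rule Lim_transform_eventually)
  then show ?thesis
    unfolding has_vector_derivative_def has_derivative_iff_norm by (simp add: bounded_linear_scaleR_left)
qed

lemma has_curve_deriv_unique:
  assumes "has_curve_deriv At \<gamma> L t" "has_curve_deriv At \<gamma> L' t"
  shows "L = L'"
  by (rule field_eqI[OF has_curve_deriv_endo[OF assms(1)] has_curve_deriv_endo[OF assms(2)]])
    (rule vector_derivative_unique_at[OF has_curve_deriv_pointwise[OF assms(1)] has_curve_deriv_pointwise[OF assms(2)]])

lemma curve_deriv_eq: "has_curve_deriv At \<gamma> L t \<Longrightarrow> curve_deriv At \<gamma> t = L"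
  unfolding curve_deriv_def using has_curve_deriv_unique by blast

text \<open>\<open>has_curve_deriv\<close> requires smoothness only of the derivative. The
  additional clause, with \<open>nhds\<close> in order to include the point \<open>t\<close>, makes
  the curve one of smooth fields, as the rules for sums, products and inverses require.\<close>

definition fderiv :: "(real \<Rightarrow> ('m, 'd) field) \<Rightarrow> ('m, 'd) field \<Rightarrow> real \<Rightarrow> bool" where
  "fderiv \<gamma> L t \<longleftrightarrow> (\<forall>\<^sub>F s in nhds t. \<gamma> s \<in> endo At) \<and> has_curve_deriv At \<gamma> L t"

lemma fderivD:
  assumes "fderiv \<gamma> L t"
  shows "\<forall>\<^sub>F s in nhds t. \<gamma> s \<in> endo At" "\<gamma> t \<in> endo At" "L \<in> endo At" "has_curve_deriv At \<gamma> L t"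
    "\<forall>\<^sub>F s in at t. \<gamma> s \<in> endo At"
  using assms eventually_nhds_x_imp_x
  by (auto simp: fderiv_def has_curve_deriv_def eventually_at_filter elim: eventually_mono)

lemma fderiv_conv:
  "fderiv \<gamma> L t \<longleftrightarrow> (\<forall>\<^sub>F s in nhds t. \<gamma> s \<in> endo At) \<and> conv (\<lambda>s. (1 / (s - t)) \<cdot> (\<gamma> s - \<gamma> t)) L (at t)"
proof -
  have "\<forall>\<^sub>F s in at t. (1 / (s - t)) \<cdot> (\<gamma> s - \<gamma> t) \<in> endo At" if ev: "\<forall>\<^sub>F s in nhds t. \<gamma> s \<in> endo At"
  proof -
    have "\<gamma> t \<in> endo At" using ev by (rule eventually_nhds_x_imp_x)
    moreover have "\<forall>\<^sub>F s in at t. \<gamma> s \<in> endo At" using ev by (auto simp: eventually_at_filter elim: eventually_mono)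
    ultimately show ?thesis by (auto intro: endo_fscale endo_diff elim!: eventually_mono)
  qed
  then show ?thesis by (auto simp: fderiv_def conv_def has_curve_deriv_def)
qed

lemma fderiv_continuous:
  assumes "fderiv \<gamma> L t"
  shows "conv \<gamma> (\<gamma> t) (at t)"
proof -
  have "((\<lambda>s. s - t) \<longlongrightarrow> t - t) (at t)" by (intro tendsto_intros)
  with assms have "conv (\<lambda>s. (s - t) \<cdot> ((1 / (s - t)) \<cdot> (\<gamma> s - \<gamma> t))) ((t - t) \<cdot> L) (at t)"
    unfolding fderiv_conv by (intro conv_fscale) auto
  from conv_add[OF this conv_const[OF fderivD(2)[OF assms]]]
  have "conv (\<lambda>s. (s - t) \<cdot> ((1 / (s - t)) \<cdot> (\<gamma> s - \<gamma> t)) + \<gamma> t) (\<gamma> t) (at t)" by simp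
  then show ?thesis
    by (rule conv_cong[rotated]) (simp add: eventually_at_filter)
qed

lemma fderiv_eventually_is_iso:
  assumes "fderiv \<gamma> L t" "is_iso At (\<gamma> t)"
  shows "\<forall>\<^sub>F s in nhds t. is_iso At (\<gamma> s)"
  using eventually_is_iso[OF fderiv_continuous[OF assms(1)] assms(2)] assms(2)
  by (auto simp: eventually_at_filter elim: eventually_mono)

lemma fderiv_cong:
  assumes "\<forall>\<^sub>F s in nhds t. \<gamma> s = \<eta> s" "fderiv \<gamma> L t"
  shows "fderiv \<eta> L t"
  unfolding fderiv_conv
proof
  show "\<forall>\<^sub>F s in nhds t. \<eta> s \<in> endo At" using assms(1) fderivD(1)[OF assms(2)] by eventually_elim simp
  have "\<gamma> t = \<eta> t" using assms(1) by (rule eventually_nhds_x_imp_x)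
  then have "\<forall>\<^sub>F s in at t. (1 / (s - t)) \<cdot> (\<gamma> s - \<gamma> t) = (1 / (s - t)) \<cdot> (\<eta> s - \<eta> t)"
    using assms(1) by (auto simp: eventually_at_filter elim: eventually_mono)
  then show "conv (\<lambda>s. (1 / (s - t)) \<cdot> (\<eta> s - \<eta> t)) L (at t)"
    by (rule conv_cong) (use assms(2) in \<open>simp add: fderiv_conv\<close>)
qed

lemma fderiv_const: "A \<in> endo At \<Longrightarrow> fderiv (\<lambda>_. A) 0 t"
  using conv_const[OF endo_0] by (simp add: fderiv_conv)

lemma fderiv_line: assumes "K \<in> endo At" "A \<in> endo At" shows "fderiv (\<lambda>t. K + t \<cdot> A) A t"
  unfolding fderiv_conv
proof
  show "\<forall>\<^sub>F s in nhds t. K + s \<cdot> A \<in> endo At" using assms by (auto intro: always_eventually endo_intros)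
  have "\<forall>\<^sub>F s in at t. A = (1 / (s - t)) \<cdot> (K + s \<cdot> A - (K + t \<cdot> A))"
    by (auto simp: eventually_at_filter fun_eq_iff algebra_simps simp flip: scaleR_diff_left)
  from conv_cong[OF this conv_const[OF assms(2)]]
  show "conv (\<lambda>s. (1 / (s - t)) \<cdot> (K + s \<cdot> A - (K + t \<cdot> A))) A (at t)" .
qed

lemma fderiv_add:
  assumes "fderiv \<gamma> L t" "fderiv \<eta> M t"
  shows "fderiv (\<lambda>s. \<gamma> s + \<eta> s) (L + M) t"
  unfolding fderiv_conv
proof
  show "\<forall>\<^sub>F s in nhds t. \<gamma> s + \<eta> s \<in> endo At"
    using fderivD(1)[OF assms(1)] fderivD(1)[OF assms(2)] by eventually_elim (rule endo_add)
  have "conv (\<lambda>s. (1 / (s - t)) \<cdot> (\<gamma> s - \<gamma> t) + (1 / (s - t)) \<cdot> (\<eta> s - \<eta> t)) (L + M) (at t)"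
    using assms by (intro conv_add) (auto simp: fderiv_conv)
  then show "conv (\<lambda>s. (1 / (s - t)) \<cdot> (\<gamma> s + \<eta> s - (\<gamma> t + \<eta> t))) (L + M) (at t)"
    by (rule conv_cong[rotated]) (simp add: fun_eq_iff algebra_simps)
qed

lemma fderiv_fcomp:
  assumes "fderiv \<gamma> L t" "fderiv \<eta> M t"
  shows "fderiv (\<lambda>s. \<gamma> s \<odot> \<eta> s) (L \<odot> \<eta> t + \<gamma> t \<odot> M) t"
  unfolding fderiv_conv
proof
  show "\<forall>\<^sub>F s in nhds t. \<gamma> s \<odot> \<eta> s \<in> endo At"
    using fderivD(1)[OF assms(1)] fderivD(1)[OF assms(2)] by eventually_elim (rule endo_fcomp)
  have "conv (\<lambda>s. (1 / (s - t)) \<cdot> (\<gamma> s - \<gamma> t) \<odot> \<eta> s + \<gamma> t \<odot> (1 / (s - t)) \<cdot> (\<eta> s - \<eta> t)) (L \<odot> \<eta> t + \<gamma> t \<odot> M) (at t)"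
    using assms by (intro conv_add conv_fcomp fderiv_continuous[OF assms(2)] conv_const fderivD(2)[OF assms(1)])
      (auto simp: fderiv_conv)
  then show "conv (\<lambda>s. (1 / (s - t)) \<cdot> (\<gamma> s \<odot> \<eta> s - \<gamma> t \<odot> \<eta> t)) (L \<odot> \<eta> t + \<gamma> t \<odot> M) (at t)"
    by (rule conv_cong[rotated]) (simp add: fun_eq_iff mm_simps algebra_simps)
qed

lemma fderiv_fscale:
  assumes "fderiv \<gamma> L t"
  shows "fderiv (\<lambda>s. r \<cdot> \<gamma> s) (r \<cdot> L) t"
  unfolding fderiv_conv
proof
  show "\<forall>\<^sub>F s in nhds t. r \<cdot> \<gamma> s \<in> endo At"
    using fderivD(1)[OF assms] by eventually_elim (rule endo_fscale)
  have "conv (\<lambda>s. r \<cdot> (1 / (s - t)) \<cdot> (\<gamma> s - \<gamma> t)) (r \<cdot> L) (at t)"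
    using assms by (intro conv_fscale tendsto_const) (auto simp: fderiv_conv)
  then show "conv (\<lambda>s. (1 / (s - t)) \<cdot> (r \<cdot> \<gamma> s - r \<cdot> \<gamma> t)) (r \<cdot> L) (at t)"
    by (rule conv_cong[rotated]) (simp add: fun_eq_iff algebra_simps)
qed

lemma fderiv_minus: "fderiv \<gamma> L t \<Longrightarrow> fderiv (\<lambda>s. - \<gamma> s) (- L) t"
  using fderiv_fscale[of \<gamma> L t "- 1"] by (simp add: fscale_def fun_Compl_def)

lemma fderiv_diff: "fderiv \<gamma> L t \<Longrightarrow> fderiv \<eta> M t \<Longrightarrow> fderiv (\<lambda>s. \<gamma> s - \<eta> s) (L - M) t"
  using fderiv_add[OF _ fderiv_minus, of \<gamma> L t \<eta> M] by simp

lemma fderiv_finv: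
  assumes \<gamma>: "fderiv \<gamma> L t" and iso: "is_iso At (\<gamma> t)"
  shows "fderiv (\<lambda>s. finv At (\<gamma> s)) (- (finv At (\<gamma> t) \<odot> L \<odot> finv At (\<gamma> t))) t"
  unfolding fderiv_conv
proof
  note ev = fderivD(1)[OF \<gamma>] fderiv_eventually_is_iso[OF \<gamma> iso]
  show "\<forall>\<^sub>F s in nhds t. finv At (\<gamma> s) \<in> endo At"
    using ev by eventually_elim (rule endo_finv)
  have "conv (\<lambda>s. - (finv At (\<gamma> s) \<odot> ((1 / (s - t)) \<cdot> (\<gamma> s - \<gamma> t)) \<odot> finv At (\<gamma> t))) (- (finv At (\<gamma> t) \<odot> L \<odot> finv At (\<gamma> t))) (at t)"
    using \<gamma> by (intro conv_minus conv_fcomp conv_finv fderiv_continuous conv_const endo_finv fderivD(2)[OF \<gamma>] iso)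
      (auto simp: fderiv_conv)
  moreover have "\<forall>\<^sub>F s in at t. - (finv At (\<gamma> s) \<odot> ((1 / (s - t)) \<cdot> (\<gamma> s - \<gamma> t)) \<odot> finv At (\<gamma> t))
     = (1 / (s - t)) \<cdot> (finv At (\<gamma> s) - finv At (\<gamma> t))"
  proof -
    have "\<forall>\<^sub>F s in nhds t. - (finv At (\<gamma> s) \<odot> ((1 / (s - t)) \<cdot> (\<gamma> s - \<gamma> t)) \<odot> finv At (\<gamma> t))
     = (1 / (s - t)) \<cdot> (finv At (\<gamma> s) - finv At (\<gamma> t))"
      using ev
    proof eventually_elim
      case (elim s)
      show ?case unfolding finv_diff[OF fderivD(2)[OF \<gamma>] elim(1) iso elim(2)]
        by (simp add: fun_eq_iff mm_simps algebra_simps)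
    qed
    then show ?thesis by (auto simp: eventually_at_filter elim: eventually_mono)
  qed
  ultimately show "conv (\<lambda>s. (1 / (s - t)) \<cdot> (finv At (\<gamma> s) - finv At (\<gamma> t))) (- (finv At (\<gamma> t) \<odot> L \<odot> finv At (\<gamma> t))) (at t)"
    by (rule conv_cong[rotated])
qed

lemma fderiv_fexp:
  assumes A: "A \<in> endo At"
  shows "fderiv (\<lambda>s. fexp At (s \<cdot> A)) (fexp At (t \<cdot> A) \<odot> A) t"
  unfolding fderiv_conv
proof
  show "\<forall>\<^sub>F s in nhds t. fexp At (s \<cdot> A) \<in> endo At"
    by (intro always_eventually allI endo_fexp endo_fscale A)
  \<comment> \<open>The error of the difference quotient of the exponential at 0. By the group law,
    the error at \<open>t\<close> is \<open>Z (s - t)\<close> multiplied by the fixed field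
    \<open>fexp At (t \<cdot> A)\<close>.\<close>
  define Z where "Z h = (1 / h) \<cdot> (fexp At (h \<cdot> A) - fid At) - A" for h
  have Z: "Z h \<in> endo At" for h unfolding Z_def by (intro endo_intros A)
  have E: "fexp At (t \<cdot> A) \<in> endo At" by (intro endo_intros A)
  have split: "(1 / (s - t)) \<cdot> (fexp At (s \<cdot> A) - fexp At (t \<cdot> A)) - fexp At (t \<cdot> A) \<odot> A = fexp At (t \<cdot> A) \<odot> Z (s - t)" for s
  proof (rule field_eqI)
    fix c p assume "c \<in> At" "p \<in> fst c"
    moreover have "mexp (s *\<^sub>R A c p) = mexp (t *\<^sub>R A c p) ** mexp ((s - t) *\<^sub>R A c p)"
      using mexp_add[of t "s - t" "A c p"] by simp
    ultimately show "((1 / (s - t)) \<cdot> (fexp At (s \<cdot> A) - fexp At (t \<cdot> A)) - fexp At (t \<cdot> A) \<odot> A) c p = (fexp At (t \<cdot> A) \<odot> Z (s - t)) c p"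
      by (simp add: Z_def mm_simps)
  qed (intro endo_intros A Z)+
  show "conv (\<lambda>s. (1 / (s - t)) \<cdot> (fexp At (s \<cdot> A) - fexp At (t \<cdot> A))) (fexp At (t \<cdot> A) \<odot> A) (at t)"
  proof (rule conv_null_comparison)
    show "\<forall>\<^sub>F s in at t. (1 / (s - t)) \<cdot> (fexp At (s \<cdot> A) - fexp At (t \<cdot> A)) \<in> endo At"
      by (intro always_eventually allI endo_intros A)
    show "fexp At (t \<cdot> A) \<odot> A \<in> endo At" by (intro endo_intros A)
    fix c C vs assume cC: "chart_compact c C"
    let ?p = "pn c C vs"
    let ?b = "\<lambda>s. ?p (fexp At (t \<cdot> A)) * (\<bar>s - t\<bar> * (exp (?p A) * ?p (fid At)))"
    have bd: "?p (Z h) \<le> \<bar>h\<bar> * (exp (?p A) * ?p (fid At))" if h: "h \<noteq> 0" "\<bar>h\<bar> \<le> 1" for h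
    proof (rule pn_least)
      fix x assume x: "x \<in> C"
      have dom: "open (cdom c)" "x \<in> cdom c" using cC x open_dom by (auto simp: chart_compact_def)
      have c: "c \<in> At" using cC by (simp add: chart_compact_def)
      have "jnorm vs (loc (Z h) c) x = jnorm vs (\<lambda>x. (1 / h) *\<^sub>R (mexp (h *\<^sub>R loc A c x) - mat 1) - loc A c x) x"
        by (rule jnorm_cong[OF dom]) (use c coord_inv_dom(1) in \<open>simp add: Z_def loc_def\<close>)
      also have "\<dots> \<le> \<bar>h\<bar> * (exp (jnorm vs (loc A c) x) * jnorm vs (\<lambda>_. mat 1 :: real^'d^'d) x)"
        by (rule jnorm_mexp_quotient_le[OF smooth_on_loc[OF cC A] dom(2) h])
      also have "jnorm vs (\<lambda>_. mat 1 :: real^'d^'d) x = jnorm vs (loc (fid At) c) x"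
        by (rule jnorm_cong[OF dom]) (use c coord_inv_dom(1) in \<open>simp add: loc_def\<close>)
      also have "\<bar>h\<bar> * (exp (jnorm vs (loc A c) x) * jnorm vs (loc (fid At) c) x) \<le> \<bar>h\<bar> * (exp (?p A) * ?p (fid At))"
        by (intro mult_left_mono mult_mono) (auto intro: pn_upper[OF cC A x] pn_upper[OF cC endo_fid x] jnorm_nonneg)
      finally show "jnorm vs (loc (Z h) c) x \<le> \<bar>h\<bar> * (exp (?p A) * ?p (fid At))" .
    qed (auto intro!: mult_nonneg_nonneg pn_nonneg[OF cC endo_fid])
    have "\<forall>\<^sub>F s in at t. s \<noteq> t \<and> \<bar>s - t\<bar> \<le> 1"
      by (auto simp: eventually_at dist_norm intro!: exI[of _ 1])
    then have "\<forall>\<^sub>F s in at t. ?p ((1 / (s - t)) \<cdot> (fexp At (s \<cdot> A) - fexp At (t \<cdot> A)) - fexp At (t \<cdot> A) \<odot> A) \<le> ?b s"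
    proof eventually_elim
      case (elim s)
      have "?p (fexp At (t \<cdot> A) \<odot> Z (s - t)) \<le> ?p (fexp At (t \<cdot> A)) * ?p (Z (s - t))"
        by (rule pn_fcomp_le[OF cC E Z])
      also have "\<dots> \<le> ?b s" using elim by (intro mult_left_mono bd pn_nonneg[OF cC E]) auto
      finally show ?case by (simp only: split)
    qed
    moreover have "(?b \<longlongrightarrow> ?p (fexp At (t \<cdot> A)) * (\<bar>t - t\<bar> * (exp (?p A) * ?p (fid At)))) (at t)"
      by (intro tendsto_intros)
    ultimately show "\<exists>b. (\<forall>\<^sub>F s in at t. ?p ((1 / (s - t)) \<cdot> (fexp At (s \<cdot> A) - fexp At (t \<cdot> A)) - fexp At (t \<cdot> A) \<odot> A) \<le> b s) \<and> (b \<longlongrightarrow> 0) (at t)"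
      by (intro exI[of _ ?b]) simp
  qed
qed

end

section \<open>Matrix identities\<close>

text \<open>Simplification collects \<open>X + X\<close> as \<open>2 * X\<close>, a componentwise
  product; this rule turns it into a scalar multiple, which passes through matrix products.\<close>

lemma numeral_mult_eq_scaleR: "numeral n * X = (numeral n :: real) *\<^sub>R X" for X :: "real^'d^'d::finite"
  by (simp add: vec_eq_iff)

lemma matrix_inv_commute:
  fixes A :: "real^'d^'d::finite"
  assumes "invertible A" "A ** B = C ** A"
  shows "matrix_inv A ** C = B ** matrix_inv A"
proof -
  have "matrix_inv A ** (A ** B) ** matrix_inv A = matrix_inv A ** (C ** A) ** matrix_inv A"
    using assms(2) by simp
  then show ?thesis
    using assms(1) by (simp add: mm_assoc matrix_inv_mul_assoc matrix_inv_mul)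
qed

abbreviation (input) rm :: "real^'d^'d \<Rightarrow> real^'d^'d::finite" where "rm k \<equiv> matrix_inv (mat 1 - k)"
abbreviation (input) sm :: "real^'d^'d \<Rightarrow> real^'d^'d::finite" where "sm k \<equiv> matrix_inv (mat 1 + k)"
abbreviation (input) qm :: "real^'d^'d \<Rightarrow> real^'d^'d::finite" where "qm k \<equiv> matrix_inv (mat 1 - k ** k)"

context
  fixes J k :: "real^'d^'d::finite"
  assumes JJ: "J ** J = - mat 1" and anti: "J ** k = - (k ** J)" and inv: "invertible (mat 1 - k)"
begin

lemma JJ_assoc: "J ** (J ** X) = - X" for X :: "real^'d^'d"
  by (simp add: matrix_mul_assoc JJ mm.minus_left)

lemma anti_assoc: "J ** (k ** X) = - (k ** (J ** X))" for X :: "real^'d^'d"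
  by (simp add: matrix_mul_assoc anti mm.minus_left)

lemma invertible_J: "invertible J"
  by (rule invertibleI(1)[of _ "- J"]) (simp add: mm.minus_right JJ)

text \<open>Conjugation by \<open>J\<close>, whose inverse is \<open>- J\<close>, changes the sign
  of \<open>k\<close> and so turns \<open>mat 1 - k\<close> into \<open>mat 1 + k\<close>.\<close>

lemma invertible_one_plus_k: "invertible (mat 1 + k)"
proof -
  have "mat 1 + k = (- J) ** (mat 1 - k) ** J"
    by (simp add: mm_simps JJ anti anti_assoc)
  moreover have "invertible (- J)"
    by (rule invertibleI(1)[of _ J]) (simp add: mm.minus_left JJ)
  ultimately show ?thesis by (simp only:) (intro invertible_mult inv invertible_J)
qed

lemma factor_k: "mat 1 - k ** k = (mat 1 - k) ** (mat 1 + k)" "mat 1 - k ** k = (mat 1 + k) ** (mat 1 - k)"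
  by (simp_all add: mm_simps)

lemma invertible_one_minus_square: "invertible (mat 1 - k ** k)"
  unfolding factor_k by (intro invertible_mult inv invertible_one_plus_k)

lemma q_factor: "qm k = sm k ** rm k" "qm k = rm k ** sm k"
proof -
  note inv' = inv invertible_one_plus_k
  have "(mat 1 - k ** k) ** (sm k ** rm k) = mat 1"
    unfolding factor_k(1) using inv' by (simp only: mm_assoc matrix_inv_mul_assoc matrix_inv_mul)
  then show "qm k = sm k ** rm k" by (rule invertibleI)
  have "(mat 1 - k ** k) ** (rm k ** sm k) = mat 1"
    unfolding factor_k(2) using inv' by (simp only: mm_assoc matrix_inv_mul_assoc matrix_inv_mul)
  then show "qm k = rm k ** sm k" by (rule invertibleI)
qed

lemma q_k: "qm k ** k = k ** qm k"
  by (rule matrix_inv_commute[OF invertible_one_minus_square]) (simp add: mm_simps)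

lemma r_J: "rm k ** J = J ** sm k"
proof -
  have "(mat 1 - k) ** J = J ** (mat 1 + k)" by (simp add: mm_simps anti)
  then have "rm k ** ((mat 1 - k) ** J) ** sm k = rm k ** (J ** (mat 1 + k)) ** sm k" by simp
  then show ?thesis
    using inv invertible_one_plus_k by (simp add: mm_assoc matrix_inv_mul_assoc matrix_inv_mul)
qed

lemma r_J_assoc: "rm k ** (J ** X) = J ** (sm k ** X)" for X :: "real^'d^'d"
  by (simp add: matrix_mul_assoc r_J)

lemma q_J: "qm k ** J = J ** qm k"
  by (rule matrix_inv_commute[OF invertible_one_minus_square]) (simp add: mm_simps anti anti_assoc)

text \<open>The factors on the left are values of the differential of the inverse chart. Moving the
  second \<open>J\<close> to the left exchanges \<open>rm k\<close> and \<open>sm k\<close> and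
  changes sign at \<open>a\<close>; then it cancels against the first \<open>J\<close>. A cyclic
  shift of the last \<open>rm k\<close> completes both copies of
  \<open>qm k = sm k ** rm k = rm k ** sm k\<close>, and \<open>4 = 2 * 2\<close>.\<close>

lemma star_product:
  fixes a b :: "real^'d^'d"
  assumes a: "J ** a = - (a ** J)"
  shows "trace ((2 *\<^sub>R (J ** rm k ** a ** rm k)) ** (2 *\<^sub>R (J ** rm k ** b ** rm k))) = 4 * trace (qm k ** a ** qm k ** b)"
proof -
  have aJ: "a ** (J ** X) = - (J ** (a ** X))"
    for X :: "real^'d^'d" by (simp add: matrix_mul_assoc a mm.minus_left)
  have "(2 *\<^sub>R (J ** rm k ** a ** rm k)) ** (2 *\<^sub>R (J ** rm k ** b ** rm k)) = 4 *\<^sub>R (J ** (rm k ** (a ** (rm k ** (J ** (rm k ** (b ** rm k)))))))"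
    by (simp add: mm_simps)
  also have "\<dots> = 4 *\<^sub>R ((sm k ** a ** (sm k ** rm k) ** b) ** rm k)"
    by (simp add: r_J_assoc aJ JJ_assoc mm_simps)
  finally have "trace ((2 *\<^sub>R (J ** rm k ** a ** rm k)) ** (2 *\<^sub>R (J ** rm k ** b ** rm k))) = 4 * trace ((sm k ** a ** (sm k ** rm k) ** b) ** rm k)"
    by (simp add: trace_def sum_distrib_left)
  also have "trace ((sm k ** a ** (sm k ** rm k) ** b) ** rm k) = trace ((rm k ** sm k) ** a ** (sm k ** rm k) ** b)"
    by (subst trace_mul_sym) (simp add: mm_assoc)
  finally show ?thesis by (simp only: q_factor[symmetric])
qed

text \<open>The left side is the derivative of \<open>k ** qm k\<close> in direction
  \<open>a\<close>. The identity \<open>qm k - k ** qm k ** k = mat 1\<close> removes the term in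
  which \<open>a\<close> stands next to only one inverse.\<close>

lemma derivative_k_q:
  fixes a :: "real^'d^'d"
  shows "a ** qm k + k ** qm k ** (a ** k + k ** a) ** qm k = qm k ** a ** qm k + k ** qm k ** a ** k ** qm k"
proof -
  have "qm k - k ** qm k ** k = (mat 1 - k ** k) ** qm k" by (simp add: mm_simps q_k)
  then have "qm k - k ** qm k ** k = mat 1" by (simp add: matrix_inv_mul[OF invertible_one_minus_square])
  then have "(qm k - k ** qm k ** k) ** a ** qm k = a ** qm k" by simp
  then show ?thesis by (simp add: mm_simps algebra_simps)
qed

text \<open>\<open>D a b\<close> is \<open>b\<close> times the derivative of
  \<open>k ** qm k\<close> in direction \<open>a\<close>, so \<open>D a b ** c + D a c ** b\<close>
  differentiates the Christoffel map. On the right every product starts with \<open>qm k\<close>,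
  which \<open>mat 1 - k ** k\<close> cancels; four products of \<open>a\<close>, \<open>b\<close>,
  \<open>c\<close> separated by \<open>qm k\<close> remain on either side.\<close>

lemma curvature_identity:
  fixes a b c :: "real^'d^'d"
  defines "G \<equiv> \<lambda>a b. a ** k ** qm k ** b + b ** k ** qm k ** a"
    and "D \<equiv> \<lambda>a b. b ** (a ** qm k + k ** qm k ** (a ** k + k ** a) ** qm k)"
  shows "(D a b ** c + D a c ** b + G a (G b c)) - (D b a ** c + D b c ** a + G b (G a c)) =
     - ((mat 1 - k ** k) ** ((qm k ** a ** (qm k ** b) - qm k ** b ** (qm k ** a)) ** (qm k ** c) - qm k ** c ** (qm k ** a ** (qm k ** b) - qm k ** b ** (qm k ** a))))"
proof -
  have "(qm k ** a ** (qm k ** b) - qm k ** b ** (qm k ** a)) ** (qm k ** c) - qm k ** c ** (qm k ** a ** (qm k ** b) - qm k ** b ** (qm k ** a))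
     = qm k ** (a ** qm k ** b ** qm k ** c - b ** qm k ** a ** qm k ** c - c ** qm k ** a ** qm k ** b + c ** qm k ** b ** qm k ** a)"
    by (simp add: mm_simps)
  then have "(mat 1 - k ** k) ** ((qm k ** a ** (qm k ** b) - qm k ** b ** (qm k ** a)) ** (qm k ** c) - qm k ** c ** (qm k ** a ** (qm k ** b) - qm k ** b ** (qm k ** a)))
     = a ** qm k ** b ** qm k ** c - b ** qm k ** a ** qm k ** c - c ** qm k ** a ** qm k ** b + c ** qm k ** b ** qm k ** a"
    by (simp only: matrix_inv_mul_assoc[OF invertible_one_minus_square])
  then show ?thesis
    unfolding D_def G_def derivative_k_q by (simp add: mm_simps)
qed

text \<open>\<open>q'\<close> is the derivative of \<open>qm k\<close> in direction
  \<open>x\<close>, so the left side is the Leibniz rule for the metric. The matrices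
  \<open>y'\<close> and \<open>z'\<close> are the derivatives of vector fields, which need not be
  constant.\<close>

lemma compatibility_identity:
  fixes x y z y' z' :: "real^'d^'d"
  defines "G \<equiv> \<lambda>a b. a ** k ** qm k ** b + b ** k ** qm k ** a" and "q' \<equiv> qm k ** (x ** k + k ** x) ** qm k"
  shows "trace (q' ** y ** qm k ** z + qm k ** y' ** qm k ** z + qm k ** y ** q' ** z + qm k ** y ** qm k ** z') =
    trace (qm k ** (y' + G x y) ** qm k ** z) + trace (qm k ** y ** qm k ** (z' + G x z))"
proof -
  have kq: "k ** qm k = qm k ** k" "k ** (qm k ** X) = qm k ** (k ** X)" for X :: "real^'d^'d"
    by (simp_all add: q_k matrix_mul_assoc)
  \<comment> \<open>All other terms agree, up to commuting \<open>k\<close> with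
    \<open>qm k\<close>; only this one needs a cyclic shift under the trace.\<close>
  have cyc: "trace (qm k ** (k ** (x ** (qm k ** (y ** (qm k ** z)))))) = trace (qm k ** (y ** (qm k ** (z ** (qm k ** (k ** x))))))"
    using trace_mul_sym[of "qm k ** k ** x" "qm k ** y ** qm k ** z"] by (simp add: mm_assoc)
  show ?thesis
    unfolding G_def q'_def by (simp add: mm_simps trace_add kq cyc)
qed

end

section \<open>The geodesic equation for matrices\<close>

lemma has_vector_derivative_matrix_inv:
  fixes f :: "real \<Rightarrow> real^'d^'d::finite"
  assumes "(f has_vector_derivative f') (at t)" "\<forall>\<^sub>F y in nhds t. invertible (f y)"
  shows "((\<lambda>y. matrix_inv (f y)) has_vector_derivative - (matrix_inv (f t) ** f' ** matrix_inv (f t))) (at t)"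
  using has_derivative_matrix_inv[OF assms(1)[unfolded has_vector_derivative_def] assms(2)]
  by (simp add: has_vector_derivative_def mm_simps)

text \<open>The Maurer-Cartan derivative of \<open>(1 + K)(1 - K)\<^sup>-\<^sup>1\<close> is constant along solutions of the geodesic
  equation, so this curve is a one-parameter group.\<close>

lemma geodesic_matrix_solution:
  fixes k w :: "real \<Rightarrow> real^'d^'d::finite"
  assumes I: "convex I" "open I" "0 \<in> I" "t \<in> I"
    and k: "\<And>s. s \<in> I \<Longrightarrow> (k has_vector_derivative w s) (at s)"
    and w: "\<And>s. s \<in> I \<Longrightarrow> (w has_vector_derivative - (2 *\<^sub>R (w s ** k s ** matrix_inv (mat 1 - k s ** k s) ** w s))) (at s)"
    and inv: "\<And>s. s \<in> I \<Longrightarrow> invertible (mat 1 - k s)" "\<And>s. s \<in> I \<Longrightarrow> invertible (mat 1 + k s)"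
    and k0: "k 0 = 0"
  defines "a \<equiv> t *\<^sub>R w 0"
  shows "invertible (mexp a + mexp (- a))" "k t = matrix_inv (mexp a + mexp (- a)) ** (mexp a - mexp (- a))"
proof -
  let ?r = "\<lambda>s. matrix_inv (mat 1 - k s)" and ?s = "\<lambda>s. matrix_inv (mat 1 + k s)"
  have q: "matrix_inv (mat 1 - k s ** k s) = ?s s ** ?r s" if "s \<in> I" for s
  proof (rule invertibleI)
    have "mat 1 - k s ** k s = (mat 1 - k s) ** (mat 1 + k s)" by (simp add: mm_simps)
    then show "(mat 1 - k s ** k s) ** (?s s ** ?r s) = mat 1"
      by (simp only: mm_assoc matrix_inv_mul_assoc[OF inv(2)[OF that]] matrix_inv_mul[OF inv(1)[OF that]])
  qed
  have ev: "\<forall>\<^sub>F y in nhds s. y \<in> I" if "s \<in> I" for s using eventually_nhds_in_open[OF I(2) that] .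
  have r': "(?r has_vector_derivative ?r s ** w s ** ?r s) (at s)" if s: "s \<in> I" for s
  proof -
    have "((\<lambda>s. mat 1 - k s) has_vector_derivative (0 - w s)) (at s)"
      by (intro has_vector_derivative_diff has_vector_derivative_const k s)
    from has_vector_derivative_matrix_inv[OF this eventually_mono[OF ev[OF s] inv(1)]] show ?thesis
      by (simp add: mm_simps)
  qed
  have s': "(?s has_vector_derivative - (?s s ** w s ** ?s s)) (at s)" if s: "s \<in> I" for s
  proof -
    have "((\<lambda>s. mat 1 + k s) has_vector_derivative (0 + w s)) (at s)"
      by (intro has_vector_derivative_add has_vector_derivative_const k s)
    from has_vector_derivative_matrix_inv[OF this eventually_mono[OF ev[OF s] inv(2)]] show ?thesis
      by (simp add: mm_simps)
  qed
  have W': "((\<lambda>s. ?s s ** w s ** ?r s) has_vector_derivative 0) (at s)" if s: "s \<in> I" for s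
  proof -
    let ?R = "?r s" and ?S = "?s s" and ?w = "w s" and ?k = "k s"
    \<comment> \<open>A partial fraction identity. Differentiating the two inverses produces
      \<open>?R - ?S\<close> between the velocities, and this is exactly what the quadratic term of
      the equation cancels.\<close>
    have RS: "?R - ?S = 2 *\<^sub>R (?k ** (?S ** ?R))"
    proof -
      have "?S ** ((2 *\<^sub>R ?k) ** ?R) = ?S ** (((mat 1 + ?k) - (mat 1 - ?k)) ** ?R)"
        by (simp add: scaleR_2)
      also have "\<dots> = (?S ** (mat 1 + ?k)) ** ?R - ?S ** ((mat 1 - ?k) ** ?R)"
        by (simp only: mm.diff_left mm.diff_right matrix_mul_assoc)
      also have "\<dots> = ?R - ?S"
        by (simp only: matrix_inv_mul[OF inv(1)[OF s]] matrix_inv_mul[OF inv(2)[OF s]] matrix_mul_lid matrix_mul_rid)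
      finally have "?S ** ((2 *\<^sub>R ?k) ** ?R) = ?R - ?S" .
      moreover have "?S ** ?k = ?k ** ?S"
        by (rule matrix_inv_commute[OF inv(2)[OF s]]) (simp add: mm_simps)
      then have "?S ** (?k ** ?R) = ?k ** (?S ** ?R)" by (simp add: matrix_mul_assoc)
      ultimately show ?thesis by (simp add: mm.scaleR_left mm.scaleR_right)
    qed
    have "((\<lambda>s. ?s s ** w s ** ?r s) has_vector_derivative
       ((?S ** ?w) ** (?R ** ?w ** ?R) + (?S ** (- (2 *\<^sub>R (?w ** ?k ** matrix_inv (mat 1 - ?k ** ?k) ** ?w))) + (- (?S ** ?w ** ?S)) ** ?w) ** ?R)) (at s)"
      by (intro mm.has_vector_derivative[OF mm.has_vector_derivative[OF s'[OF s] w[OF s]] r'[OF s]])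
    moreover have "(?S ** ?w) ** (?R ** ?w ** ?R) + (?S ** (- (2 *\<^sub>R (?w ** ?k ** matrix_inv (mat 1 - ?k ** ?k) ** ?w))) + (- (?S ** ?w ** ?S)) ** ?w) ** ?R
      = ?S ** ?w ** ((?R - ?S) - 2 *\<^sub>R (?k ** (?S ** ?R))) ** ?w ** ?R"
      unfolding q[OF s] by (simp add: mm_simps)
    ultimately show ?thesis by (simp add: RS mm.zero_left mm.zero_right)
  qed
  \<comment> \<open>The constant value of the first integral, read off at parameter 0, where
    \<open>k\<close> vanishes and both inverses are the unit matrix. The factor 2 is the one that
    arises in the derivative of \<open>S\<close>.\<close>
  define a0 where "a0 = 2 *\<^sub>R w 0"
  have W: "2 *\<^sub>R (?s s ** w s ** ?r s) = a0" if s: "s \<in> I" for s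
  proof -
    have der: "((\<lambda>s. ?s s ** w s ** ?r s) has_vector_derivative 0) (at s within I)" if "s \<in> I" for s
      by (rule has_vector_derivative_at_within[OF W'[OF that]])
    have one: "matrix_inv (mat 1) = (mat 1 :: real^'d^'d)" by (rule invertibleI(2)) simp
    have "?s s ** w s ** ?r s = ?s 0 ** w 0 ** ?r 0"
    proof (rule has_vector_derivative_zero_constant[OF I(1) der])
      fix c assume c: "\<And>s. s \<in> I \<Longrightarrow> ?s s ** w s ** ?r s = c"
      show ?thesis using c[OF s] c[OF I(3)] by simp
    qed
    then show ?thesis by (simp add: a0_def k0 one)
  qed
  define S where "S s = (mat 1 + k s) ** ?r s" for s
  have S': "(S has_vector_derivative S s ** a0) (at s)" if s: "s \<in> I" for s
  proof -
    have "((\<lambda>s. mat 1 + k s) has_vector_derivative (0 + w s)) (at s)"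
      by (intro has_vector_derivative_add has_vector_derivative_const k s)
    from mm.has_vector_derivative[OF this r'[OF s]]
    have "(S has_vector_derivative (mat 1 + k s) ** (?r s ** w s ** ?r s) + w s ** ?r s) (at s)"
      by (simp add: S_def[abs_def])
    moreover have "S s ** a0 = (mat 1 + k s) ** (?r s ** w s ** ?r s) + w s ** ?r s"
    proof -
      have "?r s ** (mat 1 + k s) = (mat 1 + k s) ** ?r s"
        by (rule matrix_inv_commute[OF inv(1)[OF s]]) (simp add: mm_simps)
      then have "S s ** a0 = 2 *\<^sub>R (?r s ** ((mat 1 + k s) ** (?s s ** w s ** ?r s)))"
        unfolding W[OF s, symmetric] S_def by (simp only: mm.scaleR_right matrix_mul_assoc)
      also have "\<dots> = 2 *\<^sub>R (?r s ** (w s ** ?r s))"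
        by (simp only: mm_assoc matrix_inv_mul_assoc[OF inv(2)[OF s]])
      finally have 1: "S s ** a0 = 2 *\<^sub>R (?r s ** (w s ** ?r s))" .
      \<comment> \<open>Writing \<open>w s ** ?r s\<close> with the factor
        \<open>mat 1 - k s\<close> lets the two summands add up through
        \<open>(1 + k) + (1 - k) = 2\<close>.\<close>
      have "w s ** ?r s = (mat 1 - k s) ** (?r s ** (w s ** ?r s))"
        by (simp only: matrix_inv_mul_assoc[OF inv(1)[OF s]])
      then have "(mat 1 + k s) ** (?r s ** w s ** ?r s) + w s ** ?r s
         = (mat 1 + k s) ** (?r s ** (w s ** ?r s)) + (mat 1 - k s) ** (?r s ** (w s ** ?r s))"
        by (simp add: mm_assoc)
      also have "\<dots> = 2 *\<^sub>R (?r s ** (w s ** ?r s))"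
        by (simp add: mm.add_left mm.diff_left numeral_mult_eq_scaleR)
      finally show ?thesis using 1 by simp
    qed
    ultimately show ?thesis by simp
  qed
  have "((\<lambda>s. S s ** mexp (s *\<^sub>R (- a0))) has_vector_derivative 0) (at s within I)" if s: "s \<in> I" for s
  proof -
    have "((\<lambda>s. S s ** mexp (s *\<^sub>R (- a0))) has_vector_derivative 0) (at s)"
      using mm.has_vector_derivative[OF S'[OF s] has_vector_derivative_mexp[of "- a0"]] by (simp add: mm_simps)
    then show ?thesis by (rule has_vector_derivative_at_within)
  qed
  then have "S t ** mexp (t *\<^sub>R (- a0)) = S 0 ** mexp (0 *\<^sub>R (- a0))"
  proof (rule has_vector_derivative_zero_constant[OF I(1)])
    fix c assume c: "\<And>s. s \<in> I \<Longrightarrow> S s ** mexp (s *\<^sub>R (- a0)) = c"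
    show ?thesis using c[OF I(4)] c[OF I(3)] by simp
  qed
  moreover have "matrix_inv (mat 1) = (mat 1 :: real^'d^'d)" by (rule invertibleI(2)) simp
  ultimately have "S t ** mexp (- (t *\<^sub>R a0)) = mat 1" by (simp add: S_def k0)
  then have "S t ** (mexp (- (t *\<^sub>R a0)) ** mexp (t *\<^sub>R a0)) = mexp (t *\<^sub>R a0)"
    by (simp add: matrix_mul_assoc)
  then have "S t = mexp (t *\<^sub>R a0)" using mexp_inverse[of "- (t *\<^sub>R a0)"] by simp
  \<comment> \<open>The exponent \<open>t *\<^sub>R a0\<close> is twice \<open>a\<close>; the square
    root \<open>mexp a\<close> is what turns the Cayley transform into a hyperbolic tangent.\<close>
  also have "mexp (t *\<^sub>R a0) = mexp a ** mexp a"
  proof -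
    have "(1 + 1) *\<^sub>R a = t *\<^sub>R a0" by (simp add: a_def a0_def mult.commute)
    with mexp_add[of 1 1 a] show ?thesis by (simp only: scaleR_one)
  qed
  finally have St: "S t = mexp a ** mexp a" .
  have inv1: "mexp (- a) ** (mexp a ** X) = X" for X :: "real^'d^'d"
    using mexp_inverse[of "- a"] by (simp add: matrix_mul_assoc)
  \<comment> \<open>Inverting the Cayley transform: \<open>1 + k = exp (2 a) (1 - k)\<close>,
    multiplied by \<open>exp (- a)\<close> and solved for \<open>k\<close>.\<close>
  have "(mat 1 + k t) = S t ** (mat 1 - k t)"
    by (simp only: S_def mm_assoc matrix_inv_mul(2)[OF inv(1)[OF I(4)]] matrix_mul_rid)
  then have "mexp (- a) ** (mat 1 + k t) = mexp a ** (mat 1 - k t)"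
    by (simp only: St mm_assoc inv1)
  then have eq: "(mexp a + mexp (- a)) ** k t = mexp a - mexp (- a)"
    by (simp add: mm_simps algebra_simps)
  \<comment> \<open>\<open>S + 1\<close> is twice an inverse matrix, hence invertible, and
    \<open>exp (- a) (S + 1)\<close> is the denominator of the hyperbolic tangent. Thus a geodesic
    cannot outlive the domain of that expression.\<close>
  have "S t + mat 1 = 2 *\<^sub>R ?r t"
  proof -
    have "S t + mat 1 = (mat 1 + k t) ** ?r t + (mat 1 - k t) ** ?r t"
      by (simp only: S_def matrix_inv_mul(1)[OF inv(1)[OF I(4)]])
    also have "\<dots> = 2 *\<^sub>R ?r t" by (simp add: mm.add_left mm.diff_left numeral_mult_eq_scaleR)
    finally show ?thesis .
  qed
  moreover have "mexp (- a) ** (S t + mat 1) = mexp a + mexp (- a)"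
    by (simp add: St mm.add_right inv1)
  moreover have "(2 *\<^sub>R ?r t) ** ((1 / 2) *\<^sub>R (mat 1 - k t)) = mat 1"
    by (simp add: mm.scaleR_left mm.scaleR_right matrix_inv_mul[OF inv(1)[OF I(4)]])
  then have "invertible (2 *\<^sub>R ?r t)" by (rule invertibleI)
  moreover have "invertible (mexp (- a))" using mexp_inverse[of "- a"] by (rule invertibleI)
  ultimately show "invertible (mexp a + mexp (- a))" by (metis invertible_mult)
  then show "k t = matrix_inv (mexp a + mexp (- a)) ** (mexp a - mexp (- a))"
    by (simp add: eq[symmetric] matrix_inv_mul_assoc)
qed

section \<open>The chart around an almost complex structure\<close>

lemmas field_apply = plus_fun_apply minus_apply uminus_apply zero_fun_apply fcomp_apply fscale_apply

text \<open>The rules for derivatives and limits yield eta-expanded fields, which these rules would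
  rewrite pointwise.\<close>

declare field_apply [simp del]

lemma fcomp_simps:
  "(A + B) \<odot> C = A \<odot> C + B \<odot> C" "A \<odot> (B + C) = A \<odot> B + A \<odot> C"
  "(A - B) \<odot> C = A \<odot> C - B \<odot> C" "A \<odot> (B - C) = A \<odot> B - A \<odot> C"
  "(- A) \<odot> B = - (A \<odot> B)" "A \<odot> (- B) = - (A \<odot> B)"
  "(r \<cdot> A) \<odot> B = r \<cdot> (A \<odot> B)" "A \<odot> (r \<cdot> B) = r \<cdot> (A \<odot> B)"
  "0 \<odot> A = 0" "A \<odot> 0 = 0" "A \<odot> B \<odot> C = A \<odot> (B \<odot> C)"
  "r \<cdot> (A + B) = r \<cdot> A + r \<cdot> B" "r \<cdot> (A - B) = r \<cdot> A - r \<cdot> B" "r \<cdot> (- A) = - (r \<cdot> A)"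
  by (simp_all add: fun_eq_iff field_apply mm_simps algebra_simps)

locale almost_complex_point = closed_manifold +
  fixes J0
  assumes J0: "J0 \<in> almost_complex At"
begin

abbreviation "E \<equiv> tangent At J0"
abbreviation "V \<equiv> dom_V At J0"
abbreviation "P K \<equiv> finv At (fid At - K \<odot> K)"

lemma J0_endo: "J0 \<in> endo At" and J0_square: "J0 \<odot> J0 = - fid At"
  using J0 by (auto simp: almost_complex_def)

lemma J0_mat: "c \<in> At \<Longrightarrow> p \<in> fst c \<Longrightarrow> J0 c p ** J0 c p = - mat 1"
  using fun_cong[OF fun_cong[OF J0_square, of c], of p] by (simp add: field_apply)

lemma tangent_endo: "A \<in> E \<Longrightarrow> A \<in> endo At"
  by (simp add: tangent_def)

lemma tangent_mat:
  assumes "A \<in> E"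
  shows "J0 c p ** A c p = - (A c p ** J0 c p)"
proof -
  have "J0 \<odot> A + A \<odot> J0 = 0" using assms by (simp add: tangent_def)
  from fun_cong[OF fun_cong[OF this, of c], of p] show ?thesis
    by (simp add: field_apply eq_neg_iff_add_eq_0)
qed

lemma tangentI:
  assumes "A \<in> endo At" "\<And>c p. c \<in> At \<Longrightarrow> p \<in> fst c \<Longrightarrow> J0 c p ** A c p = - (A c p ** J0 c p)"
  shows "A \<in> E"
proof -
  have "J0 \<odot> A + A \<odot> J0 = 0"
    by (rule field_eqI) (use assms in \<open>auto intro: endo_add endo_fcomp endo_0 J0_endo simp: field_apply\<close>)
  then show ?thesis using assms(1) by (simp add: tangent_def)
qed

lemma tangent_add: "A \<in> E \<Longrightarrow> B \<in> E \<Longrightarrow> A + B \<in> E"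
  by (rule tangentI[OF endo_add]) (simp_all add: tangent_endo field_apply mm_simps tangent_mat)

lemma tangent_minus: "A \<in> E \<Longrightarrow> - A \<in> E"
  by (rule tangentI[OF endo_minus]) (simp_all add: tangent_endo field_apply mm_simps tangent_mat)

lemma tangent_diff: "A \<in> E \<Longrightarrow> B \<in> E \<Longrightarrow> A - B \<in> E"
  using tangent_add[OF _ tangent_minus, of A B] by simp

lemma tangent_fscale: "A \<in> E \<Longrightarrow> r \<cdot> A \<in> E"
  by (rule tangentI[OF endo_fscale]) (simp_all add: tangent_endo field_apply mm_simps tangent_mat)

lemma V_tangent: "K \<in> V \<Longrightarrow> K \<in> E" and V_iso: "K \<in> V \<Longrightarrow> is_iso At (fid At - K)"
  by (simp_all add: dom_V_def)

lemma V_endo: "K \<in> V \<Longrightarrow> K \<in> endo At"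
  by (simp add: V_tangent tangent_endo)

lemma V_mat:
  assumes "K \<in> V" "c \<in> At" "p \<in> fst c"
  shows "J0 c p ** J0 c p = - mat 1" "J0 c p ** K c p = - (K c p ** J0 c p)" "invertible (mat 1 - K c p)"
  using J0_mat[OF assms(2,3)] tangent_mat[OF V_tangent[OF assms(1)]] V_iso[OF assms(1)] assms(2,3)
  by (auto simp: is_iso_def field_apply)

lemma V_iso_square: "K \<in> V \<Longrightarrow> is_iso At (fid At - K \<odot> K)"
  unfolding is_iso_def
proof (intro ballI)
  fix c p assume "K \<in> V" and c: "c \<in> At" "p \<in> fst c"
  from invertible_one_minus_square[OF V_mat[OF this]] show "invertible ((fid At - K \<odot> K) c p)"
    using c by (simp add: field_apply)
qed

lemma P_endo: "K \<in> V \<Longrightarrow> P K \<in> endo At"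
  by (intro endo_finv endo_diff endo_fid endo_fcomp V_endo V_iso_square)

lemma P_mat_J0:
  "K \<in> V \<Longrightarrow> c \<in> At \<Longrightarrow> p \<in> fst c \<Longrightarrow>
    matrix_inv (mat 1 - K c p ** K c p) ** J0 c p = J0 c p ** matrix_inv (mat 1 - K c p ** K c p)"
  by (rule q_J[OF V_mat])

text \<open>Anticommuting with \<open>J0\<close> is a linear condition at each point, so it passes
  from a curve to its derivative.\<close>

lemma tangent_limit:
  assumes \<gamma>: "has_curve_deriv At \<gamma> L t" and ev: "\<forall>\<^sub>F s in nhds t. \<gamma> s \<in> E"
  shows "L \<in> E"
proof (rule tangentI)
  fix c p assume c: "c \<in> At" "p \<in> fst c"
  note der = has_curve_deriv_pointwise[OF \<gamma> c]
  obtain S where S: "open S" "t \<in> S" "\<And>s. s \<in> S \<Longrightarrow> \<gamma> s \<in> E"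
    using ev by (auto simp: eventually_nhds)
  have left: "((\<lambda>s. J0 c p ** \<gamma> s c p) has_vector_derivative (J0 c p ** L c p)) (at t)"
    by (rule bounded_linear.has_vector_derivative[OF mm.bounded_linear_right der])
  have "((\<lambda>s. - (\<gamma> s c p ** J0 c p)) has_vector_derivative - (L c p ** J0 c p)) (at t)"
    by (rule has_vector_derivative_minus[OF bounded_linear.has_vector_derivative[OF mm.bounded_linear_left der]])
  from has_vector_derivative_transform_within_open[OF this S(1,2) tangent_mat[OF S(3), symmetric]]
  have "((\<lambda>s. J0 c p ** \<gamma> s c p) has_vector_derivative - (L c p ** J0 c p)) (at t)" .
  with left show "J0 c p ** L c p = - (L c p ** J0 c p)" by (rule vector_derivative_unique_at)
qed (rule has_curve_deriv_endo[OF \<gamma>])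

lemma eventually_V:
  assumes "fderiv \<gamma> L t" "\<gamma> t \<in> V" "\<forall>\<^sub>F s in nhds t. \<gamma> s \<in> E"
  shows "\<forall>\<^sub>F s in nhds t. \<gamma> s \<in> V"
proof -
  have "fderiv (\<lambda>s. fid At - \<gamma> s) (0 - L) t" by (intro fderiv_diff fderiv_const endo_fid assms(1))
  from fderiv_eventually_is_iso[OF this V_iso[OF assms(2)]] assms(3)
  show ?thesis by eventually_elim (simp add: dom_V_def)
qed

lemma eventually_V_line:
  assumes "K \<in> V" "A \<in> E"
  shows "\<forall>\<^sub>F t in nhds 0. K + t \<cdot> A \<in> V"
  by (rule eventually_V[OF fderiv_line])
    (use assms in \<open>auto intro: always_eventually tangent_add tangent_fscale V_tangent tangent_endo\<close>)

lemma fderiv_P: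
  assumes \<gamma>: "fderiv \<gamma> L t" and "\<gamma> t \<in> V"
  shows "fderiv (\<lambda>s. P (\<gamma> s)) (P (\<gamma> t) \<odot> (L \<odot> \<gamma> t + \<gamma> t \<odot> L) \<odot> P (\<gamma> t)) t"
  using fderiv_finv[OF fderiv_diff[OF fderiv_const[OF endo_fid] fderiv_fcomp[OF \<gamma> \<gamma>]] V_iso_square[OF assms(2)]]
  by (simp add: fcomp_simps add.commute)

text \<open>\<open>Phi_inv\<close> is given only as an abstract inverse; this is the explicit
  formula \<open>J_K = J0 (1 + K)(1 - K)^-1\<close>, which can be differentiated.
  \<open>Phi_inv_eq\<close> identifies the two on \<open>V\<close>.\<close>

definition JK :: "('a, 'b) field \<Rightarrow> ('a, 'b) field" where
  "JK K = J0 \<odot> (fid At + K) \<odot> finv At (fid At - K)"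

lemma JK_mat: "c \<in> At \<Longrightarrow> p \<in> fst c \<Longrightarrow> JK K c p = J0 c p ** (mat 1 + K c p) ** matrix_inv (mat 1 - K c p)"
  by (simp add: JK_def field_apply)

lemma JK_endo: "K \<in> V \<Longrightarrow> JK K \<in> endo At"
  unfolding JK_def by (intro endo_fcomp endo_add endo_diff endo_fid endo_finv J0_endo V_endo V_iso)

text \<open>Moving the right \<open>J0\<close> to the left changes the sign of \<open>K\<close> in
  each factor. In this form \<open>1 - J_K J0\<close> and \<open>1 + J_K J0\<close> become
  \<open>2 (1 + K)^-1\<close> and \<open>2 K (1 + K)^-1\<close>, whose quotient is visibly
  \<open>K\<close>.\<close>

lemma JK_J0_mat:
  assumes K: "K \<in> V" and c: "c \<in> At" "p \<in> fst c"
  shows "JK K c p ** J0 c p = (K c p - mat 1) ** matrix_inv (mat 1 + K c p)"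
proof -
  note m = V_mat[OF K c]
  have "JK K c p ** J0 c p = J0 c p ** (mat 1 + K c p) ** (matrix_inv (mat 1 - K c p) ** J0 c p)"
    by (simp add: JK_mat c mm_assoc)
  also have "\<dots> = (J0 c p ** (mat 1 + K c p) ** J0 c p) ** matrix_inv (mat 1 + K c p)"
    by (simp add: r_J[OF m] mm_assoc)
  also have "J0 c p ** (mat 1 + K c p) ** J0 c p = K c p - mat 1"
    using m(1,2) anti_assoc[OF m] by (simp add: mm_simps)
  finally show ?thesis .
qed

lemma JK_dom_U:
  assumes K: "K \<in> V"
  shows "JK K \<in> dom_U At J0" and "Phi At J0 (JK K) = K"
proof -
  have minus: "mat 1 - JK K c p ** J0 c p = 2 *\<^sub>R matrix_inv (mat 1 + K c p)"
    and plus: "mat 1 + JK K c p ** J0 c p = 2 *\<^sub>R (K c p ** matrix_inv (mat 1 + K c p))"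
    and square: "JK K c p ** JK K c p = - mat 1"
    if c: "c \<in> At" "p \<in> fst c" for c p
  proof -
    note m = V_mat[OF K c]
    let ?s = "matrix_inv (mat 1 + K c p)"
    have e: "mat 1 = (mat 1 + K c p) ** ?s" using matrix_inv_mul[OF invertible_one_plus_k[OF m]] by simp
    have eq: "(mat 1 + K c p) ** ?s - (K c p - mat 1) ** ?s = 2 *\<^sub>R ?s"
      "(mat 1 + K c p) ** ?s + (K c p - mat 1) ** ?s = 2 *\<^sub>R (K c p ** ?s)"
      by (simp_all add: mm_simps numeral_mult_eq_scaleR)
    show "mat 1 - JK K c p ** J0 c p = 2 *\<^sub>R ?s" "mat 1 + JK K c p ** J0 c p = 2 *\<^sub>R (K c p ** ?s)"
      using e eq unfolding JK_J0_mat[OF K c] by simp_all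
    have "JK K c p ** JK K c p = (JK K c p ** J0 c p) ** ((mat 1 + K c p) ** matrix_inv (mat 1 - K c p))"
      by (simp add: JK_mat c mm_assoc)
    also have "\<dots> = (K c p - mat 1) ** matrix_inv (mat 1 - K c p)"
      unfolding JK_J0_mat[OF K c] by (simp only: mm_assoc matrix_inv_mul_assoc[OF invertible_one_plus_k[OF m]])
    also have "\<dots> = - ((mat 1 - K c p) ** matrix_inv (mat 1 - K c p))"
      by (simp add: mm_simps)
    finally show "JK K c p ** JK K c p = - mat 1" by (simp only: matrix_inv_mul[OF m(3)])
  qed
  have "JK K \<odot> JK K = - fid At"
    by (rule field_eqI) (auto intro: endo_fcomp endo_minus endo_fid JK_endo K simp: square field_apply)
  moreover have "is_iso At (fid At - JK K \<odot> J0)"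
    unfolding is_iso_def
  proof (intro ballI)
    fix c p assume c: "c \<in> At" "p \<in> fst c"
    have "(2 *\<^sub>R matrix_inv (mat 1 + K c p)) ** ((1/2) *\<^sub>R (mat 1 + K c p)) = mat 1"
      by (simp add: mm.scaleR_left mm.scaleR_right matrix_inv_mul[OF invertible_one_plus_k[OF V_mat[OF K c]]])
    then show "invertible ((fid At - JK K \<odot> J0) c p)" using c by (simp add: field_apply minus invertibleI(1))
  qed
  ultimately show U: "JK K \<in> dom_U At J0"
    using JK_endo[OF K] by (simp add: dom_U_def almost_complex_def)
  show "Phi At J0 (JK K) = K"
    unfolding Phi_def
  proof (rule field_eqI)
    show "finv At (fid At - JK K \<odot> J0) \<odot> (fid At + JK K \<odot> J0) \<in> endo At"
      using U by (intro endo_fcomp endo_finv endo_diff endo_add endo_fid JK_endo J0_endo K) (simp add: dom_U_def)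
    fix c p assume c: "c \<in> At" "p \<in> fst c"
    note m = V_mat[OF K c]
    have "(2 *\<^sub>R matrix_inv (mat 1 + K c p)) ** ((1/2) *\<^sub>R (mat 1 + K c p)) = mat 1"
      by (simp add: mm.scaleR_left mm.scaleR_right matrix_inv_mul[OF invertible_one_plus_k[OF m]])
    then have i: "matrix_inv (2 *\<^sub>R matrix_inv (mat 1 + K c p)) = (1/2) *\<^sub>R (mat 1 + K c p)"
      by (rule invertibleI)
    have "(mat 1 + K c p) ** (K c p ** matrix_inv (mat 1 + K c p)) = K c p ** ((mat 1 + K c p) ** matrix_inv (mat 1 + K c p))"
      by (simp add: mm_simps)
    then have "(mat 1 + K c p) ** (K c p ** matrix_inv (mat 1 + K c p)) = K c p"
      by (simp add: matrix_inv_mul[OF invertible_one_plus_k[OF m]])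
    then show "(finv At (fid At - JK K \<odot> J0) \<odot> (fid At + JK K \<odot> J0)) c p = K c p"
      using c by (simp add: field_apply minus plus i mm.scaleR_left mm.scaleR_right)
  qed (rule V_endo[OF K])
qed

lemma Phi_inv_eq:
  assumes K: "K \<in> V"
  shows "Phi_inv At J0 K = JK K"
  unfolding Phi_inv_def the_inv_into_def
proof (rule the_equality)
  show "JK K \<in> dom_U At J0 \<and> Phi At J0 (JK K) = K" using JK_dom_U[OF K] by simp
  fix J assume J: "J \<in> dom_U At J0 \<and> Phi At J0 J = K"
  then have J_endo: "J \<in> endo At" and iso: "is_iso At (fid At - J \<odot> J0)" and Phi: "Phi At J0 J = K"
    by (auto simp: dom_U_def almost_complex_def)
  show "J = JK K"
  proof (rule field_eqI[OF J_endo JK_endo[OF K]])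
    fix c p assume c: "c \<in> At" "p \<in> fst c"
    note m = V_mat[OF K c]
    \<comment> \<open>With \<open>x = J J0\<close> the equation for the chart reads
      \<open>(1 - x) k = 1 + x\<close>, which is linear in \<open>x\<close> and has the only
      solution \<open>(k - 1)(1 + k)^-1\<close>.\<close>
    let ?k = "K c p" and ?x = "J c p ** J0 c p"
    have inv: "invertible (mat 1 - ?x)" using iso c by (auto simp: is_iso_def field_apply)
    have "matrix_inv (mat 1 - ?x) ** (mat 1 + ?x) = ?k"
      using fun_cong[OF fun_cong[OF Phi, of c], of p] c by (simp add: Phi_def field_apply)
    then have "(mat 1 - ?x) ** ?k = mat 1 + ?x"
      using matrix_inv_mul_assoc(1)[OF inv, of "mat 1 + ?x"] by simp
    then have "?x ** (mat 1 + ?k) = ?k - mat 1" by (simp add: mm_simps algebra_simps)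
    then have "?x ** (mat 1 + ?k) ** matrix_inv (mat 1 + ?k) = JK K c p ** J0 c p"
      by (simp add: JK_J0_mat[OF K c])
    then have "?x = JK K c p ** J0 c p"
      by (simp add: mm_assoc matrix_inv_mul[OF invertible_one_plus_k[OF m]])
    then have "?x ** J0 c p = JK K c p ** J0 c p ** J0 c p" by simp
    then show "J c p = JK K c p" by (simp add: mm_simps J0_mat[OF c])
  qed
qed

lemma dderiv_eqI: "fderiv (\<lambda>t. F (K + t \<cdot> A)) L 0 \<Longrightarrow> dderiv At F K A = L"
  unfolding dderiv_def using curve_deriv_eq fderivD(4) by blast

lemma dderiv_Phi_inv:
  assumes K: "K \<in> V" and A: "A \<in> E"
  shows "dderiv At (Phi_inv At J0) K A = 2 \<cdot> (J0 \<odot> finv At (fid At - K) \<odot> A \<odot> finv At (fid At - K))"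
proof (rule dderiv_eqI)
  let ?R = "finv At (fid At - K)"
  note en = tangent_endo[OF A] V_endo[OF K]
  have line: "fderiv (\<lambda>t. K + t \<cdot> A) A 0" using en by (intro fderiv_line)
  have "fderiv (\<lambda>t. finv At (fid At - (K + t \<cdot> A))) (- (finv At (fid At - (K + 0 \<cdot> A)) \<odot> (0 - A) \<odot> finv At (fid At - (K + 0 \<cdot> A)))) 0"
    by (intro fderiv_finv fderiv_diff fderiv_const endo_fid line) (simp add: V_iso[OF K])
  then have R: "fderiv (\<lambda>t. finv At (fid At - (K + t \<cdot> A))) (?R \<odot> A \<odot> ?R) 0" by (simp add: fcomp_simps)
  have "fderiv (\<lambda>t. JK (K + t \<cdot> A))
     ((0 \<odot> (fid At + (K + 0 \<cdot> A)) + J0 \<odot> (0 + A)) \<odot> finv At (fid At - (K + 0 \<cdot> A)) + J0 \<odot> (fid At + (K + 0 \<cdot> A)) \<odot> (?R \<odot> A \<odot> ?R)) 0"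
    unfolding JK_def
    by (rule fderiv_fcomp[OF fderiv_fcomp[OF fderiv_const[OF J0_endo] fderiv_add[OF fderiv_const[OF endo_fid] line]] R])
  also have "(0 \<odot> (fid At + (K + 0 \<cdot> A)) + J0 \<odot> (0 + A)) \<odot> finv At (fid At - (K + 0 \<cdot> A)) + J0 \<odot> (fid At + (K + 0 \<cdot> A)) \<odot> (?R \<odot> A \<odot> ?R)
      = 2 \<cdot> (J0 \<odot> ?R \<odot> A \<odot> ?R)"
  proof (rule field_eqI)
    fix c p assume c: "c \<in> At" "p \<in> fst c"
    let ?k = "K c p" and ?r = "matrix_inv (mat 1 - K c p)" and ?a = "A c p" and ?J = "J0 c p"
    \<comment> \<open>The first summand is rewritten with \<open>a = (1 - k) r a\<close>; the two
      terms then combine through \<open>(1 - k) + (1 + k) = 2\<close>, the source of the factor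
      2.\<close>
    have "?J ** ?a ** ?r + ?J ** (mat 1 + ?k) ** (?r ** ?a ** ?r)
        = ?J ** (((mat 1 - ?k) ** (?r ** (?a ** ?r))) + (mat 1 + ?k) ** (?r ** (?a ** ?r)))"
      unfolding matrix_inv_mul_assoc(1)[OF V_mat(3)[OF K c]] by (simp add: mm_simps)
    also have "\<dots> = 2 *\<^sub>R (?J ** ?r ** ?a ** ?r)" by (simp add: mm_simps numeral_mult_eq_scaleR)
    finally show "((0 \<odot> (fid At + (K + 0 \<cdot> A)) + J0 \<odot> (0 + A)) \<odot> finv At (fid At - (K + 0 \<cdot> A)) + J0 \<odot> (fid At + (K + 0 \<cdot> A)) \<odot> (?R \<odot> A \<odot> ?R)) c p
      = (2 \<cdot> (J0 \<odot> ?R \<odot> A \<odot> ?R)) c p"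
      using c by (simp add: field_apply mm.zero_left)
  qed (simp_all, (intro endo_intros J0_endo en V_iso K)+)
  finally have "fderiv (\<lambda>t. JK (K + t \<cdot> A)) (2 \<cdot> (J0 \<odot> ?R \<odot> A \<odot> ?R)) 0" .
  \<comment> \<open>\<open>JK\<close> agrees with \<open>Phi_inv\<close> only on \<open>V\<close>,
    and a line through a point of \<open>V\<close> stays there for small parameters.\<close>
  then show "fderiv (\<lambda>t. Phi_inv At J0 (K + t \<cdot> A)) (2 \<cdot> (J0 \<odot> ?R \<odot> A \<odot> ?R)) 0"
    by (rule fderiv_cong[rotated]) (use eventually_V_line[OF K A] in \<open>auto simp: Phi_inv_eq elim: eventually_mono\<close>)
qed

lemma ftrace_scaled_eqI:
  assumes "\<And>c. c \<in> At \<Longrightarrow> p \<in> fst c \<Longrightarrow> trace (X c p) = r * trace (Y c p)"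
  shows "ftrace At X p = r * ftrace At Y p"
proof -
  have "\<exists>c. c \<in> At \<and> p \<in> fst c" using chart_around by blast
  then have "(SOME c. c \<in> At \<and> p \<in> fst c) \<in> At \<and> p \<in> fst (SOME c. c \<in> At \<and> p \<in> fst c)" by (rule someI_ex)
  then show ?thesis unfolding ftrace_def by (intro assms) auto
qed

lemma inner_K_eq:
  assumes K: "K \<in> V" and A: "A \<in> E" and B: "B \<in> E"
  shows "inner_K At \<mu> J0 K A B = 4 * (\<integral>p. ftrace At (P K \<odot> A \<odot> P K \<odot> B) p \<partial>\<mu>)"
proof -
  have "ftrace At (dderiv At (Phi_inv At J0) K A \<odot> dderiv At (Phi_inv At J0) K B) p = 4 * ftrace At (P K \<odot> A \<odot> P K \<odot> B) p" for p
    by (rule ftrace_scaled_eqI)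
      (simp add: field_apply dderiv_Phi_inv[OF K A] dderiv_Phi_inv[OF K B] star_product[OF V_mat[OF K] tangent_mat[OF A]])
  then show ?thesis by (simp add: inner_K_def inner_AC_def)
qed

section \<open>The Christoffel map and its curvature\<close>

definition Gam :: "('a, 'b) christoffel" where
  "Gam K A B = A \<odot> K \<odot> P K \<odot> B + B \<odot> K \<odot> P K \<odot> A"

lemma Gam_sym: "Gam K A B = Gam K B A"
  by (simp add: Gam_def add.commute)

lemma Gam_tangent:
  assumes K: "K \<in> V" and A: "A \<in> E" and B: "B \<in> E"
  shows "Gam K A B \<in> E"
proof (rule tangentI)
  show "Gam K A B \<in> endo At"
    unfolding Gam_def by (intro endo_add endo_fcomp P_endo tangent_endo V_endo K A B)
  fix c p assume c: "c \<in> At" "p \<in> fst c"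
  have anti: "J0 c p ** (X c p ** Y) = - (X c p ** (J0 c p ** Y))" if "X \<in> E" for X and Y :: "real^'b^'b"
    by (simp add: matrix_mul_assoc tangent_mat[OF that] mm.minus_left)
  have comm: "J0 c p ** (matrix_inv (mat 1 - K c p ** K c p) ** Y) = matrix_inv (mat 1 - K c p ** K c p) ** (J0 c p ** Y)" for Y :: "real^'b^'b"
    by (simp add: matrix_mul_assoc P_mat_J0[OF K c])
  show "J0 c p ** Gam K A B c p = - (Gam K A B c p ** J0 c p)"
    using c by (simp add: Gam_def field_apply mm_simps anti[OF A] anti[OF B] anti[OF V_tangent[OF K]] comm tangent_mat[OF A] tangent_mat[OF B])
qed

section \<open>Covariant derivatives and curvature of constant fields\<close>

lemma dderiv_const: "A \<in> endo At \<Longrightarrow> dderiv At (\<lambda>_. A) K B = 0"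
  by (rule dderiv_eqI) (rule fderiv_const)

lemma cov_const: "B \<in> E \<Longrightarrow> cov At \<Gamma> (\<lambda>_. A) (\<lambda>_. B) K = \<Gamma> K A B"
  by (simp add: cov_def dderiv_const tangent_endo)

text \<open>In each summand of \<open>Gam\<close> the point occurs only in
  \<open>K \<odot> P K\<close>; \<open>D X\<close> is \<open>X\<close> times the derivative of this
  factor in direction \<open>A\<close>.\<close>

lemma fderiv_Gam:
  assumes K: "K \<in> V" and A: "A \<in> E" and B: "B \<in> E" and C: "C \<in> E"
  defines "D \<equiv> \<lambda>X. X \<odot> (A \<odot> P K + K \<odot> P K \<odot> (A \<odot> K + K \<odot> A) \<odot> P K)"
  shows "fderiv (\<lambda>t. Gam (K + t \<cdot> A) B C) (D B \<odot> C + D C \<odot> B) 0"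
proof -
  have line: "fderiv (\<lambda>t. K + t \<cdot> A) A 0" by (intro fderiv_line V_endo K tangent_endo A)
  have K0: "K + 0 \<cdot> A \<in> V" using K by simp
  have "fderiv (\<lambda>t. X \<odot> (K + t \<cdot> A) \<odot> P (K + t \<cdot> A) \<odot> Y) (D X \<odot> Y) 0" if "X \<in> E" "Y \<in> E" for X Y
    using fderiv_fcomp[OF fderiv_fcomp[OF fderiv_fcomp[OF fderiv_const[OF tangent_endo[OF that(1)]] line] fderiv_P[OF line K0]]
        fderiv_const[OF tangent_endo[OF that(2)]]]
    by (simp add: D_def fcomp_simps)
  from fderiv_add[OF this[OF B C] this[OF C B]] show ?thesis by (simp add: Gam_def)
qed

lemma curvature_Gam:
  assumes \<Gamma>: "\<And>K A B. K \<in> V \<Longrightarrow> A \<in> E \<Longrightarrow> B \<in> E \<Longrightarrow> \<Gamma> K A B = Gam K A B"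
    and K: "K \<in> V" and A: "A \<in> E" and B: "B \<in> E" and C: "C \<in> E"
  shows "curvature At \<Gamma> K A B C =
    - ((fid At - K \<odot> K) \<odot> commutator (commutator (P K \<odot> A) (P K \<odot> B)) (P K \<odot> C))"
proof -
  define D where "D A X = X \<odot> (A \<odot> P K + K \<odot> P K \<odot> (A \<odot> K + K \<odot> A) \<odot> P K)" for A X
  have cov: "cov At \<Gamma> (\<lambda>_. A) (cov At \<Gamma> (\<lambda>_. B) (\<lambda>_. C)) K = D A B \<odot> C + D A C \<odot> B + Gam K A (Gam K B C)"
    if A: "A \<in> E" and B: "B \<in> E" for A B
  proof -
    have c: "cov At \<Gamma> (\<lambda>_. B) (\<lambda>_. C) = (\<lambda>K. \<Gamma> K B C)" by (rule ext) (rule cov_const[OF C])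
    \<comment> \<open>A connection is determined only on \<open>V\<close>, but its derivative at
      \<open>K\<close> sees only nearby points of the line, all of which lie in
      \<open>V\<close>.\<close>
    have "fderiv (\<lambda>t. \<Gamma> (K + t \<cdot> A) B C) (D A B \<odot> C + D A C \<odot> B) 0"
      by (rule fderiv_cong[OF _ fderiv_Gam[OF K A B C, folded D_def]])
        (use eventually_V_line[OF K A] in \<open>auto simp: \<Gamma> B C elim: eventually_mono\<close>)
    from dderiv_eqI[OF this] show ?thesis
      unfolding c by (simp add: cov_def \<Gamma> K A B C Gam_tangent)
  qed
  have Den: "D A B \<in> endo At" if "A \<in> E" "B \<in> E" for A B
    unfolding D_def by (intro endo_fcomp endo_add P_endo V_endo tangent_endo that K)
  show ?thesis
    unfolding curvature_def cov[OF A B] cov[OF B A]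
  proof (rule field_eqI)
    show "D A B \<odot> C + D A C \<odot> B + Gam K A (Gam K B C) - (D B A \<odot> C + D B C \<odot> A + Gam K B (Gam K A C)) \<in> endo At"
      by (intro endo_diff endo_add endo_fcomp Den tangent_endo Gam_tangent A B C K)
    show "- ((fid At - K \<odot> K) \<odot> commutator (commutator (P K \<odot> A) (P K \<odot> B)) (P K \<odot> C)) \<in> endo At"
      unfolding commutator_def
      by (intro endo_minus endo_fcomp endo_diff endo_fid P_endo[OF K] V_endo[OF K]
          tangent_endo[OF A] tangent_endo[OF B] tangent_endo[OF C])
    fix c p assume c: "c \<in> At" "p \<in> fst c"
    show "(D A B \<odot> C + D A C \<odot> B + Gam K A (Gam K B C) - (D B A \<odot> C + D B C \<odot> A + Gam K B (Gam K A C))) c p =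
      (- ((fid At - K \<odot> K) \<odot> commutator (commutator (P K \<odot> A) (P K \<odot> B)) (P K \<odot> C))) c p"
      unfolding D_def Gam_def commutator_def field_apply fid_apply[OF c] finv_apply[OF c]
      by (rule curvature_identity[OF V_mat[OF K c]])
  qed
qed

end

section \<open>Smoothness of rational expressions\<close>

text \<open>\<open>Var i\<close> is component \<open>i\<close> of the point, \<open>Dir j i\<close> is component \<open>i\<close> of the \<open>j\<close>-th direction, and
  \<open>Pinv\<close> is \<open>(1 - K\<^sup>2)\<^sup>-\<^sup>1\<close> for the component \<open>K\<close> of index \<open>0\<close>.  These expressions are closed under
  directional derivatives, and an expression depends continuously on point and directions jointly.\<close>

datatype 'f rexp = Cst 'f | Var nat | Dir nat nat | Pinv | Add "'f rexp" "'f rexp" | Mul "'f rexp" "'f rexp"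

fun reval :: "('m, 'd::finite) chart set \<Rightarrow> ('m, 'd) field rexp \<Rightarrow> ('m, 'd) field list \<Rightarrow> ('m, 'd) field list list
    \<Rightarrow> ('m, 'd) field" where
  "reval At (Cst A) Ks Ds = A"
| "reval At (Var i) Ks Ds = Ks ! i"
| "reval At (Dir j i) Ks Ds = Ds ! j ! i"
| "reval At Pinv Ks Ds = finv At (fid At - Ks ! 0 \<odot> Ks ! 0)"
| "reval At (Add a b) Ks Ds = reval At a Ks Ds + reval At b Ks Ds"
| "reval At (Mul a b) Ks Ds = reval At a Ks Ds \<odot> reval At b Ks Ds"

fun rdiff :: "nat \<Rightarrow> ('m, 'd::finite) field rexp \<Rightarrow> ('m, 'd) field rexp" where
  "rdiff k (Cst A) = Cst 0"
| "rdiff k (Var i) = Dir k i"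
| "rdiff k (Dir j i) = Cst 0"
| "rdiff k Pinv = Mul (Mul Pinv (Add (Mul (Dir k 0) (Var 0)) (Mul (Var 0) (Dir k 0)))) Pinv"
| "rdiff k (Add a b) = Add (rdiff k a) (rdiff k b)"
| "rdiff k (Mul a b) = Add (Mul (rdiff k a) b) (Mul a (rdiff k b))"

text \<open>The first \<open>k\<close> directions are already bound, so the next differentiation
  introduces the direction of index \<open>k\<close>. The resulting expression depends on the number
  of directions and not on the directions themselves; this is why joint continuity becomes a single
  limit of \<open>reval\<close>.\<close>

fun riter :: "nat \<Rightarrow> nat \<Rightarrow> ('m, 'd::finite) field rexp \<Rightarrow> ('m, 'd) field rexp" where
  "riter k 0 e = e"
| "riter k (Suc l) e = riter (Suc k) l (rdiff k e)"

fun rwf :: "('m, 'd::finite) field set \<Rightarrow> nat \<Rightarrow> nat \<Rightarrow> ('m, 'd) field rexp \<Rightarrow> bool" where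
  "rwf S m k (Cst A) \<longleftrightarrow> A \<in> S"
| "rwf S m k (Var i) \<longleftrightarrow> i < m"
| "rwf S m k (Dir j i) \<longleftrightarrow> j < k \<and> i < m"
| "rwf S m k Pinv \<longleftrightarrow> 0 < m"
| "rwf S m k (Add a b) \<longleftrightarrow> rwf S m k a \<and> rwf S m k b"
| "rwf S m k (Mul a b) \<longleftrightarrow> rwf S m k a \<and> rwf S m k b"

lemma rwf_mono: "rwf S m k e \<Longrightarrow> k \<le> l \<Longrightarrow> rwf S m l e"
  by (induction e) auto

lemma rwf_rdiff: "0 \<in> S \<Longrightarrow> rwf S m k e \<Longrightarrow> rwf S m (Suc k) (rdiff k e)"
  by (induction e) (auto intro: rwf_mono)

lemma rwf_riter: "0 \<in> S \<Longrightarrow> rwf S m k e \<Longrightarrow> rwf S m (k + l) (riter k l e)"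
proof (induction l arbitrary: k e)
  case (Suc l)
  from Suc.IH[OF Suc.prems(1) rwf_rdiff[OF Suc.prems]] show ?case by simp
qed simp

lemma reval_append: "rwf S m (length Ds) e \<Longrightarrow> reval At e Ks (Ds @ Ds') = reval At e Ks Ds"
  by (induction e) (auto simp: nth_append)

lemma length_displace: "length (displace Ks t D) = min (length Ks) (length D)"
  by (simp add: displace_def)

lemma nth_displace: "i < length Ks \<Longrightarrow> i < length D \<Longrightarrow> displace Ks t D ! i = Ks ! i + t \<cdot> (D ! i)"
  by (simp add: displace_def)

lemma displace_0: "length D = length Ks \<Longrightarrow> displace Ks 0 D = Ks"
  by (simp add: list_eq_iff_nth_eq length_displace nth_displace)

context almost_complex_point
begin

text \<open>The amount of openness that directional derivatives use: a displaced point stays in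
  \<open>W\<close> for small parameters. Component 0 lies in \<open>V\<close>, so that
  \<open>Pinv\<close> denotes a genuine inverse.\<close>

definition line_open :: "nat \<Rightarrow> ('a, 'b) field list set \<Rightarrow> bool" where
  "line_open m W \<longleftrightarrow> 0 < m \<and> (\<forall>Ks\<in>W. length Ks = m \<and> set Ks \<subseteq> E \<and> Ks ! 0 \<in> V) \<and>
     (\<forall>Ks\<in>W. \<forall>D\<in>tuples m E. \<forall>\<^sub>F t in nhds 0. displace Ks t D \<in> W)"

lemma line_openD:
  assumes "line_open m W" "Ks \<in> W"
  shows "0 < m" "length Ks = m" "i < m \<Longrightarrow> Ks ! i \<in> E" "Ks ! 0 \<in> V"
    "D \<in> tuples m E \<Longrightarrow> \<forall>\<^sub>F t in nhds 0. displace Ks t D \<in> W"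
proof -
  have *: "0 < m" "length Ks = m" "set Ks \<subseteq> E" "Ks ! 0 \<in> V"
    "\<forall>D\<in>tuples m E. \<forall>\<^sub>F t in nhds 0. displace Ks t D \<in> W"
    using assms unfolding line_open_def by blast+
  then show "0 < m" "length Ks = m" "i < m \<Longrightarrow> Ks ! i \<in> E" "Ks ! 0 \<in> V"
    "D \<in> tuples m E \<Longrightarrow> \<forall>\<^sub>F t in nhds 0. displace Ks t D \<in> W"
    using nth_mem[of i Ks] by blast+
qed

lemma tuples_nth: "D \<in> tuples m E \<Longrightarrow> i < m \<Longrightarrow> D ! i \<in> E"
  unfolding tuples_def using nth_mem[of i D] by auto

lemma fderiv_reval:
  assumes W: "line_open m W" "Ks \<in> W" and Ds: "Ds \<in> lists (tuples m E)" and D: "D \<in> tuples m E"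
  shows "rwf (endo At) m (length Ds) e \<Longrightarrow>
    fderiv (\<lambda>t. reval At e (displace Ks t D) Ds) (reval At (rdiff (length Ds) e) Ks (Ds @ [D])) 0"
proof (induction e)
  case (Cst A)
  then show ?case using fderiv_const by simp
next
  case (Var i)
  have len: "length D = m" using D by (simp add: tuples_def)
  have "fderiv (\<lambda>t. Ks ! i + t \<cdot> (D ! i)) (D ! i) 0"
    using Var line_openD(3)[OF W] tuples_nth[OF D] by (intro fderiv_line tangent_endo) auto
  then show ?case using Var len line_openD(2)[OF W] by (simp add: nth_displace)
next
  case (Dir j i)
  then have "Ds ! j \<in> tuples m E" using Ds nth_mem[of j Ds] by auto
  then have "Ds ! j ! i \<in> endo At" using tuples_nth Dir tangent_endo by auto
  then show ?case using fderiv_const by simp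
next
  case Pinv
  have len: "length D = m" using D by (simp add: tuples_def)
  have m: "0 < m" "length Ks = m" using line_openD[OF W] by auto
  have line: "fderiv (\<lambda>t. Ks ! 0 + t \<cdot> (D ! 0)) (D ! 0) 0"
    using m line_openD(3)[OF W] tuples_nth[OF D] by (intro fderiv_line tangent_endo) auto
  from fderiv_P[OF line] line_openD(4)[OF W]
  have "fderiv (\<lambda>t. P (Ks ! 0 + t \<cdot> (D ! 0)))
      (P (Ks ! 0) \<odot> (D ! 0 \<odot> Ks ! 0 + Ks ! 0 \<odot> D ! 0) \<odot> P (Ks ! 0)) 0" by simp
  then show ?case using m len by (simp add: nth_displace)
next
  case (Add a b)
  then show ?case by (simp add: fderiv_add)
next
  case (Mul a b)
  have 0: "displace Ks 0 D = Ks" using D line_openD(2)[OF W] by (simp add: tuples_def displace_0)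
  have wf: "rwf (endo At) m (length Ds) a" "rwf (endo At) m (length Ds) b" using Mul.prems by auto
  show ?case
    using fderiv_fcomp[OF Mul.IH(1)[OF wf(1)] Mul.IH(2)[OF wf(2)]]
    by (simp add: 0 reval_append[OF wf(1)] reval_append[OF wf(2)])
qed

text \<open>The list \<open>env\<close> holds the directions already processed. \<open>F\<close> is
  linked to the expression only on \<open>W\<close>, since each step of the induction replaces
  \<open>F\<close> by its directional derivative, which is known only there. Membership in
  \<open>E\<close> is carried along because it passes to derivatives.\<close>

lemma iter_dderiv_reval:
  assumes W: "line_open m W"
  shows "rwf (endo At) m (length env) e \<Longrightarrow> env \<in> lists (tuples m E) \<Longrightarrow> Ds \<in> lists (tuples m E) \<Longrightarrow>
    (\<And>Ks. Ks \<in> W \<Longrightarrow> F Ks = reval At e Ks env \<and> F Ks \<in> E) \<Longrightarrow> Ks \<in> W \<Longrightarrow>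
    iter_dderiv At Ds F Ks = reval At (riter (length env) (length Ds) e) Ks (env @ Ds) \<and> iter_dderiv At Ds F Ks \<in> E"
proof (induction Ds arbitrary: env e F Ks)
  case Nil
  show ?case
    unfolding iter_dderiv.simps riter.simps list.size append_Nil2 by (rule Nil.prems(4)[OF Nil.prems(5)])
next
  case (Cons D Ds)
  have D: "D \<in> tuples m E" and Ds: "Ds \<in> lists (tuples m E)" using Cons.prems(3) by auto
  let ?F = "\<lambda>Ks. curve_deriv At (\<lambda>t. F (displace Ks t D)) 0"
  have step: "?F Ks = reval At (rdiff (length env) e) Ks (env @ [D]) \<and> ?F Ks \<in> E" if Ks: "Ks \<in> W" for Ks
  proof -
    note ev = line_openD(5)[OF W Ks D]
    have "fderiv (\<lambda>t. F (displace Ks t D)) (reval At (rdiff (length env) e) Ks (env @ [D])) 0"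
      by (rule fderiv_cong[OF _ fderiv_reval[OF W Ks Cons.prems(2) D Cons.prems(1)]])
        (rule eventually_mono[OF ev], use Cons.prems(4) in simp)
    then have der: "has_curve_deriv At (\<lambda>t. F (displace Ks t D)) (reval At (rdiff (length env) e) Ks (env @ [D])) 0"
      by (rule fderivD)
    moreover have "\<forall>\<^sub>F t in nhds 0. F (displace Ks t D) \<in> E"
      by (rule eventually_mono[OF ev]) (use Cons.prems(4) in blast)
    ultimately show ?thesis using curve_deriv_eq[OF der] tangent_limit by simp
  qed
  have "rwf (endo At) m (length (env @ [D])) (rdiff (length env) e)"
    using rwf_rdiff[OF endo_0 Cons.prems(1)] by simp
  from Cons.IH[OF this _ Ds step Cons.prems(5)] Cons.prems(2) D show ?case by auto
qed

lemma conv_reval: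
  assumes Ks: "\<And>i. i < m \<Longrightarrow> conv (\<lambda>k. Ksq k ! i) (Ks ! i) \<F>" and K0: "Ks ! 0 \<in> V"
    and Ds: "\<And>j i. j < l \<Longrightarrow> i < m \<Longrightarrow> conv (\<lambda>k. Dsq k ! j ! i) (Ds ! j ! i) \<F>"
  shows "rwf (endo At) m l e \<Longrightarrow> conv (\<lambda>k. reval At e (Ksq k) (Dsq k)) (reval At e Ks Ds) \<F>"
proof (induction e)
  case Pinv
  then have "conv (\<lambda>k. Ksq k ! 0) (Ks ! 0) \<F>" using Ks by simp
  then have "conv (\<lambda>k. finv At (fid At - Ksq k ! 0 \<odot> Ksq k ! 0)) (P (Ks ! 0)) \<F>"
    by (intro conv_finv conv_diff conv_const endo_fid conv_fcomp V_iso_square K0)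
  then show ?case by simp
qed (simp_all add: Ks Ds conv_const conv_add conv_fcomp)

lemma smooth_map_reval:
  assumes W: "line_open m W" and wf: "rwf (endo At) m 0 e"
    and F: "\<And>Ks. Ks \<in> W \<Longrightarrow> F Ks = reval At e Ks [] \<and> F Ks \<in> E"
  shows "smooth_map At E m W F"
  unfolding smooth_map_def
proof (intro conjI ballI allI impI)
  fix Ks assume "Ks \<in> W"
  from F[OF this] show "F Ks \<in> E" by (rule conjunct2)
next
  fix Ds D Ks assume Ds: "Ds \<in> lists (tuples m E)" and D: "D \<in> tuples m E" and Ks: "Ks \<in> W"
  let ?e = "riter 0 (length Ds) e"
  have eq: "iter_dderiv At Ds F Ks = reval At ?e Ks Ds \<and> iter_dderiv At Ds F Ks \<in> E" if "Ks \<in> W" for Ks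
    using iter_dderiv_reval[OF W _ _ Ds F that] wf by auto
  note ev = line_openD(5)[OF W Ks D]
  have wf': "rwf (endo At) m (length Ds) ?e" using rwf_riter[OF endo_0 wf] by simp
  have "fderiv (\<lambda>t. iter_dderiv At Ds F (displace Ks t D)) (reval At (rdiff (length Ds) ?e) Ks (Ds @ [D])) 0"
    by (rule fderiv_cong[OF _ fderiv_reval[OF W Ks Ds D wf']]) (rule eventually_mono[OF ev], use eq in simp)
  then have der: "has_curve_deriv At (\<lambda>t. iter_dderiv At Ds F (displace Ks t D)) (reval At (rdiff (length Ds) ?e) Ks (Ds @ [D])) 0"
    by (rule fderivD)
  moreover have "\<forall>\<^sub>F t in nhds 0. iter_dderiv At Ds F (displace Ks t D) \<in> E"
    by (rule eventually_mono[OF ev]) (use eq in blast)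
  ultimately show "\<exists>L\<in>E. has_curve_deriv At (\<lambda>t. iter_dderiv At Ds F (displace Ks t D)) L 0"
    using tangent_limit by blast
next
  fix Ksq Ks Dsq Ds
  assume asm: "Ks \<in> W \<and> Ds \<in> lists (tuples m E) \<and>
        (\<forall>k. Ksq k \<in> W \<and> Dsq k \<in> lists (tuples m E) \<and> length (Dsq k) = length Ds) \<and>
        (\<forall>i<m. Cinf_tendsto At (\<lambda>k. Ksq k ! i) (Ks ! i) sequentially) \<and>
        (\<forall>j<length Ds. \<forall>i<m. Cinf_tendsto At (\<lambda>k. Dsq k ! j ! i) (Ds ! j ! i) sequentially)"
  let ?e = "riter 0 (length Ds) e"
  have eq: "iter_dderiv At Ds' F Ks' = reval At ?e Ks' Ds'"
    if "Ks' \<in> W" "Ds' \<in> lists (tuples m E)" "length Ds' = length Ds" for Ds' Ks'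
    using iter_dderiv_reval[OF W _ _ that(2) F that(1)] wf that(3) by auto
  have wf': "rwf (endo At) m (length Ds) ?e" using rwf_riter[OF endo_0 wf] by simp
  have dir: "Ds' ! j ! i \<in> endo At" if "Ds' \<in> lists (tuples m E)" "j < length Ds'" "i < m" for Ds' i j
  proof (rule tangent_endo, rule tuples_nth[OF _ that(3)])
    show "Ds' ! j \<in> tuples m E" using that(1) nth_mem[OF that(2)] by auto
  qed
  have "conv (\<lambda>k. reval At ?e (Ksq k) (Dsq k)) (reval At ?e Ks Ds) sequentially"
  proof (rule conv_reval[OF _ _ _ wf'])
    show "conv (\<lambda>k. Ksq k ! i) (Ks ! i) sequentially" if "i < m" for i
      unfolding conv_def using asm that line_openD(3)[OF W] tangent_endo by auto
    show "Ks ! 0 \<in> V" using asm line_openD(4)[OF W] by auto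
    show "conv (\<lambda>k. Dsq k ! j ! i) (Ds ! j ! i) sequentially" if "j < length Ds" "i < m" for i j
      unfolding conv_def using asm that dir by auto
  qed
  then show "Cinf_tendsto At (\<lambda>k. iter_dderiv At (Dsq k) F (Ksq k)) (iter_dderiv At Ds F Ks) sequentially"
    using asm eq by (simp add: conv_def)
qed

lemma line_open_1: "line_open 1 {[K] | K. K \<in> V}"
  unfolding line_open_def
proof (intro conjI ballI)
  fix Ks D assume "Ks \<in> {[K] | K. K \<in> V}" "D \<in> tuples 1 E"
  then obtain K A where KA: "Ks = [K]" "K \<in> V" "D = [A]" "A \<in> E"
    by (auto simp: tuples_def length_Suc_conv)
  then show "\<forall>\<^sub>F t in nhds 0. displace Ks t D \<in> {[K] | K. K \<in> V}"
    using eventually_V_line[of K A] by (simp add: displace_def)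
qed (auto simp: V_tangent)

lemma line_open_3: "line_open 3 {[K, A, B] | K A B. K \<in> V \<and> A \<in> E \<and> B \<in> E}"
  unfolding line_open_def
proof (intro conjI ballI)
  fix Ks D assume "Ks \<in> {[K, A, B] | K A B. K \<in> V \<and> A \<in> E \<and> B \<in> E}" "D \<in> tuples 3 E"
  then obtain K A B X Y Z where *: "Ks = [K, A, B]" "K \<in> V" "A \<in> E" "B \<in> E"
    "D = [X, Y, Z]" "X \<in> E" "Y \<in> E" "Z \<in> E"
    by (auto simp: tuples_def length_Suc_conv numeral_3_eq_3)
  from eventually_V_line[OF *(2,6)]
  show "\<forall>\<^sub>F t in nhds 0. displace Ks t D \<in> {[K, A, B] | K A B. K \<in> V \<and> A \<in> E \<and> B \<in> E}"
    by eventually_elim (use * in \<open>simp add: displace_def tangent_add tangent_fscale\<close>)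
qed (auto simp: V_tangent)

section \<open>Smooth vector fields and smoothness of the connection\<close>

lemma smooth_vfield_const: "A \<in> E \<Longrightarrow> smooth_vfield At J0 (\<lambda>_. A)"
  unfolding smooth_vfield_def
  by (rule smooth_map_reval[OF line_open_1, of "Cst A"]) (simp_all add: tangent_endo)

lemma smooth_vfield_tangent: "smooth_vfield At J0 X \<Longrightarrow> K \<in> V \<Longrightarrow> X K \<in> E"
  unfolding smooth_vfield_def smooth_map_def by force

lemma smooth_vfield_fderiv:
  assumes X: "smooth_vfield At J0 X" and K: "K \<in> V" and A: "A \<in> E"
  shows "fderiv (\<lambda>t. X (K + t \<cdot> A)) (dderiv At X K A) 0" and "dderiv At X K A \<in> E"
proof -
  have "[A] \<in> tuples 1 E" using A by (simp add: tuples_def)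
  then obtain L where "L \<in> E" and L: "has_curve_deriv At (\<lambda>t. iter_dderiv At [] (\<lambda>Ks. X (Ks ! 0)) (displace [K] t [A])) L 0"
    using X K unfolding smooth_vfield_def smooth_map_def by blast
  then have L: "has_curve_deriv At (\<lambda>t. X (K + t \<cdot> A)) L 0" by (simp add: displace_def)
  then have "dderiv At X K A = L" unfolding dderiv_def by (rule curve_deriv_eq)
  moreover have "\<forall>\<^sub>F t in nhds 0. X (K + t \<cdot> A) \<in> endo At"
    using eventually_V_line[OF K A] by eventually_elim (simp add: smooth_vfield_tangent[OF X] tangent_endo)
  ultimately show "fderiv (\<lambda>t. X (K + t \<cdot> A)) (dderiv At X K A) 0" "dderiv At X K A \<in> E"
    using L \<open>L \<in> E\<close> by (simp_all add: fderiv_def)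
qed

lemma connection_Gam: "connection At J0 Gam"
  unfolding connection_def
proof (intro conjI ballI allI)
  let ?e = "Add (Mul (Mul (Mul (Var 1) (Var 0)) Pinv) (Var 2)) (Mul (Mul (Mul (Var 2) (Var 0)) Pinv) (Var 1))"
  show "smooth_map At E 3 {[K, A, B] | K A B. K \<in> V \<and> A \<in> E \<and> B \<in> E} (\<lambda>Ks. Gam (Ks ! 0) (Ks ! 1) (Ks ! 2))"
    by (rule smooth_map_reval[OF line_open_3, of ?e]) (auto simp: Gam_def intro: Gam_tangent[unfolded Gam_def])
qed (simp_all add: Gam_def fcomp_simps)

section \<open>Geodesics\<close>

text \<open>Twice the hyperbolic cosine and sine of \<open>(t / 2) \<cdot> A\<close>; the factors 2
  cancel in the quotient.\<close>

abbreviation "Ch A t \<equiv> fexp At ((t / 2) \<cdot> A) + fexp At (- ((t / 2) \<cdot> A))"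
abbreviation "Sh A t \<equiv> fexp At ((t / 2) \<cdot> A) - fexp At (- ((t / 2) \<cdot> A))"

lemma fderiv_Ch_Sh:
  assumes A: "A \<in> endo At"
  shows "fderiv (Ch A) (Sh A t \<odot> ((1 / 2) \<cdot> A)) t" "fderiv (Sh A) (Ch A t \<odot> ((1 / 2) \<cdot> A)) t"
proof -
  let ?B = "(1 / 2) \<cdot> A"
  have minus: "(- r) \<cdot> A = - (r \<cdot> A)" for r by (simp add: fun_eq_iff field_apply)
  have p: "fderiv (\<lambda>t. fexp At ((t / 2) \<cdot> A)) (fexp At ((t / 2) \<cdot> A) \<odot> ?B) t"
    using fderiv_fexp[OF endo_fscale[OF A], of "1 / 2" t] by simp
  have m: "fderiv (\<lambda>t. fexp At (- ((t / 2) \<cdot> A))) (fexp At (- ((t / 2) \<cdot> A)) \<odot> (- ?B)) t"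
    using fderiv_fexp[OF endo_fscale[OF A], of "- (1 / 2)" t] by (simp add: minus fcomp_simps(14))
  show "fderiv (Ch A) (Sh A t \<odot> ?B) t" using fderiv_add[OF p m] by (simp add: fcomp_simps)
  show "fderiv (Sh A) (Ch A t \<odot> ?B) t" using fderiv_diff[OF p m] by (simp add: fcomp_simps)
qed

abbreviation "tanh_dom A \<equiv> {t. ftanh_defined At ((t / 2) \<cdot> A)}"
abbreviation "tanh_curve A t \<equiv> ftanh At ((t / 2) \<cdot> A)"

lemma tanh_curve_mat:
  assumes A: "A \<in> E" and t: "t \<in> tanh_dom A" and c: "c \<in> At" "p \<in> fst c"
  defines "a \<equiv> (t / 2) *\<^sub>R A c p"
  shows "tanh_curve A t c p = matrix_inv (mexp a + mexp (- a)) ** (mexp a - mexp (- a))"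
    and "invertible (mexp a + mexp (- a))"
  using t c by (auto simp: ftanh_defined_def is_iso_def ftanh_def field_apply a_def)

lemma tanh_curve_endo: "A \<in> E \<Longrightarrow> t \<in> tanh_dom A \<Longrightarrow> tanh_curve A t \<in> endo At"
  unfolding ftanh_def ftanh_defined_def
  by (intro endo_fcomp endo_finv endo_add endo_diff endo_fexp endo_minus endo_fscale tangent_endo) auto

text \<open>\<open>J0\<close> exchanges the exponentials of \<open>a\<close> and \<open>- a\<close>,
  so it commutes with their sum and anticommutes with their difference, hence with the quotient.
  Moreover \<open>1 - tanh a\<close> is \<open>2 (exp a + exp (- a))^-1 exp (- a)\<close>, a product
  of invertible matrices.\<close>

lemma tanh_curve_V:
  assumes A: "A \<in> E" and t: "t \<in> tanh_dom A"
  shows "tanh_curve A t \<in> V"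
proof -
  have *: "J0 c p ** tanh_curve A t c p = - (tanh_curve A t c p ** J0 c p) \<and> invertible (mat 1 - tanh_curve A t c p)"
    if c: "c \<in> At" "p \<in> fst c" for c p
  proof -
    let ?a = "(t / 2) *\<^sub>R A c p" and ?J = "J0 c p"
    let ?ci = "matrix_inv (mexp ?a + mexp (- ?a))"
    note ta = tanh_curve_mat[OF A t c]
    have J1: "mexp (- ?a) ** ?J = ?J ** mexp ?a" and J2: "mexp ?a ** ?J = ?J ** mexp (- ?a)"
      by (rule mexp_intertwine; simp add: mm_simps tangent_mat[OF A])+
    have "?ci ** ?J = ?J ** ?ci"
      by (rule matrix_inv_commute[OF ta(2)]) (simp add: mm_simps J1 J2)
    then have ciJ: "?J ** (?ci ** X) = ?ci ** (?J ** X)" for X :: "real^'b^'b" by (simp add: matrix_mul_assoc)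
    have "?J ** tanh_curve A t c p = - (tanh_curve A t c p ** ?J)"
      unfolding ta(1) by (simp add: ciJ mm_simps J1 J2)
    moreover have "invertible (mat 1 - tanh_curve A t c p)"
    proof -
      have "mat 1 - tanh_curve A t c p = ?ci ** (mexp ?a + mexp (- ?a)) - ?ci ** (mexp ?a - mexp (- ?a))"
        unfolding ta(1) by (simp add: matrix_inv_mul[OF ta(2)])
      also have "\<dots> = ?ci ** (2 *\<^sub>R mexp (- ?a))"
        by (simp add: mm_simps numeral_mult_eq_scaleR)
      finally have eq: "mat 1 - tanh_curve A t c p = ?ci ** (2 *\<^sub>R mexp (- ?a))" .
      have "(2 *\<^sub>R mexp (- ?a)) ** ((1 / 2) *\<^sub>R mexp ?a) = mat 1"
        using mexp_inverse[of "- ?a"] by (simp add: mm_simps)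
      then have "invertible (2 *\<^sub>R mexp (- ?a))" by (rule invertibleI)
      then show ?thesis unfolding eq by (intro invertible_mult invertible_matrix_inv ta(2))
    qed
    ultimately show ?thesis by blast
  qed
  have "tanh_curve A t \<in> E" by (rule tangentI[OF tanh_curve_endo[OF A t]]) (use * in blast)
  moreover have "is_iso At (fid At - tanh_curve A t)" using * by (simp add: is_iso_def field_apply)
  ultimately show ?thesis by (simp add: dom_V_def)
qed

lemma tanh_curve_0: "0 \<in> tanh_dom A" "A \<in> E \<Longrightarrow> tanh_curve A 0 = 0"
proof -
  show 0: "0 \<in> tanh_dom A"
  proof -
    have "(mat 1 + mat 1) ** ((1 / 2) *\<^sub>R mat 1) = (mat 1 :: real^'b^'b)"
      by (simp add: mm_simps numeral_mult_eq_scaleR)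
    from invertibleI(1)[OF this] show ?thesis
      by (simp add: ftanh_defined_def is_iso_def field_apply)
  qed
  assume A: "A \<in> E"
  show "tanh_curve A 0 = 0"
  proof (rule field_eqI[OF tanh_curve_endo[OF A 0] endo_0])
    fix c p assume c: "c \<in> At" "p \<in> fst c"
    show "tanh_curve A 0 c p = 0 c p"
      unfolding tanh_curve_mat(1)[OF A 0 c] by (simp add: field_apply mm.zero_right)
  qed
qed

lemma open_tanh_dom:
  assumes A: "A \<in> E"
  shows "open (tanh_dom A)"
  unfolding open_subopen[of "tanh_dom A"]
proof
  fix t assume "t \<in> tanh_dom A"
  then have "is_iso At (Ch A t)" by (simp add: ftanh_defined_def)
  from fderiv_eventually_is_iso[OF fderiv_Ch_Sh(1)[OF tangent_endo[OF A]] this]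
  show "\<exists>T. open T \<and> t \<in> T \<and> T \<subseteq> tanh_dom A"
    by (auto simp: eventually_nhds ftanh_defined_def)
qed

text \<open>The equation \<open>tanh' = 1 - tanh^2\<close> with inner derivative
  \<open>(1 / 2) \<cdot> A\<close>. Stated through the curve itself, the velocity can be
  differentiated again by the product rule.\<close>

abbreviation "tanh_vel A t \<equiv> (1 / 2) \<cdot> A - (1 / 2) \<cdot> A \<odot> (tanh_curve A t \<odot> tanh_curve A t)"

lemma tanh_commute:
  assumes A: "A \<in> E" and t: "t \<in> tanh_dom A" and c: "c \<in> At" "p \<in> fst c"
  shows "tanh_curve A t c p ** A c p = A c p ** tanh_curve A t c p"
proof -
  let ?a = "(t / 2) *\<^sub>R A c p"
  note ta = tanh_curve_mat[OF A t c]
  have e: "mexp ?a ** A c p = A c p ** mexp ?a" "mexp (- ?a) ** A c p = A c p ** mexp (- ?a)"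
    by (rule mexp_intertwine; simp add: mm_simps)+
  have "matrix_inv (mexp ?a + mexp (- ?a)) ** A c p = A c p ** matrix_inv (mexp ?a + mexp (- ?a))"
    by (rule matrix_inv_commute[OF ta(2)]) (simp add: mm_simps e)
  then have "matrix_inv (mexp ?a + mexp (- ?a)) ** (A c p ** X) = A c p ** (matrix_inv (mexp ?a + mexp (- ?a)) ** X)"
    for X :: "real^'b^'b" by (simp add: matrix_mul_assoc)
  then show ?thesis unfolding ta(1) by (simp add: mm_simps e)
qed

lemma fderiv_tanh_curve:
  assumes A: "A \<in> E" and t: "t \<in> tanh_dom A"
  shows "fderiv (tanh_curve A) (tanh_vel A t) t"
proof -
  note Aen = tangent_endo[OF A]
  have iso: "is_iso At (Ch A t)" using t by (simp add: ftanh_defined_def)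
  note d = fderiv_Ch_Sh[OF Aen, of t]
  have en: "Ch A t \<in> endo At" "Sh A t \<in> endo At" "finv At (Ch A t) \<in> endo At"
    using fderivD(2)[OF d(1)] fderivD(2)[OF d(2)] endo_finv[OF _ iso] by auto
  let ?L = "- (finv At (Ch A t) \<odot> (Sh A t \<odot> ((1 / 2) \<cdot> A)) \<odot> finv At (Ch A t)) \<odot> Sh A t + finv At (Ch A t) \<odot> (Ch A t \<odot> ((1 / 2) \<cdot> A))"
  have "fderiv (\<lambda>s. finv At (Ch A s) \<odot> Sh A s) ?L t"
    by (rule fderiv_fcomp[OF fderiv_finv[OF d(1) iso] d(2)])
  moreover have "?L = tanh_vel A t"
  proof (rule field_eqI)
    show "?L \<in> endo At" by (intro endo_add endo_minus endo_fcomp endo_fscale en Aen)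
    show "tanh_vel A t \<in> endo At" by (intro endo_diff endo_fcomp endo_fscale Aen tanh_curve_endo[OF A t])
    fix c p assume c: "c \<in> At" "p \<in> fst c"
    let ?a = "(t / 2) *\<^sub>R A c p" and ?g = "tanh_curve A t c p"
    let ?ci = "matrix_inv (mexp ?a + mexp (- ?a))"
    note ta = tanh_curve_mat[OF A t c] and com = tanh_commute[OF A t c]
    have e: "mexp ?a ** A c p = A c p ** mexp ?a" "mexp (- ?a) ** A c p = A c p ** mexp (- ?a)"
      by (rule mexp_intertwine; simp add: mm_simps)+
    have ci: "?ci ** A c p = A c p ** ?ci"
      by (rule matrix_inv_commute[OF ta(2)]) (simp add: mm_simps e)
    have "?L c p = - (?ci ** ((mexp ?a - mexp (- ?a)) ** ((1 / 2) *\<^sub>R A c p)) ** ?ci) ** (mexp ?a - mexp (- ?a))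
        + ?ci ** ((mexp ?a + mexp (- ?a)) ** ((1 / 2) *\<^sub>R A c p))"
      using c by (simp add: field_apply)
    also have "?ci ** ((mexp ?a + mexp (- ?a)) ** ((1 / 2) *\<^sub>R A c p)) = (1 / 2) *\<^sub>R A c p"
      by (rule matrix_inv_mul_assoc[OF ta(2)])
    also have "- (?ci ** ((mexp ?a - mexp (- ?a)) ** ((1 / 2) *\<^sub>R A c p)) ** ?ci) ** (mexp ?a - mexp (- ?a))
        = - ((1 / 2) *\<^sub>R ((?ci ** (mexp ?a - mexp (- ?a))) ** A c p ** (?ci ** (mexp ?a - mexp (- ?a)))))"
      by (simp only: mm.scaleR_left mm.scaleR_right mm.minus_left mm_assoc)
    also have "\<dots> = - ((1 / 2) *\<^sub>R (?g ** A c p ** ?g))" by (simp only: ta(1))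
    also have "\<dots> = - ((1 / 2) *\<^sub>R (A c p ** ?g ** ?g))" by (simp only: com)
    finally have L: "?L c p = - ((1 / 2) *\<^sub>R (A c p ** ?g ** ?g)) + (1 / 2) *\<^sub>R A c p" .
    show "?L c p = tanh_vel A t c p" unfolding L by (simp add: field_apply mm_simps)
  qed
  ultimately show ?thesis by (simp add: ftanh_def[abs_def])
qed

text \<open>With \<open>B = A/2\<close>, which commutes with \<open>K\<close>, the velocity is
  \<open>B (1 - K^2)\<close> and the second derivative is \<open>- B (K' K + K K')\<close>. The
  inverse inside the Christoffel map cancels the factor \<open>1 - K^2\<close> of one velocity,
  which leaves the same expression.\<close>

lemma geodesic_tanh_curve:
  assumes \<Gamma>: "\<And>K A B. K \<in> V \<Longrightarrow> A \<in> E \<Longrightarrow> B \<in> E \<Longrightarrow> \<Gamma> K A B = Gam K A B" and A: "A \<in> E"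
  shows "geodesic_on At J0 \<Gamma> (tanh_dom A) (tanh_curve A)"
  unfolding geodesic_on_def
proof (intro conjI exI[of _ "tanh_vel A"] ballI)
  show "open (tanh_dom A)" by (rule open_tanh_dom[OF A])
  fix t assume t: "t \<in> tanh_dom A"
  note g = fderiv_tanh_curve[OF A t]
  show V: "tanh_curve A t \<in> V" by (rule tanh_curve_V[OF A t])
  show "has_curve_deriv At (tanh_curve A) (tanh_vel A t) t" by (rule fderivD(4)[OF g])
  have "\<forall>\<^sub>F s in nhds t. tanh_curve A s \<in> E"
    using eventually_nhds_in_open[OF open_tanh_dom[OF A] t] tanh_curve_V[OF A] V_tangent by (auto elim: eventually_mono)
  then have vel: "tanh_vel A t \<in> E" by (rule tangent_limit[OF fderivD(4)[OF g]])
  note Ben = endo_fscale[OF tangent_endo[OF A], of "1 / 2"]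
  let ?L = "0 - (0 \<odot> (tanh_curve A t \<odot> tanh_curve A t) + (1 / 2) \<cdot> A \<odot> (tanh_vel A t \<odot> tanh_curve A t + tanh_curve A t \<odot> tanh_vel A t))"
  have "fderiv (tanh_vel A) ?L t"
    by (intro fderiv_diff fderiv_const fderiv_fcomp[OF fderiv_const fderiv_fcomp[OF g g]] Ben)
  moreover have "?L = - \<Gamma> (tanh_curve A t) (tanh_vel A t) (tanh_vel A t)"
  proof (rule field_eqI)
    show "?L \<in> endo At"
      by (intro endo_diff endo_add endo_fcomp endo_0 Ben tangent_endo[OF vel] V_endo[OF V])
    show "- \<Gamma> (tanh_curve A t) (tanh_vel A t) (tanh_vel A t) \<in> endo At"
      unfolding \<Gamma>[OF V vel vel] by (intro endo_minus tangent_endo Gam_tangent V vel)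
    fix c p assume c: "c \<in> At" "p \<in> fst c"
    let ?g = "tanh_curve A t c p" and ?b = "(1 / 2) *\<^sub>R A c p" and ?v = "tanh_vel A t c p"
    let ?q = "matrix_inv (mat 1 - ?g ** ?g)"
    note m = V_mat[OF V c]
    have gb: "?g ** ?b = ?b ** ?g" by (simp add: mm_simps tanh_commute[OF A t c])
    have v1: "?v = ?b - ?b ** (?g ** ?g)" by (simp add: field_apply mm_simps)
    have gbX: "?g ** (?b ** X) = ?b ** (?g ** X)" for X :: "real^'b^'b"
      by (simp only: matrix_mul_assoc gb)
    have v2: "?v = ?b ** (mat 1 - ?g ** ?g)" "?v = (mat 1 - ?g ** ?g) ** ?b"
      unfolding v1 by (simp_all add: mm.diff_left mm.diff_right mm_assoc gb gbX)
    have gv: "?g ** ?v = ?v ** ?g"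
      unfolding v1 by (simp add: mm.diff_left mm.diff_right mm_assoc gb gbX)
    \<comment> \<open>Only the right velocity is replaced by \<open>(1 - g^2) b\<close>, the form in
      which \<open>?q\<close> meets its inverse.\<close>
    have "?v ** ?g ** ?q ** ?v = ?v ** ?g ** (?q ** ((mat 1 - ?g ** ?g) ** ?b))"
      by (simp only: mm_assoc v2(2)[symmetric])
    also have "\<dots> = ?v ** ?g ** ?b" by (simp only: matrix_inv_mul_assoc[OF invertible_one_minus_square[OF m]])
    also have "\<dots> = ?b ** (?v ** ?g)"
      unfolding v1 by (simp add: mm.diff_left mm.diff_right mm_assoc gb gbX)
    finally have "?v ** ?g ** ?q ** ?v = ?b ** (?v ** ?g)" .
    then have "- \<Gamma> (tanh_curve A t) (tanh_vel A t) (tanh_vel A t) c p = - (?b ** (?v ** ?g) + ?b ** (?v ** ?g))"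
      unfolding \<Gamma>[OF V vel vel] Gam_def using c by (simp add: field_apply del: mm.diff_left)
    moreover have "?L c p = - (?b ** (?v ** ?g + ?g ** ?v))"
      by (simp add: field_apply mm.zero_left)
    ultimately show "?L c p = (- \<Gamma> (tanh_curve A t) (tanh_vel A t) (tanh_vel A t)) c p"
      by (simp only: gv mm.add_right uminus_apply)
  qed
  ultimately show "has_curve_deriv At (tanh_vel A) (- \<Gamma> (tanh_curve A t) (tanh_vel A t) (tanh_vel A t)) t"
    using fderivD(4) by simp
qed

text \<open>In a Frechet space the geodesic equation cannot be handed to a general uniqueness
  theorem. Evaluated at a point of a chart it is an equation for matrices, whose solution on an
  interval is explicit; the same computation shows that the denominator is invertible there, so both
  conclusions hold at every point of the manifold.\<close>

lemma geodesic_unique: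
  assumes \<Gamma>: "\<And>K A B. K \<in> V \<Longrightarrow> A \<in> E \<Longrightarrow> B \<in> E \<Longrightarrow> \<Gamma> K A B = Gam K A B" and A: "A \<in> E"
    and I: "is_interval I" "0 \<in> I" and geo: "geodesic_on At J0 \<Gamma> I \<gamma>" and "\<gamma> 0 = 0"
    and init: "has_curve_deriv At \<gamma> ((1 / 2) \<cdot> A) 0" and t: "t \<in> I"
  shows "t \<in> tanh_dom A" "\<gamma> t = tanh_curve A t"
proof -
  obtain v where openI: "open I" and v: "\<And>t. t \<in> I \<Longrightarrow> \<gamma> t \<in> V"
    "\<And>t. t \<in> I \<Longrightarrow> has_curve_deriv At \<gamma> (v t) t"
    "\<And>t. t \<in> I \<Longrightarrow> has_curve_deriv At v (- \<Gamma> (\<gamma> t) (v t) (v t)) t"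
    using geo unfolding geodesic_on_def by blast
  have v0: "v 0 = (1 / 2) \<cdot> A" by (rule has_curve_deriv_unique[OF v(2)[OF I(2)] init])
  have vE: "v s \<in> E" if s: "s \<in> I" for s
    by (rule tangent_limit[OF v(2)[OF s]])
      (use eventually_nhds_in_open[OF openI s] v(1) V_tangent in \<open>auto elim: eventually_mono\<close>)
  have mat: "invertible (mexp ((t / 2) *\<^sub>R A c p) + mexp (- ((t / 2) *\<^sub>R A c p)))"
    "\<gamma> t c p = matrix_inv (mexp ((t / 2) *\<^sub>R A c p) + mexp (- ((t / 2) *\<^sub>R A c p))) ** (mexp ((t / 2) *\<^sub>R A c p) - mexp (- ((t / 2) *\<^sub>R A c p)))"
    if c: "c \<in> At" "p \<in> fst c" for c p
  proof -
    have k: "((\<lambda>s. \<gamma> s c p) has_vector_derivative v s c p) (at s)" if "s \<in> I" for s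
      by (rule has_curve_deriv_pointwise[OF v(2)[OF that] c])
    have w: "((\<lambda>s. v s c p) has_vector_derivative
        - (2 *\<^sub>R (v s c p ** \<gamma> s c p ** matrix_inv (mat 1 - \<gamma> s c p ** \<gamma> s c p) ** v s c p))) (at s)"
      if s: "s \<in> I" for s
    proof -
      have "(- \<Gamma> (\<gamma> s) (v s) (v s)) c p = - (2 *\<^sub>R (v s c p ** \<gamma> s c p ** matrix_inv (mat 1 - \<gamma> s c p ** \<gamma> s c p) ** v s c p))"
        unfolding \<Gamma>[OF v(1)[OF s] vE[OF s] vE[OF s]] Gam_def using c
        by (simp add: field_apply numeral_mult_eq_scaleR)
      with has_curve_deriv_pointwise[OF v(3)[OF s] c] show ?thesis by simp
    qed
    have k0: "\<gamma> 0 c p = 0" using \<open>\<gamma> 0 = 0\<close> by (simp add: field_apply)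
    note sol = geodesic_matrix_solution[OF is_interval_convex[OF I(1)] openI I(2) t, of "\<lambda>s. \<gamma> s c p" "\<lambda>s. v s c p",
        OF k w V_mat(3)[OF v(1) c] invertible_one_plus_k[OF V_mat[OF v(1) c]] k0]
    have "t *\<^sub>R v 0 c p = (t / 2) *\<^sub>R A c p" by (simp add: v0 field_apply)
    with sol show "invertible (mexp ((t / 2) *\<^sub>R A c p) + mexp (- ((t / 2) *\<^sub>R A c p)))"
      "\<gamma> t c p = matrix_inv (mexp ((t / 2) *\<^sub>R A c p) + mexp (- ((t / 2) *\<^sub>R A c p))) ** (mexp ((t / 2) *\<^sub>R A c p) - mexp (- ((t / 2) *\<^sub>R A c p)))"
      by simp_all
  qed
  show dom: "t \<in> tanh_dom A"
    using mat(1) by (simp add: ftanh_defined_def is_iso_def field_apply)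
  show "\<gamma> t = tanh_curve A t"
    by (rule field_eqI[OF V_endo[OF v(1)[OF t]] tanh_curve_endo[OF A dom]])
      (simp only: mat(2) tanh_curve_mat(1)[OF A dom])
qed

end

section \<open>Positive definite matrices\<close>

lemma continuous_on_det:
  fixes f :: "'a::topological_space \<Rightarrow> real^'d^'d::finite"
  assumes "continuous_on S f"
  shows "continuous_on S (\<lambda>x. det (f x))"
  unfolding det_def by (intro continuous_intros assms)

lemma trace_scaleR: "trace (r *\<^sub>R A) = r * trace A" for A :: "real^'d^'d::finite"
  by (simp add: trace_def sum_distrib_left)

lemma abs_trace_le: "\<bar>trace A\<bar> \<le> real CARD('d) * norm A" for A :: "real^'d^'d::finite"
proof -
  have "\<bar>A $ i $ i\<bar> \<le> norm A" for i
    by (rule order_trans[OF component_le_norm_cart Finite_Cartesian_Product.norm_nth_le])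
  then have "\<bar>trace A\<bar> \<le> (\<Sum>i\<in>(UNIV::'d set). norm A)"
    unfolding trace_def by (intro order_trans[OF sum_abs] sum_mono)
  then show ?thesis by simp
qed

definition pos_def :: "real^'d^'d::finite \<Rightarrow> bool" where
  "pos_def g \<longleftrightarrow> transpose g = g \<and> (\<forall>v. v \<noteq> 0 \<longrightarrow> 0 < v \<bullet> (g *v v))"

lemma pos_def_invertible: "pos_def g \<Longrightarrow> invertible g"
  unfolding invertible_iff_inj pos_def_def by (metis inner_zero_right less_irrefl)

text \<open>The segment from the unit matrix to \<open>g\<close> consists of positive definite,
  hence invertible, matrices. A determinant that is not positive at \<open>g\<close> would vanish
  somewhere on it by the intermediate value theorem.\<close>

lemma pos_def_det_pos:
  fixes g :: "real^'d^'d::finite"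
  assumes g: "pos_def g"
  shows "0 < det g"
proof (rule ccontr)
  assume "\<not> 0 < det g"
  define f where "f s = det ((1 - s) *\<^sub>R mat 1 + s *\<^sub>R g)" for s
  have "continuous_on {0..1} f"
    unfolding f_def by (intro continuous_on_det continuous_intros)
  moreover have "f 1 \<le> 0" "0 \<le> f 0" using \<open>\<not> 0 < det g\<close> by (simp_all add: f_def)
  ultimately obtain s where s: "0 \<le> s" "s \<le> 1" "f s = 0"
    using IVT2'[of f 1 0 0] by auto
  have "invertible ((1 - s) *\<^sub>R mat 1 + s *\<^sub>R g)"
    unfolding invertible_iff_inj
  proof (intro allI impI, rule ccontr)
    fix v assume v: "((1 - s) *\<^sub>R mat 1 + s *\<^sub>R g) *v v = 0" "v \<noteq> 0"
    have "0 = v \<bullet> (((1 - s) *\<^sub>R mat 1 + s *\<^sub>R g) *v v)" by (simp add: v)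
    also have "\<dots> = (1 - s) * (v \<bullet> v) + s * (v \<bullet> (g *v v))"
      by (simp add: matrix_vector_mult_add_rdistrib inner_add_right flip: scaleR_matrix_vector_assoc)
    also have "\<dots> > 0"
    proof (cases "s = 0")
      case False
      then have "0 < s * (v \<bullet> (g *v v))" using g v s by (simp add: pos_def_def)
      then show ?thesis using s by (intro add_nonneg_pos) auto
    qed (use v in simp)
    finally show False by simp
  qed
  then show False using s by (simp add: f_def invertible_det_nz)
qed

definition outer :: "real^'d \<Rightarrow> real^'d^'d::finite" where
  "outer u = (\<chi> i j. u $ i * u $ j)"

text \<open>A quadratic polynomial in \<open>s\<close>. It is used to see that pivots are
  nonnegative, to see that they do not vanish, and to complete the square.\<close>

lemma quad_axis:
  fixes M :: "real^'d^'d::finite"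
  assumes M: "transpose M = M"
  shows "(v + s *\<^sub>R axis i 1) \<bullet> (M *v (v + s *\<^sub>R axis i 1)) = v \<bullet> (M *v v) + 2 * s * (M *v v) $ i + s\<^sup>2 * M $ i $ i"
proof -
  have "v \<bullet> (M *v axis i 1) = (M *v v) $ i"
    using dot_lmul_matrix[of v M "axis i 1"] M
    by (metis cart_eq_inner_axis transpose_matrix_vector)
  moreover have "axis i 1 \<bullet> (M *v v) = (M *v v) $ i"
    by (metis cart_eq_inner_axis inner_commute)
  moreover have "axis i 1 \<bullet> (M *v axis i 1) = M $ i $ i"
    by (simp add: inner_commute[of "axis i 1"] cart_eq_inner_axis[symmetric] matrix_vector_mul_component inner_axis)
  ultimately show ?thesis
    by (simp add: matrix_vector_right_distrib matrix_vector_mult_scaleR inner_add_left inner_add_right power2_eq_square algebra_simps)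
qed

text \<open>Cholesky elimination: subtracting the scaled outer square of a row with positive pivot
  keeps the form nonnegative and kills that row, so induction on the number of nonzero rows applies.
  The decomposition serves to write traces against \<open>g\<close> as sums of values of quadratic
  forms.\<close>

lemma psd_sum_outer:
  fixes M :: "real^'d^'d::finite"
  shows "transpose M = M \<Longrightarrow> (\<And>v. 0 \<le> v \<bullet> (M *v v)) \<Longrightarrow> \<exists>us. M = (\<Sum>u\<leftarrow>us. outer u)"
proof (induction "card {i. M $ i \<noteq> 0}" arbitrary: M rule: less_induct)
  case less
  note sym = less.prems(1) and psd = less.prems(2)
  have symc: "M $ i $ j = M $ j $ i" for i j
    using sym by (metis transpose_def vec_lambda_beta)
  show ?case
  proof (cases "M = 0")
    case True
    then show ?thesis by (intro exI[of _ "[]"]) simp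
  next
    case False
    then obtain i j where ij: "M $ i $ j \<noteq> 0" by (auto simp: vec_eq_iff)
    have "M $ i $ i > 0"
    \<comment> \<open>With a vanishing pivot the form along \<open>v + s *\<^sub>R axis i 1\<close>
      is affine in \<open>s\<close> with slope \<open>2 * M $ i $ j\<close>, so it takes negative
      values.\<close>
    proof (rule ccontr)
      assume "\<not> M $ i $ i > 0"
      moreover have "0 \<le> M $ i $ i" using psd[of "0 + 1 *\<^sub>R axis i 1"] unfolding quad_axis[OF sym] by simp
      ultimately have ii: "M $ i $ i = 0" by simp
      define v where "v = axis j (1::real)"
      have Mv: "(M *v v) $ i = M $ i $ j" by (simp add: v_def matrix_vector_mul_component inner_axis)
      have "0 \<le> v \<bullet> (M *v v) + 2 * s * M $ i $ j" for s
        using psd[of "v + s *\<^sub>R axis i 1"] unfolding quad_axis[OF sym] ii Mv by simp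
      \<comment> \<open>For this value of \<open>s\<close> the affine function equals
        \<open>- 1\<close>.\<close>
      from this[of "- (v \<bullet> (M *v v) + 1) / (2 * M $ i $ j)"] show False using ij by (simp add: field_simps)
    qed
    define m where "m = M $ i $ i"
    have m: "m > 0" using \<open>M $ i $ i > 0\<close> by (simp add: m_def)
    define u where "u = (1 / sqrt m) *\<^sub>R M $ i"
    have u: "outer u $ j $ k = M $ i $ j * M $ i $ k / m" for j k
      using m by (simp add: outer_def u_def field_simps)
    define N where "N = M - outer u"
    have N: "N $ j $ k = M $ j $ k - M $ i $ j * M $ i $ k / m" for j k
      by (simp add: N_def u)
    have "transpose N = N" by (simp add: vec_eq_iff transpose_def N symc mult.commute)
    moreover have "0 \<le> v \<bullet> (N *v v)" for v
    proof -
      have "v \<bullet> (outer u *v v) = ((M *v v) $ i)\<^sup>2 / m"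
      proof -
        have "outer u *v v = (u \<bullet> v) *\<^sub>R u"
          by (simp add: vec_eq_iff matrix_vector_mult_def outer_def inner_vec_def sum_distrib_left sum_distrib_right mult_ac)
        then have "v \<bullet> (outer u *v v) = (u \<bullet> v)\<^sup>2" by (simp add: inner_commute power2_eq_square)
        also have "u \<bullet> v = (M *v v) $ i / sqrt m" by (simp add: u_def matrix_vector_mul_component)
        finally show ?thesis using m by (simp add: power_divide)
      qed
      then have "v \<bullet> (N *v v) = v \<bullet> (M *v v) - ((M *v v) $ i)\<^sup>2 / m"
        by (simp add: N_def matrix_vector_mult_diff_rdistrib inner_diff_right)
      \<comment> \<open>Completing the square: the new form at \<open>v\<close> is the old one at
        \<open>v\<close> shifted along the axis by the minimizing amount
        \<open>- (M *v v) $ i / m\<close>.\<close>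
      also have "\<dots> = v \<bullet> (M *v v) + 2 * (- ((M *v v) $ i) / m) * (M *v v) $ i + (- ((M *v v) $ i) / m)\<^sup>2 * m"
        using m by (simp add: field_simps power2_eq_square)
      also have "\<dots> \<ge> 0"
        using psd[of "v + (- ((M *v v) $ i) / m) *\<^sub>R axis i 1"] unfolding quad_axis[OF sym] m_def[symmetric] .
      finally show ?thesis .
    qed
    moreover have "card {j. N $ j \<noteq> 0} < card {j. M $ j \<noteq> 0}"
    proof (rule psubset_card_mono)
      have "N $ i = 0" using m by (simp add: vec_eq_iff N m_def[symmetric])
      moreover have "M $ i \<noteq> 0" using m by (auto simp: m_def)
      moreover have "N $ j = 0" if "M $ j = 0" for j using that symc[of i j] by (simp add: vec_eq_iff N)
      ultimately show "{j. N $ j \<noteq> 0} \<subset> {j. M $ j \<noteq> 0}" by blast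
    qed simp
    ultimately obtain us where "N = (\<Sum>u\<leftarrow>us. outer u)" using less.hyps[of N] by blast
    then have "M = (\<Sum>u\<leftarrow>u # us. outer u)" by (simp add: N_def algebra_simps)
    then show ?thesis by blast
  qed
qed

lemma trace_mul_outer: "trace (Y ** outer u) = u \<bullet> (Y *v u)" for Y :: "real^'d^'d::finite"
  by (simp add: trace_def matrix_matrix_mult_def outer_def inner_vec_def matrix_vector_mult_def sum_distrib_left mult_ac)

lemma trace_mul_sum_outer:
  "trace (Y ** (\<Sum>u\<leftarrow>us. outer u)) = (\<Sum>u\<leftarrow>us. u \<bullet> (Y *v u))" for Y :: "real^'d^'d::finite"
proof (induction us)
  case Nil
  show ?case by (simp add: mm.zero_right trace_def)
qed (simp add: trace_mul_outer trace_add mm.add_right)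

text \<open>The factor \<open>matrix_inv g ** transpose X ** g\<close> is the adjoint of
  \<open>X\<close> for \<open>g\<close>. Writing the last \<open>g\<close> as a sum of outer squares
  turns the trace into a sum of values of the inverse metric at the vectors
  \<open>transpose X *v u\<close>. If it vanishes, all these vectors do, so
  \<open>transpose X ** g = 0\<close>.\<close>

lemma trace_adjoint_nonneg:
  fixes g X :: "real^'d^'d::finite"
  assumes g: "pos_def g"
  shows "0 \<le> trace (X ** (matrix_inv g ** transpose X ** g))"
    and "trace (X ** (matrix_inv g ** transpose X ** g)) = 0 \<Longrightarrow> X = 0"
proof -
  note inv = pos_def_invertible[OF g]
  have nn: "0 \<le> v \<bullet> (g *v v)" for v using g by (cases "v = 0") (auto simp: pos_def_def less_imp_le)
  have "transpose g = g" using g by (simp add: pos_def_def)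
  with psd_sum_outer[OF this nn] obtain us where us: "g = (\<Sum>u\<leftarrow>us. outer u)" by blast
  have h: "v \<bullet> (matrix_inv g *v v) = (matrix_inv g *v v) \<bullet> (g *v (matrix_inv g *v v))" for v
    by (simp add: matrix_vector_mul_assoc matrix_inv_mul[OF inv] inner_commute)
  have quad: "u \<bullet> ((X ** matrix_inv g ** transpose X) *v u) = (transpose X *v u) \<bullet> (matrix_inv g *v (transpose X *v u))" for u
  proof -
    have "u \<bullet> (X *v w) = (transpose X *v u) \<bullet> w" for w
      by (simp add: dot_lmul_matrix[symmetric] transpose_matrix_vector)
    then show ?thesis by (simp add: matrix_vector_mul_assoc[symmetric])
  qed
  have tr: "trace (X ** (matrix_inv g ** transpose X ** g)) = (\<Sum>u\<leftarrow>us. (transpose X *v u) \<bullet> (matrix_inv g *v (transpose X *v u)))"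
  proof -
    have "trace (X ** (matrix_inv g ** transpose X ** g)) = trace ((X ** matrix_inv g ** transpose X) ** g)"
      by (simp add: mm_assoc)
    also have "\<dots> = (\<Sum>u\<leftarrow>us. u \<bullet> ((X ** matrix_inv g ** transpose X) *v u))"
      by (subst (2) us) (rule trace_mul_sum_outer)
    finally show ?thesis by (simp only: quad)
  qed
  have ge: "0 \<le> v \<bullet> (matrix_inv g *v v)" for v unfolding h by (rule nn)
  show "0 \<le> trace (X ** (matrix_inv g ** transpose X ** g))"
    unfolding tr by (rule sum_list_nonneg) (use ge in auto)
  assume "trace (X ** (matrix_inv g ** transpose X ** g)) = 0"
  then have "\<forall>u\<in>set us. (transpose X *v u) \<bullet> (matrix_inv g *v (transpose X *v u)) = 0"
    unfolding tr by (subst (asm) sum_list_nonneg_eq_0_iff) (use ge in auto)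
  moreover have "v = 0" if "v \<bullet> (matrix_inv g *v v) = 0" for v
  proof -
    have "matrix_inv g *v v = 0" using that g unfolding h pos_def_def by (metis less_irrefl)
    then have "g *v (matrix_inv g *v v) = 0" by simp
    then show ?thesis by (simp add: matrix_vector_mul_assoc matrix_inv_mul[OF inv])
  qed
  ultimately have z: "\<forall>u\<in>set us. transpose X *v u = 0" by blast
  have "transpose X ** outer u = 0" if "u \<in> set us" for u
  proof -
    have "(transpose X ** outer u) $ i $ j = (transpose X *v u) $ i * u $ j" for i j
      by (simp add: matrix_matrix_mult_def outer_def matrix_vector_mult_def sum_distrib_left mult_ac)
    then show ?thesis using z that by (simp add: vec_eq_iff)
  qed
  then have "transpose X ** (\<Sum>u\<leftarrow>us. outer u) = 0"
    by (induction us) (simp_all add: mm.add_right mm.zero_right)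
  then have "transpose X ** g ** matrix_inv g = 0" using us by (simp add: mm.zero_left)
  then have "transpose X = 0" by (simp add: mm_assoc matrix_inv_mul[OF inv])
  then have "transpose (transpose X) = transpose 0" by simp
  then show "X = 0" by (simp add: transpose_def vec_eq_iff)
qed

section \<open>Integration over the manifold\<close>

locale riemannian_point = almost_complex_point +
  fixes g \<mu>
  assumes metric: "riemannian_metric At g" and volume: "riemannian_volume At g \<mu>"
begin

lemma sets_\<mu>: "sets \<mu> = sets borel" and space_\<mu>: "space \<mu> = UNIV"
  and emeasure_chart: "c \<in> At \<Longrightarrow> S \<in> sets borel \<Longrightarrow> S \<subseteq> fst c \<Longrightarrow>
    emeasure \<mu> S = (\<integral>\<^sup>+x\<in>snd c ` S. ennreal (sqrt (det (g c (coord_inv c x)))) \<partial>lborel)"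
proof -
  show s: "sets \<mu> = sets borel" using volume by (simp add: riemannian_volume_def)
  show "space \<mu> = UNIV" using sets_eq_imp_space_eq[OF s] by simp
  show "c \<in> At \<Longrightarrow> S \<in> sets borel \<Longrightarrow> S \<subseteq> fst c \<Longrightarrow>
    emeasure \<mu> S = (\<integral>\<^sup>+x\<in>snd c ` S. ennreal (sqrt (det (g c (coord_inv c x)))) \<partial>lborel)"
    using volume unfolding riemannian_volume_def by blast
qed

lemma metric_smooth: "c \<in> At \<Longrightarrow> smooth_on (cdom c) (\<lambda>x. g c (coord_inv c x))"
  and metric_pos_def: "c \<in> At \<Longrightarrow> p \<in> fst c \<Longrightarrow> pos_def (g c p)"
  and metric_transform: "c \<in> At \<Longrightarrow> c' \<in> At \<Longrightarrow> p \<in> fst c \<Longrightarrow> p \<in> fst c' \<Longrightarrow>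
    g c p = transpose (jac c c' p) ** g c' p ** jac c c' p"
  using metric unfolding riemannian_metric_def pos_def_def by blast+

lemma continuous_on_density: "c \<in> At \<Longrightarrow> continuous_on (cdom c) (\<lambda>x. sqrt (det (g c (coord_inv c x))))"
  using continuous_on_iter_D[OF metric_smooth, of c "[]"] by (auto intro!: continuous_intros continuous_on_det)

text \<open>The volume is described only inside charts. Finitely many compact coordinate pieces
  cover the manifold, and on each of them the density is bounded.\<close>

lemma finite_measure_\<mu>: "finite_measure \<mu>"
proof
  obtain I where I: "finite I" "\<And>c C. (c, C) \<in> I \<Longrightarrow> chart_compact c C"
    "\<And>p. \<exists>(c, C)\<in>I. p \<in> fst c \<and> snd c p \<in> C" by (rule finite_compact_cover) blast
  let ?S = "\<lambda>(c, C). coord_inv c ` C"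
  have fin: "?S i \<in> sets borel \<and> emeasure \<mu> (?S i) < \<infinity>" if "i \<in> I" for i
  proof -
    obtain c C where i: "i = (c, C)" by (cases i)
    then have c: "c \<in> At" and C: "compact C" "C \<subseteq> cdom c" using I(2) that by (auto simp: chart_compact_def)
    have "continuous_on C (coord_inv c)"
      using chart_homeomorphism[OF c] C(2) by (auto simp: homeomorphism_def intro: continuous_on_subset)
    then have "compact (coord_inv c ` C)" using C(1) by (rule compact_continuous_image)
    then have S: "coord_inv c ` C \<in> sets borel" by (intro borel_closed compact_imp_closed)
    have sub: "coord_inv c ` C \<subseteq> fst c" using coord_inv_dom(1)[OF c] C(2) by blast
    have img: "snd c ` coord_inv c ` C = C"
      using coord_inv_dom(2)[OF c] C(2) by (force simp: image_image)
    let ?f = "\<lambda>x. sqrt (det (g c (coord_inv c x)))"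
    have "compact (?f ` C)"
      using continuous_on_density[OF c] C by (intro compact_continuous_image) (auto intro: continuous_on_subset)
    then obtain B where B: "\<And>x. x \<in> C \<Longrightarrow> ?f x \<le> B"
      using compact_imp_bounded bounded_imp_bdd_above by (fastforce simp: bdd_above_def)
    have "emeasure \<mu> (coord_inv c ` C) = (\<integral>\<^sup>+x\<in>C. ennreal (?f x) \<partial>lborel)"
      using emeasure_chart[OF c S sub] img by simp
    also have "\<dots> \<le> (\<integral>\<^sup>+x. ennreal B * indicator C x \<partial>lborel)"
      by (intro nn_integral_mono) (auto simp: indicator_def intro!: ennreal_leI B)
    also have "\<dots> = ennreal B * emeasure lborel C"
      using C(1) by (intro nn_integral_cmult_indicator) (simp add: borel_compact)
    also have "\<dots> < \<infinity>"
      using emeasure_bounded_finite[OF compact_imp_bounded[OF C(1)]] by (simp add: ennreal_mult_less_top)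
    finally show ?thesis using S by (simp add: i)
  qed
  have "UNIV \<subseteq> (\<Union>i\<in>I. ?S i)"
  proof
    fix p :: 'a
    obtain c C where cC: "(c, C) \<in> I" "p \<in> fst c" "snd c p \<in> C" using I(3)[of p] by blast
    have c: "c \<in> At" using I(2)[OF cC(1)] by (simp add: chart_compact_def)
    then have "p = coord_inv c (snd c p)" using coord_inv_snd cC(2) by simp
    then have "p \<in> ?S (c, C)" using cC(3) by auto
    then show "p \<in> (\<Union>i\<in>I. ?S i)" using cC(1) by blast
  qed
  then have "emeasure \<mu> (space \<mu>) \<le> emeasure \<mu> (\<Union>i\<in>I. ?S i)"
    using fin I(1) unfolding space_\<mu> by (intro emeasure_mono sets.finite_UN) (auto simp: sets_\<mu>)
  also have "\<dots> \<le> (\<Sum>i\<in>I. emeasure \<mu> (?S i))"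
    using fin I(1) by (intro emeasure_subadditive_finite) (auto simp: sets_\<mu>)
  also have "\<dots> < \<infinity>" using fin I(1) by simp
  finally show "emeasure \<mu> (space \<mu>) \<noteq> \<infinity>" by simp
qed

lemma ftrace_chart:
  assumes X: "X \<in> endo At" and c: "c \<in> At" "p \<in> fst c"
  shows "ftrace At X p = trace (X c p)"
proof -
  define c' where "c' = (SOME c. c \<in> At \<and> p \<in> fst c)"
  have c': "c' \<in> At \<and> p \<in> fst c'" unfolding c'_def by (rule someI_ex) (use c in blast)
  have "trace (X c' p) = trace (matrix_inv (jac c c' p) ** (jac c c' p ** X c p))"
    unfolding endo_conj[OF X c(1) conjunct1[OF c'] c(2) conjunct2[OF c']] by (rule trace_mul_sym)
  also have "\<dots> = trace (X c p)"
    using c' c by (simp add: matrix_inv_mul_assoc[OF invertible_jac])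
  finally show ?thesis by (simp add: ftrace_def c'_def)
qed

text \<open>The chart selected in \<open>ftrace\<close> may change arbitrarily from point to point;
  by chart independence a fixed chart may be used near each point.\<close>

lemma continuous_on_ftrace:
  assumes X: "X \<in> endo At"
  shows "continuous_on UNIV (ftrace At X)"
proof -
  have "continuous_on (fst c) (ftrace At X)" if c: "c \<in> At" for c
  proof -
    have "continuous_on (cdom c) (loc X c)" using continuous_on_iter_D[OF endoD(1)[OF X c], of "[]"] by simp
    moreover have "continuous_on (fst c) (snd c)" using chart_homeomorphism[OF c] by (simp add: homeomorphism_def)
    ultimately have "continuous_on (fst c) (\<lambda>p. loc X c (snd c p))" by (auto intro: continuous_on_compose2)
    then have "continuous_on (fst c) (\<lambda>p. trace (loc X c (snd c p)))"
      unfolding trace_def by (intro continuous_intros)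
    then show ?thesis
      by (rule continuous_on_eq) (simp add: loc_def coord_inv_snd[OF c] ftrace_chart[OF X c])
  qed
  then have "continuous_on (\<Union>c\<in>At. fst c) (ftrace At X)"
    by (intro continuous_on_open_UN) (auto intro: open_fst)
  then show ?thesis by (simp only: charts_cover)
qed

lemma borel_measurable_continuous:
  fixes f :: "'a \<Rightarrow> real"
  assumes "continuous_on UNIV f"
  shows "f \<in> borel_measurable \<mu>"
  using borel_measurable_continuous_onI[OF assms] by (simp add: measurable_cong_sets[OF sets_\<mu> refl])

lemma integrable_continuous:
  fixes f :: "'a \<Rightarrow> real"
  assumes f: "continuous_on UNIV f"
  shows "integrable \<mu> f"
proof -
  have "bounded (f ` UNIV)" using compact_continuous_image[OF f compact_UNIV] by (rule compact_imp_bounded)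
  then obtain B where "\<And>p. norm (f p) \<le> B" by (auto simp: bounded_iff)
  then show ?thesis
    by (intro finite_measure.integrable_const_bound[OF finite_measure_\<mu>] borel_measurable_continuous f) auto
qed

section \<open>The integrated trace and its derivative along curves\<close>

definition tr_int :: "('a, 'b) field \<Rightarrow> real" where
  "tr_int X = (\<integral>p. ftrace At X p \<partial>\<mu>)"

lemma integrable_ftrace: "X \<in> endo At \<Longrightarrow> integrable \<mu> (ftrace At X)"
  by (intro integrable_continuous continuous_on_ftrace)

lemma tr_int_add:
  assumes "X \<in> endo At" "Y \<in> endo At"
  shows "tr_int (X + Y) = tr_int X + tr_int Y"
proof -
  have "ftrace At (X + Y) = (\<lambda>p. ftrace At X p + ftrace At Y p)"
    by (simp add: fun_eq_iff ftrace_def trace_add field_apply)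
  then show ?thesis
    unfolding tr_int_def using Bochner_Integration.integral_add[OF assms[THEN integrable_ftrace]] by simp
qed

lemma tr_int_fscale: "tr_int (r \<cdot> X) = r * tr_int X"
proof -
  have "ftrace At (r \<cdot> X) = (\<lambda>p. r * ftrace At X p)"
    by (simp add: fun_eq_iff ftrace_def trace_scaleR field_apply)
  then show ?thesis unfolding tr_int_def by simp
qed

lemma tr_int_diff:
  assumes "X \<in> endo At" "Y \<in> endo At"
  shows "tr_int (X - Y) = tr_int X - tr_int Y"
proof -
  have "ftrace At (X - Y) = (\<lambda>p. ftrace At X p - ftrace At Y p)"
    by (simp add: fun_eq_iff ftrace_def trace_sub field_apply)
  then show ?thesis
    unfolding tr_int_def using Bochner_Integration.integral_diff[OF assms[THEN integrable_ftrace]] by simp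
qed

lemma tr_int_commute: "tr_int (X \<odot> Y) = tr_int (Y \<odot> X)"
  unfolding tr_int_def ftrace_def field_apply by (subst trace_mul_sym) (rule refl)

lemma tr_int_eqI:
  assumes "\<And>c p. c \<in> At \<Longrightarrow> p \<in> fst c \<Longrightarrow> trace (X c p) = trace (Y c p)"
  shows "tr_int X = tr_int Y"
proof -
  have "ftrace At X = ftrace At Y" by (rule ext) (use ftrace_scaled_eqI[of _ X 1 Y] assms in simp)
  then show ?thesis by (simp add: tr_int_def)
qed

text \<open>A field is bounded at all points by the order zero seminorms of a finite cover, the
  trace by the norm, and the volume is finite. This continuity, applied to difference quotients, is
  differentiation under the integral.\<close>

lemma tr_int_tendsto:
  assumes F: "conv F L \<F>"
  shows "((\<lambda>t. tr_int (F t)) \<longlongrightarrow> tr_int L) \<F>"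
proof -
  obtain I where I: "finite I" "\<And>c C. (c, C) \<in> I \<Longrightarrow> chart_compact c C"
    "\<And>p. \<exists>(c, C)\<in>I. p \<in> fst c \<and> snd c p \<in> C" by (rule finite_compact_cover) blast
  define b where "b X = real CARD('b) * (\<Sum>(c, C)\<in>I. pn c C [] X)" for X
  define m where "m = measure \<mu> UNIV"
  have le: "\<bar>ftrace At X p\<bar> \<le> b X" if X: "X \<in> endo At" for X p
  proof -
    obtain c C where cC: "(c, C) \<in> I" "p \<in> fst c" "snd c p \<in> C" using I(3)[of p] by blast
    have c: "c \<in> At" "chart_compact c C" using I(2)[OF cC(1)] by (auto simp: chart_compact_def)
    have "norm (X c p) \<le> pn c C [] X"
      using pn_upper[OF c(2) X cC(3), of "[]"] coord_inv_snd[OF c(1) cC(2)] by (simp add: loc_def)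
    also have "\<dots> = (\<lambda>(c, C). pn c C [] X) (c, C)" by simp
    also have "\<dots> \<le> (\<Sum>(c, C)\<in>I. pn c C [] X)"
      by (rule member_le_sum[OF cC(1) _ I(1)]) (auto intro!: pn_nonneg X I(2))
    finally have "real CARD('b) * norm (X c p) \<le> b X" unfolding b_def by (rule mult_left_mono) simp
    with abs_trace_le[of "X c p"] show ?thesis by (simp add: ftrace_chart[OF X c(1) cC(2)])
  qed
  have bd: "\<bar>tr_int X\<bar> \<le> b X * m" if X: "X \<in> endo At" for X
  proof -
    have "\<bar>tr_int X\<bar> \<le> (\<integral>p. \<bar>ftrace At X p\<bar> \<partial>\<mu>)" unfolding tr_int_def by (rule integral_abs_bound)
    also have "\<dots> \<le> (\<integral>p. b X \<partial>\<mu>)"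
      by (intro integral_mono le X finite_measure.integrable_const[OF finite_measure_\<mu>] integrable_abs
          integrable_continuous continuous_on_ftrace)
    also have "\<dots> = b X * m" by (simp add: m_def space_\<mu>)
    finally show ?thesis .
  qed
  have "((\<lambda>t. b (F t - L) * m) \<longlongrightarrow> real CARD('b) * (\<Sum>(c, C)\<in>I. 0) * m) \<F>"
    unfolding b_def case_prod_beta
    by (intro tendsto_intros conv_pn[OF F]) (auto intro: I(2))
  then have lim: "((\<lambda>t. b (F t - L) * m) \<longlongrightarrow> 0) \<F>" by (simp add: case_prod_beta)
  have "((\<lambda>t. tr_int (F t) - tr_int L) \<longlongrightarrow> 0) \<F>"
  proof (rule Lim_null_comparison[OF _ lim])
    show "\<forall>\<^sub>F t in \<F>. norm (tr_int (F t) - tr_int L) \<le> b (F t - L) * m"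
      using conv_eventually_endo[OF F]
    proof eventually_elim
      case (elim t)
      show ?case using bd[OF endo_diff[OF elim conv_endo[OF F]]] by (simp add: tr_int_diff[OF elim conv_endo[OF F]])
    qed
  qed
  then show ?thesis by (rule LIM_zero_cancel)
qed

lemma tr_int_has_derivative:
  assumes \<gamma>: "fderiv \<gamma> L t"
  shows "((\<lambda>s. tr_int (\<gamma> s)) has_real_derivative tr_int L) (at t)"
  unfolding has_field_derivative_iff
proof (rule Lim_transform_eventually)
  show "((\<lambda>s. tr_int ((1 / (s - t)) \<cdot> (\<gamma> s - \<gamma> t))) \<longlongrightarrow> tr_int L) (at t)"
    using \<gamma> by (intro tr_int_tendsto) (simp add: fderiv_conv)
  show "\<forall>\<^sub>F s in at t. tr_int ((1 / (s - t)) \<cdot> (\<gamma> s - \<gamma> t)) = (tr_int (\<gamma> s) - tr_int (\<gamma> t)) / (s - t)"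
    using fderivD(5)[OF \<gamma>] by eventually_elim (simp add: tr_int_fscale tr_int_diff fderivD(2)[OF \<gamma>])
qed

text \<open>The volume charges every nonempty open set: in a chart its density is positive, and a
  nonempty open set is not Lebesgue null. This upgrades vanishing almost everywhere to vanishing
  everywhere.\<close>

lemma continuous_integral_zero:
  fixes f :: "'a \<Rightarrow> real"
  assumes f: "continuous_on UNIV f" "\<And>p. 0 \<le> f p" and int: "(\<integral>p. f p \<partial>\<mu>) = 0"
  shows "f p = 0"
proof (rule ccontr)
  assume "f p \<noteq> 0"
  then have p: "f p > 0" using f(2)[of p] by simp
  obtain c where c: "c \<in> At" "p \<in> fst c" by (rule chart_around)
  define S where "S = fst c \<inter> {q. f q > 0}"
  have "open {q. f q > 0}" using f(1) by (intro open_Collect_less continuous_on_const) auto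
  then have S: "open S" "p \<in> S" "S \<subseteq> fst c" unfolding S_def using open_fst[OF c(1)] c(2) p by auto
  have "AE q in \<mu>. f q = 0"
    using integral_nonneg_eq_0_iff_AE[OF integrable_continuous[OF f(1)]] f(2) int by simp
  then have "AE q in \<mu>. q \<notin> S" by eventually_elim (simp add: S_def)
  then have "emeasure \<mu> S = 0"
    using S(1) by (subst (asm) AE_iff_measurable[OF _ refl]) (auto simp: sets_\<mu> space_\<mu>)
  then have "(\<integral>\<^sup>+x\<in>snd c ` S. ennreal (sqrt (det (g c (coord_inv c x)))) \<partial>lborel) = 0"
    using emeasure_chart[OF c(1) _ S(3)] S(1) by simp
  have openS: "open (snd c ` S)"
  proof -
    have "homeomorphism (cdom c) (fst c) (coord_inv c) (snd c)"
      using chart_homeomorphism[OF c(1)] by (rule homeomorphism_sym[THEN iffD1])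
    then have "continuous_on (cdom c) (coord_inv c)" by (simp add: homeomorphism_def)
    then have "open (cdom c \<inter> coord_inv c -` S)"
      using open_dom[OF c(1)] S(1) by (rule continuous_open_preimage)
    also have "cdom c \<inter> coord_inv c -` S = snd c ` S"
      using coord_inv_snd[OF c(1)] coord_inv_dom[OF c(1)] S(3) by (force simp: image_iff)
    finally show ?thesis .
  qed
  have "(\<lambda>x. ennreal (sqrt (det (g c (coord_inv c x)))) * indicator (snd c ` S) x) \<in> borel_measurable lborel"
  proof -
    have "continuous_on (snd c ` S) (\<lambda>x. sqrt (det (g c (coord_inv c x))))"
      using continuous_on_density[OF c(1)] S(3) by (auto intro: continuous_on_subset)
    then have "(\<lambda>x. indicator (snd c ` S) x *\<^sub>R sqrt (det (g c (coord_inv c x)))) \<in> borel_measurable borel"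
      using openS by (intro borel_measurable_continuous_on_indicator) auto
    then have "(\<lambda>x. ennreal (indicator (snd c ` S) x *\<^sub>R sqrt (det (g c (coord_inv c x))))) \<in> borel_measurable lborel"
      by simp
    moreover have "(\<lambda>x. ennreal (indicator (snd c ` S) x *\<^sub>R sqrt (det (g c (coord_inv c x)))))
        = (\<lambda>x. ennreal (sqrt (det (g c (coord_inv c x)))) * indicator (snd c ` S) x)"
      by (auto simp: fun_eq_iff indicator_def)
    ultimately show ?thesis by simp
  qed
  from nn_integral_0_iff_AE[OF this] \<open>(\<integral>\<^sup>+x\<in>snd c ` S. ennreal (sqrt (det (g c (coord_inv c x)))) \<partial>lborel) = 0\<close>
  have "AE x in lborel. ennreal (sqrt (det (g c (coord_inv c x)))) * indicator (snd c ` S) x = 0" by simp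
  then have "AE x in lborel. x \<notin> snd c ` S"
  proof eventually_elim
    case (elim x)
    show ?case
    proof
      assume x: "x \<in> snd c ` S"
      then have "coord_inv c x \<in> fst c" using coord_inv_dom(1)[OF c(1)] S(3) by blast
      then have "0 < det (g c (coord_inv c x))" by (intro pos_def_det_pos metric_pos_def c(1))
      with elim x show False by (simp add: indicator_def ennreal_eq_0_iff)
    qed
  qed
  then have "emeasure lborel (snd c ` S) = 0"
    using openS by (subst (asm) AE_iff_measurable[OF _ refl]) auto
  then have "snd c ` S \<in> null_sets lborel" using openS by (auto simp: null_sets_def)
  then have "negligible (snd c ` S)" by (simp add: negligible_iff_null_sets null_sets_completionI)
  then show False using open_not_negligible[OF openS] S(2) by blast
qed

section \<open>Nondegeneracy and the Levi-Civita connection\<close>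

definition adj :: "('a, 'b) field \<Rightarrow> ('a, 'b) field" where
  "adj X = (\<lambda>c p. if c \<in> At \<and> p \<in> fst c then matrix_inv (g c p) ** transpose (X c p) ** g c p else 0)"

lemma adj_mat: "c \<in> At \<Longrightarrow> p \<in> fst c \<Longrightarrow> adj X c p = matrix_inv (g c p) ** transpose (X c p) ** g c p"
  by (simp add: adj_def)

lemma adj_endo:
  assumes X: "X \<in> endo At"
  shows "adj X \<in> endo At"
proof (rule endoI)
  have tr: "bounded_linear (transpose :: real^'b^'b \<Rightarrow> real^'b^'b)"
    unfolding linear_conv_bounded_linear[symmetric]
    by (rule linearI) (simp_all add: transpose_def vec_eq_iff)
  show "smooth_on (cdom c) (loc (adj X) c)" if c: "c \<in> At" for c
  proof (rule smooth_on_cong)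
    show "smooth_on (cdom c) (\<lambda>x. matrix_inv (g c (coord_inv c x)) ** transpose (loc X c x) ** g c (coord_inv c x))"
      by (intro smooth_on_mm smooth_on_matrix_inv smooth_on_linear[OF tr] metric_smooth[OF c] endoD(1)[OF X c]
          pos_def_invertible metric_pos_def[OF c] coord_inv_dom(1)[OF c])
  qed (simp add: loc_def adj_mat[OF c coord_inv_dom(1)[OF c]])
  show "adj X c' p ** jac c c' p = jac c c' p ** adj X c p"
    if c: "c \<in> At" "c' \<in> At" "p \<in> fst c" "p \<in> fst c'" for c c' p
  proof -
    let ?J = "jac c c' p" and ?g = "g c p" and ?g' = "g c' p" and ?x = "X c p" and ?x' = "X c' p"
    note iJ = invertible_jac[OF c]
    have ig: "invertible ?g" "invertible ?g'" using c by (auto intro: pos_def_invertible metric_pos_def)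
    have gt: "?g = transpose ?J ** ?g' ** ?J" by (rule metric_transform[OF c])
    \<comment> \<open>Inverting \<open>g = J^T g' J\<close> shows how the inverse metric changes
      with the chart, namely by \<open>J g^-1 J^T\<close>.\<close>
    have "?g' ** (?J ** matrix_inv ?g ** transpose ?J) = mat 1"
    proof (rule invertibleI(3))
      have "(?J ** matrix_inv ?g ** transpose ?J) ** ?g' ** ?J = ?J ** (matrix_inv ?g ** ?g)"
        unfolding gt by (simp only: mm_assoc)
      also have "\<dots> = ?J" by (simp add: matrix_inv_mul[OF ig(1)])
      finally have "(?J ** matrix_inv ?g ** transpose ?J) ** ?g' ** ?J ** matrix_inv ?J = ?J ** matrix_inv ?J" by simp
      then show "(?J ** matrix_inv ?g ** transpose ?J) ** ?g' = mat 1"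
        by (simp add: mm_assoc matrix_inv_mul[OF iJ])
    qed
    then have h: "matrix_inv ?g' = ?J ** matrix_inv ?g ** transpose ?J" by (rule invertibleI)
    have "transpose (?x' ** ?J) = transpose (?J ** ?x)" using endoD(2)[OF X c] by simp
    then have xt: "transpose ?J ** transpose ?x' = transpose ?x ** transpose ?J" by (simp add: matrix_transpose_mul)
    have "adj X c' p ** ?J = ?J ** matrix_inv ?g ** (transpose ?J ** transpose ?x') ** ?g' ** ?J"
      using c by (simp add: adj_mat h mm_assoc)
    also have "\<dots> = ?J ** matrix_inv ?g ** transpose ?x ** (transpose ?J ** ?g' ** ?J)"
      by (simp only: xt mm_assoc)
    also have "\<dots> = ?J ** matrix_inv ?g ** transpose ?x ** ?g" by (simp only: gt[symmetric])
    also have "\<dots> = ?J ** adj X c p" using c by (simp add: adj_mat mm_assoc)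
    finally show ?thesis .
  qed
qed (auto simp: adj_def)

text \<open>The test vector is \<open>F - J\<^sub>0\<^sup>-\<^sup>1 F J\<^sub>0\<close>, the part anticommuting with \<open>J\<^sub>0\<close> of the \<open>g\<close>-adjoint \<open>F\<close> of
  \<open>P D P\<close>; pairing with it gives twice the integral of the nonnegative function \<open>tr (P D P F)\<close>.\<close>

lemma nondegenerate:
  assumes K: "K \<in> V" and D: "D \<in> E" and zero: "\<And>C. C \<in> E \<Longrightarrow> tr_int (P K \<odot> D \<odot> P K \<odot> C) = 0"
  shows "D = 0"
proof -
  define X where "X = P K \<odot> D \<odot> P K"
  define F where "F = adj X"
  define C where "C = F + J0 \<odot> F \<odot> J0"
  have X: "X \<in> endo At" unfolding X_def by (intro endo_fcomp P_endo[OF K] tangent_endo[OF D])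
  have F: "F \<in> endo At" unfolding F_def by (rule adj_endo[OF X])
  have C: "C \<in> E"
  proof (rule tangentI)
    show "C \<in> endo At" unfolding C_def by (intro endo_add endo_fcomp F J0_endo)
    fix c p assume c: "c \<in> At" "p \<in> fst c"
    have JJ: "J0 c p ** (J0 c p ** Y) = - Y" for Y :: "real^'b^'b"
      by (simp add: matrix_mul_assoc J0_mat[OF c] mm.minus_left)
    show "J0 c p ** C c p = - (C c p ** J0 c p)"
      by (simp add: C_def field_apply mm_simps JJ J0_mat[OF c])
  qed
  \<comment> \<open>As \<open>X\<close> anticommutes with \<open>J0\<close>, a cyclic shift gives
    \<open>tr (X J0 F J0) = tr (J0 X J0 F) = tr (X F)\<close>, so the two parts of \<open>C\<close>
    contribute equally.\<close>
  have "tr_int (X \<odot> (J0 \<odot> F \<odot> J0)) = tr_int (X \<odot> F)"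
  proof (rule tr_int_eqI)
    fix c p assume c: "c \<in> At" "p \<in> fst c"
    let ?J = "J0 c p" and ?q = "matrix_inv (mat 1 - K c p ** K c p)"
    have JJ: "?J ** (?J ** Y) = - Y" for Y :: "real^'b^'b"
      by (simp add: matrix_mul_assoc J0_mat[OF c] mm.minus_left)
    have qJ: "?J ** (?q ** Y) = ?q ** (?J ** Y)" for Y :: "real^'b^'b"
      by (simp add: matrix_mul_assoc P_mat_J0[OF K c])
    have DJ: "?J ** (D c p ** Y) = - (D c p ** (?J ** Y))" for Y :: "real^'b^'b"
      by (simp add: matrix_mul_assoc tangent_mat[OF D] mm.minus_left)
    have "trace ((X \<odot> (J0 \<odot> F \<odot> J0)) c p) = trace ((X c p ** (?J ** F c p)) ** ?J)"
      by (simp add: field_apply mm_assoc)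
    also have "\<dots> = trace (?J ** (X c p ** (?J ** F c p)))" by (rule trace_mul_sym)
    also have "?J ** (X c p ** (?J ** F c p)) = X c p ** F c p"
      using c by (simp add: X_def field_apply mm_assoc qJ DJ JJ mm.minus_right)
    finally show "trace ((X \<odot> (J0 \<odot> F \<odot> J0)) c p) = trace ((X \<odot> F) c p)" by (simp add: field_apply)
  qed
  moreover have "tr_int (X \<odot> C) = tr_int (X \<odot> F) + tr_int (X \<odot> (J0 \<odot> F \<odot> J0))"
    unfolding C_def fcomp_simps(2) by (intro tr_int_add endo_fcomp X F J0_endo)
  moreover have "tr_int (X \<odot> C) = 0" unfolding X_def by (rule zero[OF C])
  ultimately have int: "(\<integral>p. ftrace At (X \<odot> F) p \<partial>\<mu>) = 0" by (simp add: tr_int_def)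
  note XF = endo_fcomp[OF X F]
  have tr: "ftrace At (X \<odot> F) p = trace (X c p ** (matrix_inv (g c p) ** transpose (X c p) ** g c p))"
    if "c \<in> At" "p \<in> fst c" for c p
    using ftrace_chart[OF XF that] that by (simp add: field_apply F_def adj_mat)
  have nn: "0 \<le> ftrace At (X \<odot> F) p" for p
  proof -
    obtain c where c: "c \<in> At" "p \<in> fst c" by (rule chart_around)
    show ?thesis unfolding tr[OF c] by (rule trace_adjoint_nonneg(1)[OF metric_pos_def[OF c]])
  qed
  show ?thesis
  proof (rule field_eqI[OF tangent_endo[OF D] endo_0])
    fix c p assume c: "c \<in> At" "p \<in> fst c"
    let ?q = "matrix_inv (mat 1 - K c p ** K c p)"
    have "ftrace At (X \<odot> F) p = 0" by (rule continuous_integral_zero[OF continuous_on_ftrace[OF XF] nn int])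
    then have "X c p = 0" unfolding tr[OF c] by (rule trace_adjoint_nonneg(2)[OF metric_pos_def[OF c]])
    then have z: "?q ** D c p ** ?q = 0" using c by (simp add: X_def field_apply)
    note inv = invertible_one_minus_square[OF V_mat[OF K c]]
    have "D c p = (mat 1 - K c p ** K c p) ** (?q ** D c p ** ?q) ** (mat 1 - K c p ** K c p)"
      by (simp only: mm_assoc matrix_inv_mul_assoc[OF inv] matrix_inv_mul[OF inv] matrix_mul_rid)
    then show "D c p = 0 c p" by (simp add: z mm.zero_left mm.zero_right field_apply)
  qed
qed

section \<open>Metric compatibility and uniqueness of the connection\<close>

lemma inner_K_tr_int:
  assumes "K \<in> V" "A \<in> E" "B \<in> E"
  shows "inner_K At \<mu> J0 K A B = 4 * tr_int (P K \<odot> A \<odot> P K \<odot> B)"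
  using inner_K_eq[OF assms] by (simp add: tr_int_def)

text \<open>The Leibniz rule along the line and under the integral; at each point the two sides then
  agree by \<open>compatibility_identity\<close>, where the derivatives of \<open>Y\<close> and
  \<open>Z\<close> enter as \<open>y'\<close> and \<open>z'\<close>.\<close>

lemma metric_compatible_Gam:
  assumes X: "smooth_vfield At J0 X" and Y: "smooth_vfield At J0 Y" and Z: "smooth_vfield At J0 Z" and K: "K \<in> V"
  shows "((\<lambda>t. inner_K At \<mu> J0 (K + t \<cdot> X K) (Y (K + t \<cdot> X K)) (Z (K + t \<cdot> X K))) has_real_derivative
      inner_K At \<mu> J0 K (cov At Gam X Y K) (Z K) + inner_K At \<mu> J0 K (Y K) (cov At Gam X Z K)) (at 0)"
proof -
  note XK = smooth_vfield_tangent[OF X K] and YK = smooth_vfield_tangent[OF Y K] and ZK = smooth_vfield_tangent[OF Z K]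
  let ?k = "\<lambda>t. K + t \<cdot> X K" and ?Y' = "dderiv At Y K (X K)" and ?Z' = "dderiv At Z K (X K)"
  note dY = smooth_vfield_fderiv[OF Y K XK] and dZ = smooth_vfield_fderiv[OF Z K XK]
  have line: "fderiv ?k (X K) 0" by (intro fderiv_line V_endo K tangent_endo XK)
  have K0: "?k 0 = K" by simp
  let ?P' = "P K \<odot> (X K \<odot> K + K \<odot> X K) \<odot> P K"
  have dP: "fderiv (\<lambda>t. P (?k t)) ?P' 0" using fderiv_P[OF line] K by simp
  let ?L = "((?P' \<odot> Y K + P K \<odot> ?Y') \<odot> P K + P K \<odot> Y K \<odot> ?P') \<odot> Z K + P K \<odot> Y K \<odot> P K \<odot> ?Z'"
  have "fderiv (\<lambda>t. P (?k t) \<odot> Y (?k t) \<odot> P (?k t) \<odot> Z (?k t)) ?L 0"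
    using fderiv_fcomp[OF fderiv_fcomp[OF fderiv_fcomp[OF dP dY(1)] dP] dZ(1)] by simp
  from DERIV_cmult[OF tr_int_has_derivative[OF this], of 4]
  have der: "((\<lambda>t. 4 * tr_int (P (?k t) \<odot> Y (?k t) \<odot> P (?k t) \<odot> Z (?k t))) has_real_derivative 4 * tr_int ?L) (at 0)" .
  have cov: "cov At Gam X Y K \<in> E" "cov At Gam X Z K \<in> E"
    unfolding cov_def by (intro tangent_add Gam_tangent K XK YK ZK dY(2) dZ(2))+
  note en = P_endo[OF K] tangent_endo[OF cov(1)] tangent_endo[OF cov(2)] tangent_endo[OF YK] tangent_endo[OF ZK]
  have "tr_int ?L = tr_int (P K \<odot> cov At Gam X Y K \<odot> P K \<odot> Z K + P K \<odot> Y K \<odot> P K \<odot> cov At Gam X Z K)"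
  proof (rule tr_int_eqI)
    fix c p assume c: "c \<in> At" "p \<in> fst c"
    from compatibility_identity[OF V_mat[OF K c], of "X K c p" "Y K c p" "Z K c p" "?Y' c p" "?Z' c p"]
    show "trace (?L c p) = trace ((P K \<odot> cov At Gam X Y K \<odot> P K \<odot> Z K + P K \<odot> Y K \<odot> P K \<odot> cov At Gam X Z K) c p)"
      unfolding cov_def Gam_def using c
      by (simp only: field_apply fid_apply finv_apply mm.add_left trace_add)
  qed
  also have "\<dots> = tr_int (P K \<odot> cov At Gam X Y K \<odot> P K \<odot> Z K) + tr_int (P K \<odot> Y K \<odot> P K \<odot> cov At Gam X Z K)"
    by (intro tr_int_add endo_fcomp en)
  finally have L: "4 * tr_int ?L = inner_K At \<mu> J0 K (cov At Gam X Y K) (Z K) + inner_K At \<mu> J0 K (Y K) (cov At Gam X Z K)"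
    using inner_K_tr_int[OF K cov(1) ZK] inner_K_tr_int[OF K YK cov(2)] by simp
  obtain S where S: "open S" "0 \<in> S" "\<And>t. t \<in> S \<Longrightarrow> ?k t \<in> V"
    using eventually_V_line[OF K XK] by (auto simp: eventually_nhds)
  \<comment> \<open>The explicit formula for the inner product holds on \<open>V\<close> only, so
    the function is replaced near parameter 0 alone.\<close>
  have eq: "4 * tr_int (P (?k t) \<odot> Y (?k t) \<odot> P (?k t) \<odot> Z (?k t)) = inner_K At \<mu> J0 (?k t) (Y (?k t)) (Z (?k t))"
    if "t \<in> S" for t
    by (rule inner_K_tr_int[symmetric, OF S(3)[OF that] smooth_vfield_tangent[OF Y S(3)[OF that]]
          smooth_vfield_tangent[OF Z S(3)[OF that]]])
  from has_field_derivative_transform_within_open[OF der S(1,2) eq] show ?thesis by (simp only: L)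
qed

lemma levi_civita_Gam: "levi_civita At \<mu> J0 Gam"
  unfolding levi_civita_def
  by (intro conjI connection_Gam allI impI ballI metric_compatible_Gam)
    (auto simp: cov_def lie_bracket_def Gam_sym)

text \<open>The Koszul argument: the difference of two Levi-Civita connections is symmetric in its
  arguments and skew with respect to the inner product.\<close>

lemma levi_civita_unique:
  assumes LC: "levi_civita At \<mu> J0 \<Gamma>" and K: "K \<in> V" and A: "A \<in> E" and B: "B \<in> E"
  shows "\<Gamma> K A B = Gam K A B"
proof -
  have tan: "\<Gamma> K A B \<in> E" if "A \<in> E" "B \<in> E" for A B
  proof -
    have "smooth_map At E 3 {[K, A, B] | K A B. K \<in> V \<and> A \<in> E \<and> B \<in> E} (\<lambda>Ks. \<Gamma> (Ks ! 0) (Ks ! 1) (Ks ! 2))"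
      using LC unfolding levi_civita_def connection_def by blast
    then have "\<forall>Ks\<in>{[K, A, B] | K A B. K \<in> V \<and> A \<in> E \<and> B \<in> E}. \<Gamma> (Ks ! 0) (Ks ! 1) (Ks ! 2) \<in> E"
      unfolding smooth_map_def by (rule conjunct1)
    then have "\<Gamma> ([K, A, B] ! 0) ([K, A, B] ! 1) ([K, A, B] ! 2) \<in> E" using that K by blast
    then show ?thesis by simp
  qed
  have sym: "\<Gamma> K A B = \<Gamma> K B A" if "A \<in> E" "B \<in> E" for A B
  proof -
    have "cov At \<Gamma> (\<lambda>_. A) (\<lambda>_. B) K - cov At \<Gamma> (\<lambda>_. B) (\<lambda>_. A) K = lie_bracket At (\<lambda>_. A) (\<lambda>_. B) K"
      using LC smooth_vfield_const[OF that(1)] smooth_vfield_const[OF that(2)] K unfolding levi_civita_def by blast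
    then show ?thesis using that by (simp add: cov_const lie_bracket_def dderiv_const tangent_endo)
  qed
  define \<Delta> where "\<Delta> A B = \<Gamma> K A B - Gam K A B" for A B
  define ip where "ip X Y = tr_int (P K \<odot> X \<odot> P K \<odot> Y)" for X Y
  have \<Delta>E: "\<Delta> A B \<in> E" if "A \<in> E" "B \<in> E" for A B
    unfolding \<Delta>_def by (intro tangent_diff tan Gam_tangent that K)
  have \<Delta>sym: "\<Delta> A B = \<Delta> B A" if "A \<in> E" "B \<in> E" for A B
    unfolding \<Delta>_def using sym[OF that] Gam_sym by simp
  have ip_sym: "ip X Y = ip Y X" for X Y
    unfolding ip_def using tr_int_commute[of "P K \<odot> X" "P K \<odot> Y"] by (simp add: fcomp_simps)
  have ip_diff: "ip (X - Y) Z = ip X Z - ip Y Z" if "X \<in> E" "Y \<in> E" "Z \<in> E" for X Y Z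
    unfolding ip_def fcomp_simps(3,4) by (intro tr_int_diff endo_fcomp P_endo[OF K] tangent_endo that)
  have skew: "ip (\<Delta> A B) C + ip B (\<Delta> A C) = 0" if "A \<in> E" "B \<in> E" "C \<in> E" for A B C
  proof -
    note sm = smooth_vfield_const[OF that(1)] smooth_vfield_const[OF that(2)] smooth_vfield_const[OF that(3)]
    \<comment> \<open>On constant fields the covariant derivative is the Christoffel map itself.
      Both connections thus compute the derivative of one and the same real function.\<close>
    have der: "((\<lambda>t. inner_K At \<mu> J0 (K + t \<cdot> A) B C) has_real_derivative
        inner_K At \<mu> J0 K (\<Gamma>' K A B) C + inner_K At \<mu> J0 K B (\<Gamma>' K A C)) (at 0)"
      if "levi_civita At \<mu> J0 \<Gamma>'" for \<Gamma>'
    proof -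
      have "((\<lambda>t. inner_K At \<mu> J0 (K + t \<cdot> A) B C) has_real_derivative
        inner_K At \<mu> J0 K (cov At \<Gamma>' (\<lambda>_. A) (\<lambda>_. B) K) C + inner_K At \<mu> J0 K B (cov At \<Gamma>' (\<lambda>_. A) (\<lambda>_. C) K)) (at 0)"
        using that sm K unfolding levi_civita_def by blast
      then show ?thesis by (simp only: cov_const[OF \<open>B \<in> E\<close>] cov_const[OF \<open>C \<in> E\<close>])
    qed
    have "ip (\<Gamma> K A B) C + ip B (\<Gamma> K A C) = ip (Gam K A B) C + ip B (Gam K A C)"
      using DERIV_unique[OF der[OF LC] der[OF levi_civita_Gam]]
      by (simp add: inner_K_tr_int K that tan Gam_tangent ip_def)
    then show ?thesis
      unfolding ip_sym[of B] \<Delta>_def by (simp add: ip_diff tan Gam_tangent K that)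
  qed
  have "ip (\<Delta> A B) C = 0" if C: "C \<in> E" for C
  proof -
    \<comment> \<open>Each line uses skewness once and symmetry once. Three sign changes lead back
      to the initial term with the opposite sign.\<close>
    have "ip (\<Delta> A B) C = - ip (\<Delta> C A) B" using skew[OF A B C] ip_sym \<Delta>sym[OF A C] by simp
    also have "\<dots> = ip (\<Delta> B C) A" using skew[OF C A B] ip_sym \<Delta>sym[OF C B] by simp
    also have "\<dots> = - ip (\<Delta> A B) C" using skew[OF B C A] ip_sym \<Delta>sym[OF B A] by simp
    finally show ?thesis by simp
  qed
  then have "\<Delta> A B = 0" unfolding ip_def by (rule nondegenerate[OF K \<Delta>E[OF A B]])
  then show ?thesis by (simp add: \<Delta>_def)
qed

end

theorem theorem3:
  fixes n :: nat
    and At :: "('m::t2_space, 'd::finite) chart set"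
    and g\<^sub>0 :: "('m, 'd) chart \<Rightarrow> 'm \<Rightarrow> real^'d^'d"
    and \<mu> :: "'m measure"
    and J\<^sub>0 :: "('m, 'd) field"
  defines "inv\<^sub>2 \<equiv> \<lambda>K. finv At (fid At - K \<odot> K)"
  assumes "CARD('d) = 2 * n"
    and "closed_oriented_manifold At"
    and "riemannian_metric At g\<^sub>0"
    and "riemannian_volume At g\<^sub>0 \<mu>"
    and "J\<^sub>0 \<in> almost_complex At"
  shows
    "(\<forall>K\<in>dom_V At J\<^sub>0. \<forall>A\<in>tangent At J\<^sub>0. \<forall>B\<in>tangent At J\<^sub>0.
        inner_K At \<mu> J\<^sub>0 K A B = 4 * (\<integral>p. ftrace At (inv\<^sub>2 K \<odot> A \<odot> inv\<^sub>2 K \<odot> B) p \<partial>\<mu>)) \<and>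
     (\<exists>\<Gamma>. levi_civita At \<mu> J\<^sub>0 \<Gamma>) \<and>
     (\<forall>\<Gamma>. levi_civita At \<mu> J\<^sub>0 \<Gamma> \<longrightarrow>
        (\<forall>K\<in>dom_V At J\<^sub>0. \<forall>A\<in>tangent At J\<^sub>0. \<forall>B\<in>tangent At J\<^sub>0.
           cov At \<Gamma> (\<lambda>_. A) (\<lambda>_. B) K = A \<odot> K \<odot> inv\<^sub>2 K \<odot> B + B \<odot> K \<odot> inv\<^sub>2 K \<odot> A) \<and>
        (\<forall>K\<in>dom_V At J\<^sub>0. \<forall>A\<in>tangent At J\<^sub>0. \<forall>B\<in>tangent At J\<^sub>0. \<forall>C\<in>tangent At J\<^sub>0.
           curvature At \<Gamma> K A B C =
             - ((fid At - K \<odot> K) \<odot>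
                 commutator (commutator (inv\<^sub>2 K \<odot> A) (inv\<^sub>2 K \<odot> B)) (inv\<^sub>2 K \<odot> C))) \<and>
        (\<forall>A\<in>tangent At J\<^sub>0.
           (let \<gamma>\<^sub>A = (\<lambda>t. ftanh At ((t / 2) \<cdot> A)); T = {t. ftanh_defined At ((t / 2) \<cdot> A)} in
              0 \<in> T \<and> geodesic_on At J\<^sub>0 \<Gamma> T \<gamma>\<^sub>A \<and>
              \<gamma>\<^sub>A 0 = 0 \<and> has_curve_deriv At \<gamma>\<^sub>A ((1 / 2) \<cdot> A) 0 \<and>
              (\<forall>I \<gamma>. is_interval I \<and> 0 \<in> I \<and> geodesic_on At J\<^sub>0 \<Gamma> I \<gamma> \<and>
                  \<gamma> 0 = 0 \<and> has_curve_deriv At \<gamma> ((1 / 2) \<cdot> A) 0 \<longrightarrow>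
                  I \<subseteq> T \<and> (\<forall>t\<in>I. \<gamma> t = \<gamma>\<^sub>A t)))))"
proof -
  interpret riemannian_point At J\<^sub>0 g\<^sub>0 \<mu>
    by unfold_locales fact+
  have main: "cov At \<Gamma> (\<lambda>_. A) (\<lambda>_. B) K = A \<odot> K \<odot> inv\<^sub>2 K \<odot> B + B \<odot> K \<odot> inv\<^sub>2 K \<odot> A"
    if "levi_civita At \<mu> J\<^sub>0 \<Gamma>" "K \<in> dom_V At J\<^sub>0" "A \<in> tangent At J\<^sub>0" "B \<in> tangent At J\<^sub>0" for \<Gamma> K A B
    using levi_civita_unique[OF that] that(4) by (simp add: cov_const Gam_def inv\<^sub>2_def)
  have geo: "let \<gamma>\<^sub>A = (\<lambda>t. ftanh At ((t / 2) \<cdot> A)); T = {t. ftanh_defined At ((t / 2) \<cdot> A)} in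
              0 \<in> T \<and> geodesic_on At J\<^sub>0 \<Gamma> T \<gamma>\<^sub>A \<and>
              \<gamma>\<^sub>A 0 = 0 \<and> has_curve_deriv At \<gamma>\<^sub>A ((1 / 2) \<cdot> A) 0 \<and>
              (\<forall>I \<gamma>. is_interval I \<and> 0 \<in> I \<and> geodesic_on At J\<^sub>0 \<Gamma> I \<gamma> \<and>
                  \<gamma> 0 = 0 \<and> has_curve_deriv At \<gamma> ((1 / 2) \<cdot> A) 0 \<longrightarrow>
                  I \<subseteq> T \<and> (\<forall>t\<in>I. \<gamma> t = \<gamma>\<^sub>A t))"
    if LC: "levi_civita At \<mu> J\<^sub>0 \<Gamma>" and A: "A \<in> tangent At J\<^sub>0" for \<Gamma> A
    unfolding Let_def
  proof (intro conjI allI impI)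
    note \<Gamma> = levi_civita_unique[OF LC]
    show 0: "0 \<in> tanh_dom A" by (rule tanh_curve_0(1))
    show "geodesic_on At J\<^sub>0 \<Gamma> (tanh_dom A) (tanh_curve A)" by (rule geodesic_tanh_curve[OF \<Gamma> A])
    show c0: "tanh_curve A 0 = 0" by (rule tanh_curve_0(2)[OF A])
    show "has_curve_deriv At (tanh_curve A) ((1 / 2) \<cdot> A) 0"
      \<comment> \<open>At parameter 0 the curve vanishes, so the quadratic term of
        \<open>tanh_vel\<close> drops out and \<open>(1 / 2) \<cdot> A\<close> remains.\<close>
      using fderivD(4)[OF fderiv_tanh_curve[OF A 0]] unfolding c0 by (simp add: fcomp_simps)
    fix I \<gamma>
    assume "is_interval I \<and> 0 \<in> I \<and> geodesic_on At J\<^sub>0 \<Gamma> I \<gamma> \<and> \<gamma> 0 = 0 \<and> has_curve_deriv At \<gamma> ((1 / 2) \<cdot> A) 0"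
    then have I: "is_interval I" "0 \<in> I" "geodesic_on At J\<^sub>0 \<Gamma> I \<gamma>" "\<gamma> 0 = 0" "has_curve_deriv At \<gamma> ((1 / 2) \<cdot> A) 0"
      by auto
    note uniq = geodesic_unique[OF \<Gamma> A I]
    show "I \<subseteq> tanh_dom A" using uniq(1) by blast
    show "\<forall>t\<in>I. \<gamma> t = tanh_curve A t" using uniq(2) by blast
  qed
  have curv: "curvature At \<Gamma> K A B C = - ((fid At - K \<odot> K) \<odot>
      commutator (commutator (inv\<^sub>2 K \<odot> A) (inv\<^sub>2 K \<odot> B)) (inv\<^sub>2 K \<odot> C))"
    if LC: "levi_civita At \<mu> J\<^sub>0 \<Gamma>" and "K \<in> dom_V At J\<^sub>0" "A \<in> tangent At J\<^sub>0" "B \<in> tangent At J\<^sub>0" "C \<in> tangent At J\<^sub>0"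
    for \<Gamma> K A B C
    unfolding inv\<^sub>2_def by (rule curvature_Gam[OF levi_civita_unique[OF LC]]) (use that in auto)
  have inner: "inner_K At \<mu> J\<^sub>0 K A B = 4 * (\<integral>p. ftrace At (inv\<^sub>2 K \<odot> A \<odot> inv\<^sub>2 K \<odot> B) p \<partial>\<mu>)"
    if "K \<in> dom_V At J\<^sub>0" "A \<in> tangent At J\<^sub>0" "B \<in> tangent At J\<^sub>0" for K A B
    unfolding inv\<^sub>2_def by (rule inner_K_eq[OF that])
  show ?thesis
    by (intro conjI ballI allI impI exI[of _ Gam] levi_civita_Gam inner main curv geo)
qed

end
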